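(* Let $p$ be a prime and let $a$ be a positive integer. If $k$ is a positive integer such that (1) $k=p^a$, or (2) $k=2p^a$, or (3) $k=3p^a$, or (4) $k=6p^a$, or (5) $k=45$, then $Sp_{2k}(2)$ is not generated invariably by two elements of prime order; that is, there do not exist elements $g,h \in Sp_{2k}(2)$, each of prime order, such that $g,h$ generate $Sp_{2k}(2)$ invariably.
   Context: $Sp_{2k}(2)$ denotes the symplectic group, i.e. the group of all linear isometries of a nondegenerate alternating bilinear form on $\mathbb{F}_2^{2k}$. Elements $g_1,\ldots,g_m$ of a group $G$ generate $G$ invariably if $\langle x_1^{-1}g_1x_1,\ldots,x_m^{-1}g_mx_m\rangle = G$ for all $x_1,\ldots,x_m\in G$. The two elements in the theorem may have equal or different prime orders. *)

theory Defs
  imports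
    "Jordan_Normal_Form.Matrix"
    "HOL-Library.Z2"
    "HOL-Algebra.Generated_Groups"
    "HOL-Algebra.Multiplicative_Group"
    "HOL-Computational_Algebra.Primes"
begin

text \<open>
  Forms on the space \<^term>\<open>carrier_vec n\<close> of column vectors; a form is a function
  on all of \<^typ>\<open>'a vec\<close>, but only its values on \<^term>\<open>carrier_vec n\<close> matter.
\<close>

definition bilinear_form :: "nat \<Rightarrow> ('a::field vec \<Rightarrow> 'a vec \<Rightarrow> 'a) \<Rightarrow> bool" where
  "bilinear_form n \<omega> \<longleftrightarrow>
     (\<forall>u \<in> carrier_vec n. \<forall>v \<in> carrier_vec n. \<forall>w \<in> carrier_vec n.
        \<omega> (u + v) w = \<omega> u w + \<omega> v w \<and> \<omega> w (u + v) = \<omega> w u + \<omega> w v) \<and>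
     (\<forall>c. \<forall>u \<in> carrier_vec n. \<forall>v \<in> carrier_vec n.
        \<omega> (c \<cdot>\<^sub>v u) v = c * \<omega> u v \<and> \<omega> u (c \<cdot>\<^sub>v v) = c * \<omega> u v)"

definition alternating_form :: "nat \<Rightarrow> ('a::field vec \<Rightarrow> 'a vec \<Rightarrow> 'a) \<Rightarrow> bool" where
  "alternating_form n \<omega> \<longleftrightarrow> (\<forall>v \<in> carrier_vec n. \<omega> v v = 0)"

text \<open>The left radical is trivial; for alternating forms it equals the right radical.\<close>

definition nondegenerate_form :: "nat \<Rightarrow> ('a::field vec \<Rightarrow> 'a vec \<Rightarrow> 'a) \<Rightarrow> bool" where
  "nondegenerate_form n \<omega> \<longleftrightarrow>
     (\<forall>u \<in> carrier_vec n. (\<forall>v \<in> carrier_vec n. \<omega> u v = 0) \<longrightarrow> u = 0\<^sub>v n)"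

definition symplectic_form :: "nat \<Rightarrow> ('a::field vec \<Rightarrow> 'a vec \<Rightarrow> 'a) \<Rightarrow> bool" where
  "symplectic_form n \<omega> \<longleftrightarrow>
     bilinear_form n \<omega> \<and> alternating_form n \<omega> \<and> nondegenerate_form n \<omega>"

text \<open>
  The group of linear isometries of \<open>\<omega>\<close>, its elements being written as matrices. For a
  symplectic form on \<^term>\<open>carrier_vec (2 * k) :: bit vec set\<close> this is $Sp_{2k}(2)$.
\<close>

definition isometry_group :: "nat \<Rightarrow> ('a::field vec \<Rightarrow> 'a vec \<Rightarrow> 'a) \<Rightarrow> 'a mat monoid" where
  "isometry_group n \<omega> =
     \<lparr>carrier = {A \<in> carrier_mat n n. invertible_mat A \<and>
        (\<forall>u \<in> carrier_vec n. \<forall>v \<in> carrier_vec n. \<omega> (A *\<^sub>v u) (A *\<^sub>v v) = \<omega> u v)},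
      mult = (*), one = 1\<^sub>m n\<rparr>"

definition invariably_generates :: "('a, 'b) monoid_scheme \<Rightarrow> 'a list \<Rightarrow> bool" where
  "invariably_generates G gs \<longleftrightarrow>
     set gs \<subseteq> carrier G \<and>
     (\<forall>xs. length xs = length gs \<and> set xs \<subseteq> carrier G \<longrightarrow>
        generate G {inv\<^bsub>G\<^esub> (xs ! i) \<otimes>\<^bsub>G\<^esub> gs ! i \<otimes>\<^bsub>G\<^esub> xs ! i | i. i < length gs} = carrier G)"

lemma invariably_generates_pair:
  "invariably_generates G [g, h] \<longleftrightarrow>
     g \<in> carrier G \<and> h \<in> carrier G \<and>
     (\<forall>x \<in> carrier G. \<forall>y \<in> carrier G.
        generate G {inv\<^bsub>G\<^esub> x \<otimes>\<^bsub>G\<^esub> g \<otimes>\<^bsub>G\<^esub> x, inv\<^bsub>G\<^esub> y \<otimes>\<^bsub>G\<^esub> h \<otimes>\<^bsub>G\<^esub> y} = carrier G)"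
proof -
  have eq: "{inv\<^bsub>G\<^esub> ([x, y] ! i) \<otimes>\<^bsub>G\<^esub> [g, h] ! i \<otimes>\<^bsub>G\<^esub> [x, y] ! i | i. i < length [g, h]} =
      {inv\<^bsub>G\<^esub> x \<otimes>\<^bsub>G\<^esub> g \<otimes>\<^bsub>G\<^esub> x, inv\<^bsub>G\<^esub> y \<otimes>\<^bsub>G\<^esub> h \<otimes>\<^bsub>G\<^esub> y}" for x y
    by (auto simp: less_Suc_eq numeral_2_eq_2 intro: exI[of _ 0] exI[of _ 1])
  have all: "(\<forall>xs. length xs = length [g, h] \<and> set xs \<subseteq> carrier G \<longrightarrow> P xs) \<longleftrightarrow>
      (\<forall>x \<in> carrier G. \<forall>y \<in> carrier G. P [x, y])" for P
    by (auto simp: length_Suc_conv)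
  show ?thesis
    unfolding invariably_generates_def all eq by auto
qed

lemma group_isometry_group: "group (isometry_group n \<omega>)"
proof (rule groupI)
  fix A B assume "A \<in> carrier (isometry_group n \<omega>)" "B \<in> carrier (isometry_group n \<omega>)"
  then have A: "A \<in> carrier_mat n n" "invertible_mat A"
      "\<And>u v. u \<in> carrier_vec n \<Longrightarrow> v \<in> carrier_vec n \<Longrightarrow> \<omega> (A *\<^sub>v u) (A *\<^sub>v v) = \<omega> u v"
    and B: "B \<in> carrier_mat n n" "invertible_mat B"
      "\<And>u v. u \<in> carrier_vec n \<Longrightarrow> v \<in> carrier_vec n \<Longrightarrow> \<omega> (B *\<^sub>v u) (B *\<^sub>v v) = \<omega> u v"
    by (auto simp: isometry_group_def)
  have "invertible_mat (A * B)"
  proof -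
    obtain A' where A': "A * A' = 1\<^sub>m n" "A' * A = 1\<^sub>m (dim_row A')"
      using A by (auto simp: invertible_mat_def inverts_mat_def)
    obtain B' where B': "B * B' = 1\<^sub>m n" "B' * B = 1\<^sub>m (dim_row B')"
      using B by (auto simp: invertible_mat_def inverts_mat_def)
    have cA: "A' \<in> carrier_mat n n" and cB: "B' \<in> carrier_mat n n"
      using A' B' A(1) B(1)
      by (metis carrier_matI carrier_matD(2) index_mult_mat(3) index_one_mat(3))+
    have "A * B * (B' * A') = A * (B * B') * A'"
      using A(1) B(1) cA cB by (simp add: assoc_mult_mat[of _ n n _ n _ n])
    then have 1: "A * B * (B' * A') = 1\<^sub>m n"
      using A(1) A'(1) B'(1) by simp
    have "B' * A' * (A * B) = B' * (A' * A) * B"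
      using A(1) B(1) cA cB by (simp add: assoc_mult_mat[of _ n n _ n _ n])
    then have 2: "B' * A' * (A * B) = 1\<^sub>m n"
      using B(1) cA cB A'(2) B'(2) by simp
    show ?thesis
      using 1 2 A(1) B(1) cB unfolding invertible_mat_def inverts_mat_def square_mat.simps
      by (metis carrier_matD index_mult_mat(2,3))
  qed
  then show "A \<otimes>\<^bsub>isometry_group n \<omega>\<^esub> B \<in> carrier (isometry_group n \<omega>)"
    using A(1,3) B(1,3) by (auto simp: isometry_group_def assoc_mult_mat_vec[of _ n n _ n])
next
  show "\<one>\<^bsub>isometry_group n \<omega>\<^esub> \<in> carrier (isometry_group n \<omega>)"
    by (auto simp: isometry_group_def invertible_mat_def inverts_mat_def
        intro!: exI[of _ "1\<^sub>m n"])
next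
  fix A assume "A \<in> carrier (isometry_group n \<omega>)"
  then have A: "A \<in> carrier_mat n n" "invertible_mat A"
      "\<And>u v. u \<in> carrier_vec n \<Longrightarrow> v \<in> carrier_vec n \<Longrightarrow> \<omega> (A *\<^sub>v u) (A *\<^sub>v v) = \<omega> u v"
    by (auto simp: isometry_group_def)
  obtain A' where A': "A * A' = 1\<^sub>m n" "A' * A = 1\<^sub>m (dim_row A')"
    using A by (auto simp: invertible_mat_def inverts_mat_def)
  have cA: "A' \<in> carrier_mat n n"
    using A' A(1)
    by (metis carrier_matI carrier_matD(2) index_mult_mat(3) index_one_mat(3))
  have "invertible_mat A'"
    using A' A(1) cA by (auto simp: invertible_mat_def inverts_mat_def)
  moreover have "\<omega> (A' *\<^sub>v u) (A' *\<^sub>v v) = \<omega> u v"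
    if "u \<in> carrier_vec n" "v \<in> carrier_vec n" for u v
  proof -
    have "A *\<^sub>v (A' *\<^sub>v w) = w" if "w \<in> carrier_vec n" for w
      using that A(1) cA A'(1) by (metis assoc_mult_mat_vec one_mult_mat_vec)
    then show ?thesis
      using A(3)[of "A' *\<^sub>v u" "A' *\<^sub>v v"] that cA by simp
  qed
  ultimately show "\<exists>B \<in> carrier (isometry_group n \<omega>).
      B \<otimes>\<^bsub>isometry_group n \<omega>\<^esub> A = \<one>\<^bsub>isometry_group n \<omega>\<^esub>"
    using cA A'(2) by (auto simp: isometry_group_def intro!: bexI[of _ A'])
qed (auto simp: isometry_group_def)

lemma symplectic_form_exists:
  "\<exists>\<omega> :: 'a::field vec \<Rightarrow> 'a vec \<Rightarrow> 'a. symplectic_form (2 * k) \<omega>"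
proof -
  define \<omega> :: "'a vec \<Rightarrow> 'a vec \<Rightarrow> 'a" where
    "\<omega> = (\<lambda>u v. \<Sum>i<k. u $ i * v $ (k + i) - u $ (k + i) * v $ i)"
  have "bilinear_form (2 * k) \<omega>"
    by (auto simp: bilinear_form_def \<omega>_def sum.distrib[symmetric] sum_distrib_left
        algebra_simps intro!: sum.cong)
  moreover have "alternating_form (2 * k) \<omega>"
    by (simp add: alternating_form_def \<omega>_def mult.commute)
  moreover have "nondegenerate_form (2 * k) \<omega>"
    unfolding nondegenerate_form_def
  proof (intro ballI impI)
    fix u :: "'a vec"
    assume u: "u \<in> carrier_vec (2 * k)" and z: "\<forall>v \<in> carrier_vec (2 * k). \<omega> u v = 0"
    have 1: "u $ j = 0" if j: "j < k" for j
    proof -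
      have "\<omega> u (unit_vec (2 * k) (k + j)) = (\<Sum>i<k. if i = j then u $ i else 0)"
        unfolding \<omega>_def using j by (intro sum.cong) (auto simp: unit_vec_def)
      then show ?thesis using z j by simp
    qed
    have 2: "u $ (k + j) = 0" if j: "j < k" for j
    proof -
      have "\<omega> u (unit_vec (2 * k) j) = (\<Sum>i<k. if i = j then - (u $ (k + i)) else 0)"
        unfolding \<omega>_def using j by (intro sum.cong) (auto simp: unit_vec_def)
      then show ?thesis using z j by simp
    qed
    have "u $ i = 0" if "i < 2 * k" for i
      using 1[of i] 2[of "i - k"] that by (cases "i < k") auto
    then show "u = 0\<^sub>v (2 * k)" using u by auto
  qed
  ultimately show ?thesis unfolding symplectic_form_def by blast
qed

end

theory Submission
  imports Defs "HOL-Algebra.Algebraic_Closure_Type" "HOL-Number_Theory.Number_Theory"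
    "HOL-Library.Product_Plus" "HOL-Library.Function_Algebras"
begin

text \<open>
  Let \<open>V\<close> be the symplectic space. An isometry \<open>g\<close> always preserves a quadratic form \<open>q\<close>
  polarising to the symplectic form, and two such quadratic forms are conjugate under the
  symplectic group as soon as their Gauss sums, which are \<open>2\<^sup>k\<close> or \<open>- (2\<^sup>k)\<close>, agree. So if
  \<open>g\<close> and \<open>h\<close> preserve forms of the same sign, conjugates of them lie in a common orthogonal
  group. Otherwise every form preserved by \<open>g\<close> has the same sign and every form preserved by
  \<open>h\<close> the opposite one. Then these forms vanish at the fixed vectors. Say that \<open>g\<close> belongs to the
  sign \<open>-\<close>. The Gauss sum of an involution of this kind is positive, so \<open>g\<close> has odd prime order
  \<open>r\<close>, fixes no nonzero vector, and \<open>r\<close> divides \<open>2\<^sup>k + 1\<close>; likewise \<open>h\<close> is an involution or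
  has odd prime order \<open>s\<close> dividing \<open>2\<^sup>k - 1\<close>.

  In this case conjugates of \<open>g\<close> and \<open>h\<close> lie in a common extension field subgroup
  \<open>Sp(2k/b, 2\<^sup>b).b\<close> with \<open>b\<close> prime. This means that each of them commutes with (or, if it is an
  involution, is semilinear for) a self-adjoint operator annihilated by an irreducible
  polynomial of degree \<open>b\<close>, because all pairs of a symplectic space and such an operator with
  the same dimension and polynomial are isomorphic. If \<open>b\<close> divides \<open>e = ord r 4\<close>, the operator
  is a polynomial in the sum of \<open>g\<close> and its inverse. If \<open>2 * e = r - 1\<close>, that sum satisfies an
  irreducible polynomial of degree \<open>e\<close>, so \<open>V\<close> is a power of one block, and it is isomorphic
  to the tensor product of a smaller power with a field of degree \<open>b\<close>. The form of \<open>k\<close> guarantees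
  that one prime \<open>b\<close> serves both \<open>g\<close> and \<open>h\<close>.
\<close>

text \<open>Self-adjointness replaces forms over extension fields: if \<open>T\<close> is
  self-adjoint and satisfies an irreducible polynomial of degree b, the given form is the trace of
  an alternating form over the field with 2^b elements, and isometries commuting with
  \<open>T\<close> preserve that form. The sum of \<open>g\<close> and its inverse is self-adjoint,
  \<open>g\<close> itself is not. This is why the order of 4 modulo \<open>r\<close> governs
  everything: it is the degree of x + 1/x for a root of unity x of order \<open>r\<close>. The
  obstacle is that \<open>ord r 4\<close> and \<open>ord s 4\<close>, both divisors of
  \<open>k\<close>, may be coprime, so that the fields generated by the two sums have only the prime
  field in common. If \<open>2 * ord r 4 = r - 1\<close>, all the values x + 1/x are conjugate, and
  the isometry commutes with a field of any prime degree dividing \<open>k\<close>. For the listed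
  \<open>k\<close>, coprime orders always include one of this kind: its prime is 3, 5, 7 or 13, or,
  for 45, possibly 11 or 19. Bases and dimensions are avoided: character sums count subspaces, and
  isometries are obtained as graphs of maximal size.\<close>

hide_const (open) Divisibility.irreducible Divisibility.prime

declare add_bit_eq_xor [simp del] mult_bit_eq_and [simp del] power_bit_unfold [simp del]

lemma bit_add_self [simp]: "x + x = (0::bit)"
  by (cases x) (simp_all add: add_bit_eq_xor)

lemma bit_mult_self [simp]: "x * x = (x::bit)"
  by (cases x) simp_all

subsection \<open>Polynomials over the field of two elements\<close>

text \<open>A nonzero combination of \<open>f\<close> and \<open>p\<close> of least degree divides
  all combinations, in particular \<open>f\<close> and \<open>p\<close>. As \<open>f\<close> is
  irreducible, it is a unit or an associate of \<open>f\<close>, and the latter would make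
  \<open>f\<close> divide \<open>p\<close>.\<close>

lemma irreducible_bezout:
  fixes f p :: "'a::field poly"
  assumes "irreducible f" "\<not> f dvd p"
  obtains u v where "u * f + v * p = 1"
proof -
  define I where "I = {d. d \<noteq> 0 \<and> (\<exists>u v. d = u * f + v * p)}"
  have "f = 1 * f + 0 * p" by simp
  then have "f \<in> I"
    using assms(1) unfolding I_def Factorial_Ring.irreducible_def by blast
  then obtain d where d: "d \<in> I" "\<And>e. e \<in> I \<Longrightarrow> degree d \<le> degree e"
    using ex_has_least_nat[of "\<lambda>d. d \<in> I" f degree] by blast
  obtain u v where uv: "d = u * f + v * p" and d0: "d \<noteq> 0"
    using d(1) by (auto simp: I_def)
  have dvd: "d dvd e" if ex: "\<exists>u v. e = u * f + v * p" for e
  proof (rule ccontr)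
    assume "\<not> d dvd e"
    then have nz: "e mod d \<noteq> 0" by (simp add: dvd_eq_mod_eq_0)
    obtain u' v' where e: "e = u' * f + v' * p" using ex by blast
    have "e mod d = e - (e div d) * d" by (simp add: minus_div_mult_eq_mod)
    also have "\<dots> = (u' - (e div d) * u) * f + (v' - (e div d) * v) * p"
      by (simp add: e uv algebra_simps)
    finally have "e mod d \<in> I" using nz unfolding I_def by blast
    then have "degree d \<le> degree (e mod d)" by (rule d(2))
    moreover have "degree (e mod d) < degree d"
      using degree_mod_less[OF d0, of e] nz by auto
    ultimately show False by simp
  qed
  have "p = 0 * f + 1 * p" by simp
  then have "d dvd p" using dvd by blast
  have "d dvd f" using dvd \<open>f = 1 * f + 0 * p\<close> by blast
  from \<open>d dvd f\<close> obtain e where e: "f = d * e" by (auto simp: dvd_def)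
  have "\<not> e dvd 1"
  proof
    assume "e dvd 1"
    then have "f dvd d" using e by simp
    then show False using \<open>d dvd p\<close> assms(2) dvd_trans by blast
  qed
  then have "d dvd 1" using assms(1) e by (auto simp: Factorial_Ring.irreducible_def)
  then obtain w where "1 = d * w" by (auto simp: dvd_def)
  then have "(w * u) * f + (w * v) * p = 1" by (simp add: uv algebra_simps)
  then show ?thesis by (rule that)
qed

lemma irreducible_dvd_exists:
  fixes p :: "'a::field poly"
  assumes "degree p > 0"
  obtains f where "irreducible f" "f dvd p"
proof -
  define I where "I = {d. d dvd p \<and> degree d > 0}"
  have "p \<in> I" using assms by (simp add: I_def)
  then obtain d where d: "d \<in> I" "\<And>e. e \<in> I \<Longrightarrow> degree d \<le> degree e"
    using ex_has_least_nat[of "\<lambda>d. d \<in> I" p degree] by blast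
  have "irreducible d"
  proof (rule Factorial_Ring.irreducibleI)
    show "d \<noteq> 0" using d(1) by (auto simp: I_def)
    show "\<not> d dvd 1"
      using d(1) by (auto simp: I_def is_unit_iff_degree \<open>d \<noteq> 0\<close>)
    fix a b assume ab: "d = a * b"
    have nz: "a \<noteq> 0" "b \<noteq> 0" using \<open>d \<noteq> 0\<close> ab by auto
    have deg: "degree d = degree a + degree b" using ab nz by (simp add: degree_mult_eq)
    have "degree a = 0 \<or> degree b = 0"
    proof (rule ccontr)
      assume *: "\<not> ?thesis"
      then have "a \<in> I" using ab d(1) by (auto simp: I_def intro: dvd_trans)
      then show False using d(2)[of a] deg * by simp
    qed
    then show "a dvd 1 \<or> b dvd 1"
      using nz by (auto simp: is_unit_iff_degree)
  qed
  then show ?thesis using that d(1) by (auto simp: I_def)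
qed

lemma card_poly_degree_less:
  assumes "n > 0"
  shows "finite {p :: bit poly. degree p < n}" "card {p :: bit poly. degree p < n} = 2 ^ n"
proof -
  define F :: "nat set \<Rightarrow> bit poly" where "F = (\<lambda>S. \<Sum>i\<in>S. monom 1 i)"
  have co: "coeff (F S) i = (if i \<in> S then 1 else 0)" if "finite S" for S i
    using that by (simp add: F_def coeff_sum)
  have "bij_betw F (Pow {..<n}) {p. degree p < n}"
  proof (rule bij_betw_byWitness[where f' = "\<lambda>p. {i. coeff p i = 1}"])
    have "{i. coeff (F a) i = 1} = a" if "a \<subseteq> {..<n}" for a
      using that finite_subset[OF that] by (auto simp: co)
    then show "\<forall>a\<in>Pow {..<n}. {i. coeff (F a) i = 1} = a" by blast
    show "\<forall>p\<in>{p. degree p < n}. F {i. coeff p i = 1} = p"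
    proof
      fix p :: "bit poly" assume "p \<in> {p. degree p < n}"
      have "finite {i. coeff p i = 1}"
        by (rule finite_subset[of _ "{..degree p}"]) (auto intro: le_degree)
      then show "F {i. coeff p i = 1} = p" by (auto simp: poly_eq_iff co)
    qed
    show "F ` Pow {..<n} \<subseteq> {p. degree p < n}"
    proof safe
      fix S assume "S \<subseteq> {..<n}"
      then have "finite S" by (rule finite_subset) simp
      then have "\<forall>i\<ge>n. coeff (F S) i = 0"
        using \<open>S \<subseteq> {..<n}\<close> co by (auto simp: subset_iff)
      then show "degree (F S) < n" using assms
        by (metis degree_lessI)
    qed
    have "{i. coeff p i = 1} \<subseteq> {..<n}" if "degree p < n" for p :: "bit poly"
      using that le_degree[of p] by (auto dest: le_less_trans)
    then show "(\<lambda>p :: bit poly. {i. coeff p i = 1}) ` {p. degree p < n} \<subseteq> Pow {..<n}" by blast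
  qed
  then show "finite {p :: bit poly. degree p < n}" "card {p :: bit poly. degree p < n} = 2 ^ n"
    using bij_betw_finite bij_betw_same_card by (force, metis card_Pow card_lessThan finite_lessThan)
qed

section \<open>Finite fields inside one algebraic closure\<close>

definition ev :: "bit alg_closure \<Rightarrow> bit poly \<Rightarrow> bit alg_closure" where
  "ev \<alpha> p = poly (map_poly to_ac p) \<alpha>"

lemma ev_pCons [simp]: "ev \<alpha> (pCons a p) = to_ac a + \<alpha> * ev \<alpha> p"
  by (simp add: ev_def map_poly_pCons)

lemma ev_0 [simp]: "ev \<alpha> 0 = 0"
  by (simp add: ev_def)

lemma ev_1 [simp]: "ev \<alpha> 1 = 1"
  by (simp add: one_pCons)

lemma ev_add [simp]: "ev \<alpha> (p + q) = ev \<alpha> p + ev \<alpha> q"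
  by (induction p q rule: poly_induct2) (auto simp: algebra_simps)

lemma ev_smult [simp]: "ev \<alpha> (smult a p) = to_ac a * ev \<alpha> p"
  by (induction p) (auto simp: algebra_simps)

lemma ev_minus [simp]: "ev \<alpha> (- p) = - ev \<alpha> p"
  using ev_smult[of \<alpha> "-1" p] by (simp add: to_ac_minus del: uminus_bit_def)

lemma ev_diff [simp]: "ev \<alpha> (p - q) = ev \<alpha> p - ev \<alpha> q"
  using ev_add[of \<alpha> p "- q"] by simp

lemma ev_mult [simp]: "ev \<alpha> (p * q) = ev \<alpha> p * ev \<alpha> q"
  by (induction p) (auto simp: algebra_simps)

lemma ev_power [simp]: "ev \<alpha> (p ^ n) = ev \<alpha> p ^ n"
  by (induction n) auto

lemma ev_pcompose: "ev \<alpha> (pcompose p q) = ev (ev \<alpha> q) p"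
  by (induction p) (auto simp: pcompose_pCons)

lemma CHAR_bit [simp]: "CHAR(bit) = 2"
  by (rule CHAR_eqI) (auto intro: ccontr elim!: oddE)

lemma ac_frobenius_add: "(x + y :: bit alg_closure) ^ (2 ^ n) = x ^ (2 ^ n) + y ^ (2 ^ n)"
  by (rule freshmans_dream'[where n = n]) simp_all

lemma ev_frobenius: "ev \<alpha> p ^ (2 ^ n) = ev (\<alpha> ^ (2 ^ n)) p"
proof (induction p)
  case (pCons a p)
  have "to_ac a ^ (2 ^ n) = to_ac a" by (cases a) (simp_all add: power_0_left)
  then show ?case using pCons by (simp add: ac_frobenius_add power_mult_distrib)
qed (simp add: power_0_left)

lemma ev_root_exists:
  assumes "degree p > 0"
  obtains \<alpha> where "ev \<alpha> p = 0"
proof -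
  have "degree (map_poly to_ac p) > 0"
    using assms by (simp add: degree_map_poly)
  then obtain \<alpha> where "poly (map_poly to_ac p) \<alpha> = 0"
    using alg_closed_imp_poly_has_root by blast
  then show ?thesis using that by (simp add: ev_def)
qed

lemma degree_irreducible_pos: "irreducible (f :: 'a::field poly) \<Longrightarrow> degree f > 0"
  using is_unit_iff_degree[of f] by (auto simp: Factorial_Ring.irreducible_def intro!: Nat.gr0I)

text \<open>The range of \<open>ev \<alpha>\<close> is a model of the residue field of
  \<open>f\<close>. Inside one algebraic closure the fields belonging to different polynomials can
  be compared as sets.\<close>

locale irreducible_root =
  fixes f :: "bit poly" and \<alpha> :: "bit alg_closure"
  assumes irr: "irreducible f" and root: "ev \<alpha> f = 0"
begin

lemma ev_eq_0_iff: "ev \<alpha> p = 0 \<longleftrightarrow> f dvd p"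
proof
  assume p: "ev \<alpha> p = 0"
  show "f dvd p"
  proof (rule ccontr)
    assume "\<not> f dvd p"
    then obtain u v where "u * f + v * p = 1" using irreducible_bezout[OF irr] by blast
    then have "ev \<alpha> (u * f + v * p) = 1" by simp
    then show False using p root by simp
  qed
qed (auto simp: root)

lemma ev_mod: "ev \<alpha> (p mod f) = ev \<alpha> p"
proof -
  have "ev \<alpha> p = ev \<alpha> (p div f * f + p mod f)" by simp
  also have "\<dots> = ev \<alpha> (p mod f)" unfolding ev_add ev_mult root by simp
  finally show ?thesis ..
qed

lemma range_ev: "range (ev \<alpha>) = ev \<alpha> ` {p. degree p < degree f}"
proof (intro subset_antisym subsetI)
  fix y assume "y \<in> range (ev \<alpha>)"
  then obtain p where "y = ev \<alpha> (p mod f)" by (auto simp: ev_mod)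
  moreover have "degree (p mod f) < degree f"
    using degree_mod_less[of f p] degree_irreducible_pos[OF irr] by fastforce
  ultimately show "y \<in> ev \<alpha> ` {p. degree p < degree f}" by blast
qed auto

lemma card_range_ev: "finite (range (ev \<alpha>))" "card (range (ev \<alpha>)) = 2 ^ degree f"
proof -
  have inj: "inj_on (ev \<alpha>) {p. degree p < degree f}"
  proof (rule inj_onI)
    fix p q assume pq: "p \<in> {p. degree p < degree f}" "q \<in> {p. degree p < degree f}" "ev \<alpha> p = ev \<alpha> q"
    then have "ev \<alpha> (p - q) = 0" by simp
    then have "f dvd p - q" by (simp only: ev_eq_0_iff)
    moreover have "degree (p - q) < degree f" using pq by (simp add: degree_diff_less)
    ultimately show "p = q" using dvd_imp_degree_le[of f "p - q"] by fastforce
  qed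
  show "finite (range (ev \<alpha>))" "card (range (ev \<alpha>)) = 2 ^ degree f"
    unfolding range_ev using card_poly_degree_less[OF degree_irreducible_pos[OF irr]] card_image[OF inj]
    by simp_all
qed

text \<open>Multiplication by a nonzero element permutes the nonzero elements of the finite field;
  comparing their products gives exponent \<open>2 ^ degree f - 1\<close>.\<close>

lemma ev_fermat: "ev \<alpha> p ^ (2 ^ degree f) = ev \<alpha> p"
proof (cases "ev \<alpha> p = 0")
  case False
  define N where "N = range (ev \<alpha>) - {0}"
  define x where "x = ev \<alpha> p"
  have fin: "finite N" using card_range_ev by (simp add: N_def)
  have "0 \<in> range (ev \<alpha>)" using ev_0 by (metis rangeI)
  then have cN: "card N = 2 ^ degree f - 1" using card_range_ev by (simp add: N_def)
  have inj: "inj_on ((*) x) N" using False by (auto simp: inj_on_def x_def)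
  have sub: "(*) x ` N \<subseteq> N"
  proof safe
    fix y assume "y \<in> N"
    then obtain q where "y = ev \<alpha> q" "y \<noteq> 0" by (auto simp: N_def)
    then show "x * y \<in> N" using False unfolding N_def x_def by (auto simp: image_iff intro: exI[of _ "p * q"])
  qed
  have im: "(*) x ` N = N" using fin inj sub by (simp add: endo_inj_surj)
  have "prod id N = prod id ((*) x ` N)" by (simp add: im)
  also have "\<dots> = (\<Prod>y\<in>N. x * y)" using inj by (simp add: prod.reindex)
  also have "\<dots> = x ^ card N * prod id N" by (simp add: prod.distrib)
  finally have "x ^ card N = 1"
    using fin by (auto simp: prod_zero_iff N_def)
  then have "x ^ (2 ^ degree f - 1) * x = x" using cN by simp
  then have "x ^ (Suc (2 ^ degree f - 1)) = x" by (simp only: power_Suc mult.commute)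
  moreover have "Suc (2 ^ degree f - 1) = 2 ^ degree f" by simp
  ultimately show ?thesis by (simp only: x_def)
qed (simp add: power_0_left)

text \<open>By \<open>ev_fermat\<close> the field consists of roots of a polynomial of degree
  \<open>2 ^ degree f\<close>, which has no more roots than the field has elements. Hence the field
  depends on the degree of \<open>f\<close> alone.\<close>

lemma range_ev_eq: "range (ev \<alpha>) = {y. y ^ (2 ^ degree f) = y}"
proof (rule card_seteq)
  define Q :: "bit alg_closure poly" where "Q = monom 1 (2 ^ degree f) - [:0, 1:]"
  have n: "2 ^ degree f > (1::nat)"
    using degree_irreducible_pos[OF irr] by (intro one_less_power) simp_all
  have "coeff Q (2 ^ degree f) = 1" using degree_irreducible_pos[OF irr] by (simp add: Q_def coeff_pCons split: nat.splits)
  then have "Q \<noteq> 0" by auto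
  have "degree Q \<le> 2 ^ degree f" unfolding Q_def
    using less_imp_le[OF n] by (intro degree_diff_le) (use degree_irreducible_pos[OF irr] in \<open>auto simp: degree_monom_eq\<close>)
  have eq: "{y. y ^ (2 ^ degree f) = y} = {y. poly Q y = 0}" by (auto simp: Q_def poly_monom)
  show "finite {y::bit alg_closure. y ^ (2 ^ degree f) = y}"
    unfolding eq using \<open>Q \<noteq> 0\<close> by (rule poly_roots_finite)
  show "range (ev \<alpha>) \<subseteq> {y. y ^ (2 ^ degree f) = y}" using ev_fermat by auto
  show "card {y::bit alg_closure. y ^ (2 ^ degree f) = y} \<le> card (range (ev \<alpha>))"
    unfolding eq card_range_ev
    using card_poly_roots_bound[OF \<open>Q \<noteq> 0\<close>] \<open>degree Q \<le> 2 ^ degree f\<close> by linarith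
qed

end

lemma irreducible_rootE:
  assumes "irreducible f"
  obtains \<alpha> where "irreducible_root f \<alpha>"
  using ev_root_exists[OF degree_irreducible_pos[OF assms]] assms by (metis irreducible_root.intro)

lemma irreducible_dvd_fermat:
  assumes "irreducible (f :: bit poly)"
  shows "f dvd p ^ (2 ^ degree f) - p"
proof -
  obtain \<alpha> where "irreducible_root f \<alpha>" using assms by (rule irreducible_rootE)
  then interpret irreducible_root f \<alpha> .
  show ?thesis using ev_fermat[of p] by (simp flip: ev_eq_0_iff)
qed

lemma power_pow2_iterate:
  fixes x :: "'a::monoid_mult"
  assumes "x ^ (2 ^ b) = x"
  shows "x ^ (2 ^ (b * c)) = x"
proof (induction c)
  case (Suc c)
  have "x ^ (2 ^ (b * Suc c)) = (x ^ (2 ^ b)) ^ (2 ^ (b * c))"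
    by (simp add: power_add power_mult)
  then show ?case using Suc assms by simp
qed simp

text \<open>A root \<beta> of \<open>f\<close> lies in the field with \<open>2 ^ degree f\<close>
  elements, hence in the field generated by a root \<alpha> of \<phi>, and so is a polynomial in
  \<alpha>. For operators: if \<phi> annihilates \<open>A\<close>, then \<open>f\<close> annihilates
  \<open>P\<close> evaluated at \<open>A\<close>.\<close>

lemma irreducible_pcompose_root:
  assumes "irreducible (\<phi> :: bit poly)" "irreducible f" "degree f dvd degree \<phi>"
  obtains P where "\<phi> dvd pcompose f P"
proof -
  obtain \<alpha> where \<alpha>: "irreducible_root \<phi> \<alpha>" using assms(1) by (rule irreducible_rootE)
  obtain \<beta> where \<beta>: "irreducible_root f \<beta>" using assms(2) by (rule irreducible_rootE)
  have "ev \<beta> [:0, 1:] ^ (2 ^ degree f) = ev \<beta> [:0, 1:]"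
    using irreducible_root.ev_fermat[OF \<beta>] .
  then have "\<beta> ^ (2 ^ degree f) = \<beta>" by simp
  then have "\<beta> ^ (2 ^ degree \<phi>) = \<beta>" using assms(3) power_pow2_iterate by (metis dvdE)
  then obtain P where "\<beta> = ev \<alpha> P" using irreducible_root.range_ev_eq[OF \<alpha>] by blast
  then have "ev \<alpha> (pcompose f P) = 0"
    using \<beta> by (simp add: ev_pcompose irreducible_root_def)
  then show ?thesis using that irreducible_root.ev_eq_0_iff[OF \<alpha>] by blast
qed

text \<open>The roots of \<open>Q\<close> are the roots of unity of order dividing
  \<open>2 ^ b - 1\<close>, without 1. Such a root generates a subfield of the field with
  \<open>2 ^ b\<close> elements that is larger than the prime field, and for prime \<open>b\<close>
  this is the whole field.\<close>

lemma irreducible_exists_prime_degree: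
  assumes "prime b"
  obtains f :: "bit poly" where "irreducible f" "degree f = b"
proof -
  define N where "N = (2::nat) ^ b - 1"
  have b: "b \<ge> 2" using assms by (rule prime_ge_2_nat)
  have "(2::nat) ^ 2 \<le> 2 ^ b" using b by (intro power_increasing) auto
  then have N: "N \<ge> 3" "odd N" "Suc N = 2 ^ b" using b by (auto simp: N_def)
  define Q :: "bit poly" where "Q = (\<Sum>i<N. [:0, 1:] ^ i)"
  have evQ: "(\<alpha> - 1) * ev \<alpha> Q = \<alpha> ^ N - 1" for \<alpha>
  proof -
    have "ev \<alpha> (sum g A) = (\<Sum>i\<in>A. ev \<alpha> (g i))" if "finite A" for g and A :: "nat set"
      using that by (induction A) auto
    then have "ev \<alpha> Q = (\<Sum>i<N. \<alpha> ^ i)" by (simp add: Q_def)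
    then show ?thesis by (simp add: power_diff_1_eq)
  qed
  have "coeff Q i = (\<Sum>j<N. if i = j then 1 else 0)" for i
    unfolding Q_def coeff_sum
    by (intro sum.cong) (auto simp flip: monom_altdef[of 1, simplified])
  then have cQ: "coeff Q i = (if i < N then 1 else 0)" for i by simp
  have "degree Q \<ge> 1" using cQ[of 1] N by (intro le_degree) auto
  then obtain f where f: "irreducible f" "f dvd Q" using irreducible_dvd_exists[of Q] by auto
  obtain \<alpha> where \<alpha>: "irreducible_root f \<alpha>" using f(1) by (rule irreducible_rootE)
  then interpret irreducible_root f \<alpha> .
  have Q0: "ev \<alpha> Q = 0" using f(2) ev_eq_0_iff by blast
  then have aN: "\<alpha> ^ N = 1" using evQ[of \<alpha>] by simp
  \<comment> \<open>The value of \<open>Q\<close> at 1 is \<open>N\<close>, which is odd and so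
    nonzero in characteristic 2.\<close>
  have a1: "\<alpha> \<noteq> 1"
  proof
    assume "\<alpha> = 1"
    have "ev 1 (sum g A) = (\<Sum>i\<in>A. ev 1 (g i))" if "finite A" for g and A :: "nat set"
      using that by (induction A) auto
    then have "ev 1 Q = of_nat N" by (simp add: Q_def)
    then have "of_nat N = (0 :: bit alg_closure)" using Q0 \<open>\<alpha> = 1\<close> by simp
    then show False using N by (simp add: of_nat_eq_0_iff_char_dvd)
  qed
  have a0: "\<alpha> \<noteq> 0" using aN N by (auto simp: power_0_left)
  have ab: "\<alpha> ^ (2 ^ b) = \<alpha>" using aN N(3) by (metis mult_1_right power_Suc)
  have an: "\<alpha> ^ (2 ^ degree f) = \<alpha>" using ev_fermat[of "[:0, 1:]"] by simp
  have "range (ev \<alpha>) \<subseteq> {y. y ^ (2 ^ b) = y}"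
    using ev_frobenius ab by auto
  have le: "degree f \<le> b"
  proof -
    define R :: "bit alg_closure poly" where "R = monom 1 (2 ^ b) - [:0, 1:]"
    have n: "2 ^ b > (1::nat)" using b by (intro one_less_power) simp_all
    have "coeff R (2 ^ b) = 1" using b by (simp add: R_def coeff_pCons split: nat.splits)
    then have "R \<noteq> 0" by auto
    have dR: "degree R \<le> 2 ^ b" unfolding R_def
      using less_imp_le[OF n] by (intro degree_diff_le) (use b in \<open>auto simp: degree_monom_eq\<close>)
    have "range (ev \<alpha>) \<subseteq> {y. poly R y = 0}"
      using \<open>range (ev \<alpha>) \<subseteq> _\<close> by (auto simp: R_def poly_monom)
    then have "card (range (ev \<alpha>)) \<le> card {y. poly R y = 0}"
      using \<open>R \<noteq> 0\<close> by (intro card_mono poly_roots_finite)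
    then have "(2::nat) ^ degree f \<le> 2 ^ b"
      using card_range_ev card_poly_roots_bound[OF \<open>R \<noteq> 0\<close>] dR by linarith
    then show ?thesis by simp
  qed
  \<comment> \<open>The powers of Frobenius with exponents \<open>degree f\<close> and
    \<open>b\<close> fix \<alpha>. If these exponents were coprime, Frobenius itself would fix
    \<alpha>, leaving only 0 and 1.\<close>
  have "degree f = b"
  proof (rule ccontr)
    assume "degree f \<noteq> b"
    then have "degree f < b" using le by simp
    then have "coprime (degree f) b"
      using assms degree_irreducible_pos[OF f(1)]
      by (metis coprime_commute nat_dvd_not_less prime_imp_coprime_nat)
    then obtain x y where "degree f * x = b * y + 1"
      using bezout_nat[of "degree f" b] degree_irreducible_pos[OF f(1)] by auto
    moreover have "\<alpha> ^ (2 ^ (degree f * x)) = \<alpha>" using an by (rule power_pow2_iterate)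
    ultimately have "\<alpha> = \<alpha> ^ (2 ^ (b * y + 1))" by metis
    also have "\<dots> = (\<alpha> ^ (2 ^ (b * y))) ^ 2"
      by (simp only: power_add power_one_right flip: power_mult)
    finally have "\<alpha> = (\<alpha> ^ (2 ^ (b * y))) ^ 2" .
    then have "\<alpha> = \<alpha> * \<alpha>" using power_pow2_iterate[OF ab] by (simp add: power2_eq_square)
    then show False using a0 a1 by simp
  qed
  then show ?thesis using f(1) that by blast
qed

section \<open>Roots of an irreducible polynomial modulo a squarefree one\<close>

lemma dvd_pcompose_diff: "(P - Q) dvd (pcompose f P - pcompose f Q)" for f :: "'a::comm_ring_1 poly"
proof (induction f)
  case (pCons a f)
  have "pcompose (pCons a f) P - pcompose (pCons a f) Q
      = (P - Q) * pcompose f P + Q * (pcompose f P - pcompose f Q)"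
    by (simp add: pcompose_pCons algebra_simps)
  then show ?case using pCons by simp
qed simp

text \<open>Chinese remainder theorem: \<open>irreducible_pcompose_root\<close> solves the problem
  modulo each irreducible factor of \<open>M\<close>, and squarefreeness makes the factors coprime,
  so the solutions are glued one factor at a time.\<close>

lemma squarefree_pcompose_root:
  fixes M f :: "bit poly"
  assumes "M \<noteq> 0" "irreducible f"
    and "\<And>\<phi>. irreducible \<phi> \<Longrightarrow> \<phi> dvd M \<Longrightarrow> degree f dvd degree \<phi>"
    and "\<And>\<phi>. irreducible \<phi> \<Longrightarrow> \<not> \<phi> * \<phi> dvd M"
  shows "\<exists>P. M dvd pcompose f P"
  using assms
proof (induction "degree M" arbitrary: M rule: less_induct)
  case less
  show ?case
  proof (cases "degree M = 0")
    case True
    then have "M dvd 1" using less.prems(1) by (simp add: is_unit_iff_degree)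
    then show ?thesis using dvd_trans one_dvd by blast
  next
    case False
    then obtain \<phi> where \<phi>: "irreducible \<phi>" "\<phi> dvd M" using irreducible_dvd_exists[of M] by auto
    then obtain N where N: "M = \<phi> * N" by (auto simp: dvd_def)
    have "N \<noteq> 0" using less.prems(1) N by auto
    have "degree N < degree M"
      using N \<open>N \<noteq> 0\<close> degree_irreducible_pos[OF \<phi>(1)] by (subst N, subst degree_mult_eq) auto
    then obtain P2 where P2: "N dvd pcompose f P2"
      using less.hyps[of N] less.prems \<open>N \<noteq> 0\<close> N by (metis dvd_mult)
    obtain P1 where P1: "\<phi> dvd pcompose f P1"
      using irreducible_pcompose_root[OF \<phi>(1) assms(2)] less.prems(3)[OF \<phi>] by blast
    have "\<not> \<phi> dvd N" using less.prems(4)[OF \<phi>(1)] N by (auto simp: mult_dvd_mono)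
    then obtain u v where uv: "u * \<phi> + v * N = 1" using irreducible_bezout[OF \<phi>(1)] by blast
    \<comment> \<open>As \<open>u * \<phi> + v * N = 1\<close>, this \<open>P\<close> is congruent
      to \<open>P1\<close> modulo \<phi> and to \<open>P2\<close> modulo \<open>N\<close>.\<close>
    define P where "P = v * N * P1 + u * \<phi> * P2"
    have "P - P1 = \<phi> * (u * (P2 - P1))"
    proof -
      have "P - P1 = P - (u * \<phi> + v * N) * P1" by (simp add: uv)
      then show ?thesis by (simp add: P_def algebra_simps)
    qed
    then have "\<phi> dvd P - P1" by simp
    then have "\<phi> dvd pcompose f P - pcompose f P1" using dvd_pcompose_diff dvd_trans by blast
    then have 1: "\<phi> dvd pcompose f P" using P1 by (metis dvd_add diff_add_cancel)
    have "P - P2 = N * (v * (P1 - P2))"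
    proof -
      have "P - P2 = P - (u * \<phi> + v * N) * P2" by (simp add: uv)
      then show ?thesis by (simp add: P_def algebra_simps)
    qed
    then have "N dvd P - P2" by simp
    then have "N dvd pcompose f P - pcompose f P2" using dvd_pcompose_diff dvd_trans by blast
    then have 2: "N dvd pcompose f P" using P2 by (metis dvd_add diff_add_cancel)
    have "\<phi> * N dvd (u * \<phi> + v * N) * pcompose f P"
      unfolding distrib_right using 1 2
      by (intro dvd_add) (metis mult.commute mult.left_commute mult_dvd_mono dvd_triv_left dvd_mult2 dvd_refl mult_dvd_mono)+
    then show ?thesis using uv N by auto
  qed
qed

subsection \<open>Boolean groups and polynomial actions\<close>

text \<open>Vector spaces over the field of two elements, encoded without scalars: subspaces are
  subgroups and linear maps are additive maps.\<close>

class boolean_group = ab_group_add +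
  assumes add_self [simp]: "x + x = 0"
begin

lemma uminus_eq_self [simp]: "- x = x"
  using add_self by (rule minus_unique)

lemma add_self_left [simp]: "x + (x + y) = y"
  by (simp add: add.assoc[symmetric])

lemma add_eq_0_iff_eq [simp]: "x + y = 0 \<longleftrightarrow> x = y"
  using add_eq_0_iff[of x y] by auto

end

instance bit :: boolean_group
  by standard simp

instance "fun" :: (type, boolean_group) boolean_group
  by standard (simp add: fun_eq_iff)

instance prod :: (boolean_group, boolean_group) boolean_group
  by standard (auto simp: prod_eq_iff)

definition subgp :: "'v::boolean_group set \<Rightarrow> bool" where
  "subgp S \<longleftrightarrow> 0 \<in> S \<and> (\<forall>x\<in>S. \<forall>y\<in>S. x + y \<in> S)"

lemma subgp_0: "subgp S \<Longrightarrow> 0 \<in> S"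
  and subgp_add: "subgp S \<Longrightarrow> x \<in> S \<Longrightarrow> y \<in> S \<Longrightarrow> x + y \<in> S"
  by (auto simp: subgp_def)

definition endo :: "'v::boolean_group set \<Rightarrow> ('v \<Rightarrow> 'v) \<Rightarrow> bool" where
  "endo V T \<longleftrightarrow> subgp V \<and> (\<forall>x\<in>V. T x \<in> V) \<and> (\<forall>x\<in>V. \<forall>y\<in>V. T (x + y) = T x + T y)"

lemma endo_subgp: "endo V T \<Longrightarrow> subgp V"
  and endo_closed: "endo V T \<Longrightarrow> x \<in> V \<Longrightarrow> T x \<in> V"
  and endo_add: "endo V T \<Longrightarrow> x \<in> V \<Longrightarrow> y \<in> V \<Longrightarrow> T (x + y) = T x + T y"
  by (auto simp: endo_def)

lemma endo_0: "endo V T \<Longrightarrow> T 0 = 0"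
  using endo_add[of V T 0 0] by (auto simp: endo_def subgp_def)

lemma endo_id: "subgp V \<Longrightarrow> endo V (\<lambda>x. x)"
  by (auto simp: endo_def)

lemma endo_plus: "endo V S \<Longrightarrow> endo V T \<Longrightarrow> endo V (\<lambda>x. S x + T x)"
  by (auto simp: endo_def subgp_def algebra_simps)

lemma endo_funpow: "endo V T \<Longrightarrow> endo V (T ^^ n)"
  by (induction n) (auto simp: endo_def)

definition bsc :: "bit \<Rightarrow> 'v::boolean_group \<Rightarrow> 'v" where
  "bsc c x = (if c = 1 then x else 0)"

lemma bsc_simps [simp]: "bsc 0 x = 0" "bsc 1 x = x" "bsc c 0 = 0"
  by (auto simp: bsc_def)

lemma bsc_add: "bsc (c + d) x = bsc c x + bsc d x"
  by (cases c; cases d) simp_all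

lemma bsc_add_right: "bsc c (x + y) = bsc c x + bsc c y"
  by (cases c) simp_all

lemma bsc_mult: "bsc (c * d) x = bsc c (bsc d x)"
  by (cases c) simp_all

lemma endo_bsc: "endo V T \<Longrightarrow> T (bsc c x) = bsc c (T x)"
  by (cases c) (simp_all add: endo_0)

lemma bsc_closed: "subgp V \<Longrightarrow> x \<in> V \<Longrightarrow> bsc c x \<in> V"
  by (cases c) (auto simp: subgp_0)

text \<open>This is \<open>p\<close> evaluated at the operator \<open>T\<close> by Horner's scheme.
  It turns the space into a module over the polynomial ring; an extension field enters only as the
  polynomials modulo an irreducible \<open>f\<close> that annihilates the module.\<close>

definition act :: "('v \<Rightarrow> 'v) \<Rightarrow> bit poly \<Rightarrow> 'v::boolean_group \<Rightarrow> 'v" where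
  "act T p x = fold_coeffs (\<lambda>a s. bsc a x + T s) p 0"

lemma act_zero [simp]: "act T 0 x = 0"
  by (simp add: act_def)

context
  fixes V :: "'v::boolean_group set" and T
  assumes T: "endo V T"
begin

lemma act_pCons: "act T (pCons a p) x = bsc a x + T (act T p x)"
  by (cases "pCons a p = 0") (auto simp: act_def endo_0[OF T] fold_coeffs_pCons_not_0_0_eq)

lemma act_one: "act T 1 x = x"
  by (simp add: one_pCons act_pCons endo_0[OF T])

lemma act_X: "act T [:0, 1:] x = T x"
  by (simp add: act_pCons endo_0[OF T])

lemma act_closed: "x \<in> V \<Longrightarrow> act T p x \<in> V"
  using T by (induction p) (auto simp: act_pCons bsc_closed endo_def subgp_0 intro: subgp_add)

lemma act_add: "x \<in> V \<Longrightarrow> act T (p + q) x = act T p x + act T q x"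
proof (induction p q rule: poly_induct2)
  case (pCons a p b q)
  then show ?case
    by (simp add: act_pCons bsc_add endo_add[OF T] act_closed add_ac)
qed simp

lemma act_add_right: "x \<in> V \<Longrightarrow> y \<in> V \<Longrightarrow> act T p (x + y) = act T p x + act T p y"
  by (induction p) (simp_all add: act_pCons bsc_add_right endo_add[OF T] act_closed add_ac)

lemma endo_act: "endo V (act T p)"
  using T by (auto simp: endo_def act_closed act_add_right)

lemma act_smult: "act T (smult c p) x = bsc c (act T p x)"
  by (cases c) simp_all

lemma act_mult: "x \<in> V \<Longrightarrow> act T (p * q) x = act T p (act T q x)"
proof (induction p)
  case (pCons a p)
  have "act T (pCons a p * q) x = act T (smult a q) x + act T (pCons 0 (p * q)) x"
    using pCons.prems by (simp add: act_add)
  then show ?case using pCons by (simp add: act_pCons act_smult)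
qed simp

lemma act_X_power: "x \<in> V \<Longrightarrow> act T ([:0, 1:] ^ n) x = (T ^^ n) x"
  by (induction n) (simp_all add: act_one act_mult act_X act_closed del: mult_pCons_left)

lemma act_commute:
  assumes "endo V g" "\<And>x. x \<in> V \<Longrightarrow> g (T x) = T (g x)"
  shows "x \<in> V \<Longrightarrow> g (act T p x) = act T p (g x)"
  by (induction p)
    (simp_all add: act_pCons endo_0[OF assms(1)] endo_add[OF assms(1)] endo_bsc[OF assms(1)]
      bsc_closed[OF endo_subgp[OF T]] act_closed endo_closed[OF T] assms(2))

lemma act_comm: "x \<in> V \<Longrightarrow> act T p (act T q x) = act T q (act T p x)"
  using act_mult[of x p q] act_mult[of x q p] by (simp add: mult.commute)

lemma act_dvd:
  assumes "f dvd p" "\<And>x. x \<in> V \<Longrightarrow> act T f x = 0" "x \<in> V"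
  shows "act T p x = 0"
proof -
  obtain q where "p = q * f" using assms(1) by (auto simp: dvd_def mult.commute)
  then show ?thesis using assms(2,3) by (simp add: act_mult endo_0[OF endo_act])
qed

end

lemma act_pcompose:
  assumes T: "endo V T" and "x \<in> V"
  shows "act T (pcompose f P) x = act (act T P) f x"
proof (induction f)
  case (pCons a f)
  have "act T (pcompose (pCons a f) P) x = act T [:a:] x + act T P (act T (pcompose f P) x)"
    using assms by (simp add: pcompose_pCons act_add[OF T] act_mult[OF T])
  then show ?case
    using pCons by (simp add: act_pCons[OF T] act_pCons[OF endo_act[OF T]] endo_0[OF T])
qed simp

lemma act_intertwine:
  assumes T: "endo V T" and T': "endo W T'"
    and \<sigma>: "\<And>x y. x \<in> V \<Longrightarrow> y \<in> V \<Longrightarrow> \<sigma> (x + y) = \<sigma> x + \<sigma> y" "\<sigma> 0 = 0"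
    and c: "\<And>x. x \<in> V \<Longrightarrow> \<sigma> (T x) = T' (\<sigma> x)" and x: "x \<in> V"
  shows "\<sigma> (act T p x) = act T' p (\<sigma> x)"
proof (induction p)
  case (pCons a p)
  have "\<sigma> (bsc a x) = bsc a (\<sigma> x)" using \<sigma>(2) by (cases a) simp_all
  then show ?case using pCons x
    by (simp add: act_pCons[OF T] act_pCons[OF T'] \<sigma> c bsc_closed endo_subgp[OF T]
        act_closed[OF T] endo_closed[OF T])
qed (simp add: \<sigma>)

lemma act_dvd_vector:
  assumes T: "endo V T" and "x \<in> V" "act T f x = 0" "f dvd p"
  shows "act T p x = 0"
proof -
  obtain q where "p = q * f" using assms(4) by (auto simp: dvd_def mult.commute)
  then show ?thesis using assms by (simp add: act_mult[OF T] endo_0[OF endo_act[OF T]])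
qed

lemma act_unit:
  assumes T: "endo V T" and "irreducible f" "x \<in> V" "act T f x = 0" "\<not> f dvd p"
  obtains q where "act T q (act T p x) = x"
proof -
  obtain u v where uv: "u * f + v * p = 1" using irreducible_bezout[OF assms(2,5)] .
  have "x = act T (u * f + v * p) x" using uv by (simp add: act_one[OF T])
  also have "\<dots> = act T v (act T p x)"
    using assms by (simp add: act_add[OF T] act_mult[OF T] endo_0[OF endo_act[OF T]])
  finally show ?thesis using that by metis
qed

subsection \<open>Symplectic spaces over the field of two elements\<close>

text \<open>The nontrivial additive character of the field of two elements.\<close>

definition chi :: "bit \<Rightarrow> int" where
  "chi b = (if b = 0 then 1 else -1)"

lemma chi_add: "chi (a + b) = chi a * chi b"
  by (cases a; cases b) (simp_all add: chi_def)

lemma chi_0 [simp]: "chi 0 = 1" and chi_1 [simp]: "chi 1 = -1"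
  by (simp_all add: chi_def)

lemma sum_subgp_shift:
  assumes "subgp V" "x \<in> V"
  shows "(\<Sum>y\<in>V. f (y + x)) = (\<Sum>y\<in>V. f y)"
  by (rule sum.reindex_bij_witness[where i = "\<lambda>y. y + x" and j = "\<lambda>y. y + x"])
    (use assms in \<open>auto simp: subgp_add add.assoc\<close>)

text \<open>Orthogonality of characters: translation by an element where \<open>l\<close> is 1
  reverses the sign of the sum.\<close>

lemma sum_chi_additive:
  assumes "subgp W" "finite W" "\<And>x y. x \<in> W \<Longrightarrow> y \<in> W \<Longrightarrow> l (x + y) = l x + (l y :: bit)"
  shows "(\<Sum>w\<in>W. chi (l w)) = (if \<forall>w\<in>W. l w = 0 then int (card W) else 0)"
proof (cases "\<forall>w\<in>W. l w = 0")
  case False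
  then obtain z where z: "z \<in> W" "l z = 1" by auto
  have "(\<Sum>w\<in>W. chi (l w)) = (\<Sum>w\<in>W. chi (l (w + z)))"
    using sum_subgp_shift[OF assms(1) z(1), of "\<lambda>w. chi (l w)"] by simp
  also have "\<dots> = (\<Sum>w\<in>W. - chi (l w))"
    by (intro sum.cong refl) (simp add: assms(3) z chi_add)
  finally show ?thesis using False by (auto simp: sum_negf)
qed simp

text \<open>The space is a finite subset of a type, seen only through \<open>card V\<close> instead
  of a dimension. With a subset rather than the whole type, subspaces, products and tensor powers
  are instances as well.\<close>

locale sympl =
  fixes V :: "'v::boolean_group set" and B :: "'v \<Rightarrow> 'v \<Rightarrow> bit"
  assumes fin: "finite V" and sub: "subgp V"
    and addl: "x \<in> V \<Longrightarrow> y \<in> V \<Longrightarrow> z \<in> V \<Longrightarrow> B (x + y) z = B x z + B y z"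
    and addr: "x \<in> V \<Longrightarrow> y \<in> V \<Longrightarrow> z \<in> V \<Longrightarrow> B z (x + y) = B z x + B z y"
    and alt: "x \<in> V \<Longrightarrow> B x x = 0"
    and nondeg: "x \<in> V \<Longrightarrow> (\<And>y. y \<in> V \<Longrightarrow> B x y = 0) \<Longrightarrow> x = 0"
begin

lemma zero_mem [simp]: "0 \<in> V"
  using sub by (rule subgp_0)

lemma add_mem [simp]: "x \<in> V \<Longrightarrow> y \<in> V \<Longrightarrow> x + y \<in> V"
  using sub by (rule subgp_add)

lemma B_0 [simp]: "x \<in> V \<Longrightarrow> B 0 x = 0" "x \<in> V \<Longrightarrow> B x 0 = 0"
  using addl[of 0 0 x] addr[of 0 0 x] by auto

lemma symm:
  assumes "x \<in> V" "y \<in> V"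
  shows "B x y = B y x"
proof -
  have "B (x + y) (x + y) = (B x x + B x y) + (B y x + B y y)"
    using assms by (simp only: addl addr add_mem ac_simps)
  then have "B x y + B y x = 0" using assms alt by simp
  then show ?thesis by (simp only: add_eq_0_iff_eq)
qed

lemma B_bsc: "x \<in> V \<Longrightarrow> y \<in> V \<Longrightarrow> B (bsc c x) y = c * B x y"
  by (cases c) simp_all

definition perp :: "'v set \<Rightarrow> 'v set" where
  "perp W = {v \<in> V. \<forall>w\<in>W. B v w = 0}"

lemma subgp_perp: "W \<subseteq> V \<Longrightarrow> subgp (perp W)"
  by (auto simp: perp_def subgp_def addl subset_iff)

text \<open>Double counting of the sum of \<open>chi (B v w)\<close> over \<open>v\<close> in
  \<open>V\<close> and \<open>w\<close> in \<open>W\<close>: by orthogonality the sum over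
  \<open>w\<close> survives only for \<open>v\<close> in \<open>perp W\<close>, the sum over
  \<open>v\<close> only for \<open>w = 0\<close>.\<close>

lemma card_perp:
  assumes W: "subgp W" "W \<subseteq> V"
  shows "card W * card (perp W) = card V"
proof -
  have finW: "finite W" using fin W(2) by (rule finite_subset[rotated])
  have "(\<Sum>v\<in>V. \<Sum>w\<in>W. chi (B v w)) = (\<Sum>v\<in>V. if v \<in> perp W then int (card W) else 0)"
  proof (intro sum.cong refl)
    fix v assume "v \<in> V"
    then show "(\<Sum>w\<in>W. chi (B v w)) = (if v \<in> perp W then int (card W) else 0)"
      using sum_chi_additive[OF W(1) finW, of "B v"] W(2) addr by (auto simp: perp_def subset_iff)
  qed
  also have "\<dots> = int (card W * card (perp W))"
  proof -
    have "perp W = {v \<in> V. v \<in> perp W}" by (auto simp: perp_def)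
    then show ?thesis using fin by (simp add: sum.inter_filter[symmetric] mult.commute)
  qed
  finally have 1: "(\<Sum>v\<in>V. \<Sum>w\<in>W. chi (B v w)) = int (card W * card (perp W))" .
  have "(\<Sum>v\<in>V. \<Sum>w\<in>W. chi (B v w)) = (\<Sum>w\<in>W. \<Sum>v\<in>V. chi (B v w))" by (rule sum.swap)
  also have "\<dots> = (\<Sum>w\<in>W. if w = 0 then int (card V) else 0)"
  proof (intro sum.cong refl)
    fix w assume "w \<in> W"
    then have w: "w \<in> V" using W(2) by auto
    have "(\<forall>v\<in>V. B v w = 0) \<longleftrightarrow> w = 0"
      using nondeg[OF w] symm[OF w] w by auto
    then show "(\<Sum>v\<in>V. chi (B v w)) = (if w = 0 then int (card V) else 0)"
      using sum_chi_additive[OF sub fin, of "\<lambda>v. B v w"] w addl by auto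
  qed
  also have "\<dots> = int (card V)" using finW subgp_0[OF W(1)] by simp
  finally show ?thesis using 1 by linarith
qed

lemma card_V_pos: "card V > 0"
  using fin zero_mem by (metis card_gt_0_iff empty_iff)

lemma perp_perp:
  assumes W: "subgp W" "W \<subseteq> V"
  shows "perp (perp W) = W"
proof -
  have P: "subgp (perp W)" "perp W \<subseteq> V" using subgp_perp[OF W(2)] by (auto simp: perp_def)
  have sub: "W \<subseteq> perp (perp W)" using W(2) symm by (auto simp: perp_def subset_iff)
  have "card (perp W) * card (perp (perp W)) = card W * card (perp W)"
    using card_perp[OF W] card_perp[OF P] by simp
  moreover have "card (perp W) > 0" using card_perp[OF W] card_V_pos by (auto intro: Nat.gr0I)
  ultimately have "card (perp (perp W)) = card W" by simp
  then show ?thesis using sub fin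
    by (metis (no_types, lifting) card_subset_eq finite_subset mem_Collect_eq perp_def subsetI)
qed

text \<open>The addition map on \<open>W \<times> perp W\<close> is injective by \<open>nd\<close>,
  and by \<open>card_perp\<close> it then reaches all of \<open>V\<close>.\<close>

lemma perp_split:
  assumes W: "subgp W" "W \<subseteq> V" and nd: "W \<inter> perp W = {0}" and "v \<in> V"
  obtains w u where "w \<in> W" "u \<in> perp W" "v = w + u"
proof -
  have finW: "finite W" "finite (perp W)"
    using fin W(2) by (auto simp: perp_def intro: finite_subset)
  have P: "subgp (perp W)" "perp W \<subseteq> V" using subgp_perp[OF W(2)] by (auto simp: perp_def)
  define F where "F = (\<lambda>(w, u). w + u :: 'v)"
  have "inj_on F (W \<times> perp W)"
  proof (rule inj_onI, clarsimp simp: F_def)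
    fix a b c d assume *: "a \<in> W" "b \<in> perp W" "c \<in> W" "d \<in> perp W" "a + b = c + d"
    have "a + c = b + d"
    proof -
      have "a + c = a + b + b + c" by (simp add: add.assoc)
      also have "\<dots> = b + d" using *(5) by (simp add: ac_simps)
      finally show ?thesis .
    qed
    then have "a + c \<in> W \<inter> perp W"
      using *(1-4) subgp_add[OF W(1), of a c] subgp_add[OF P(1), of b d] by simp
    then have "a + c = 0" using nd by auto
    then show "a = c \<and> b = d" using \<open>a + c = b + d\<close> by auto
  qed
  then have "card (F ` (W \<times> perp W)) = card V"
    using card_perp[OF W] by (simp add: card_image card_cartesian_product)
  moreover have "F ` (W \<times> perp W) \<subseteq> V" using W(2) P(2) by (auto simp: F_def subset_iff)
  ultimately have "F ` (W \<times> perp W) = V" using fin by (simp add: card_subset_eq)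
  then have "v \<in> F ` (W \<times> perp W)" using assms(4) by simp
  then show ?thesis using that by (auto simp: F_def)
qed

text \<open>Take \<open>v\<close> orthogonal to the kernel \<open>K\<close> of \<open>l\<close> but
  not to \<open>W\<close>, which exists by \<open>perp_perp\<close>. Two nonzero functionals over
  the field of two elements agree as soon as one vanishes on the kernel of the other.\<close>

lemma functional_subgp:
  assumes W: "subgp W" "W \<subseteq> V" and l: "\<And>x y. x \<in> W \<Longrightarrow> y \<in> W \<Longrightarrow> l (x + y) = l x + (l y :: bit)"
  obtains v where "v \<in> V" "\<And>w. w \<in> W \<Longrightarrow> l w = B v w"
proof (cases "\<forall>w\<in>W. l w = 0")
  case True
  show ?thesis by (rule that[of 0]) (use True W in auto)
next
  case False
  then obtain z where z: "z \<in> W" "l z = 1" by auto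
  define K where "K = {w \<in> W. l w = 0}"
  have "l 0 = 0" using l[of 0 0] subgp_0[OF W(1)] by simp
  then have K: "subgp K" "K \<subseteq> V" using W l by (auto simp: K_def subgp_def)
  have "\<not> perp K \<subseteq> perp W"
  proof
    assume "perp K \<subseteq> perp W"
    then have "perp (perp W) \<subseteq> perp (perp K)" by (auto simp: perp_def)
    then show False using perp_perp[OF W] perp_perp[OF K] z by (auto simp: K_def)
  qed
  then obtain v where v: "v \<in> perp K" "v \<notin> perp W" by auto
  then obtain w1 where w1: "w1 \<in> W" "B v w1 = 1" by (auto simp: perp_def)
  have vV: "v \<in> V" using v by (simp add: perp_def)
  have "w1 \<notin> K" using v(1) w1 by (auto simp: perp_def)
  then have l1: "l w1 = 1" using w1 by (simp add: K_def)
  have "l w = B v w" if w: "w \<in> W" for w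
  proof (cases "l w = 0")
    case True
    then have "w \<in> K" using w by (simp add: K_def)
    then show ?thesis using v(1) True by (simp add: perp_def)
  next
    case False
    then have "w + w1 \<in> K" using w w1 l1 W l by (simp add: K_def subgp_add)
    then have "B v (w + w1) = 0" using v(1) by (simp add: perp_def)
    then have "B v w = 1" using w w1 W(2) vV by (simp add: addr subset_iff)
    then show ?thesis using False by simp
  qed
  then show ?thesis using that vV by blast
qed

definition selfadj :: "('v \<Rightarrow> 'v) \<Rightarrow> bool" where
  "selfadj T \<longleftrightarrow> endo V T \<and> (\<forall>x\<in>V. \<forall>y\<in>V. B (T x) y = B x (T y))"

definition isom :: "('v \<Rightarrow> 'v) \<Rightarrow> bool" where
  "isom g \<longleftrightarrow> endo V g \<and> (\<forall>x\<in>V. \<forall>y\<in>V. B (g x) (g y) = B x y)"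

lemma selfadj_endo: "selfadj T \<Longrightarrow> endo V T"
  and selfadjD: "selfadj T \<Longrightarrow> x \<in> V \<Longrightarrow> y \<in> V \<Longrightarrow> B (T x) y = B x (T y)"
  by (auto simp: selfadj_def)

lemma isom_endo: "isom g \<Longrightarrow> endo V g"
  and isom_B: "isom g \<Longrightarrow> x \<in> V \<Longrightarrow> y \<in> V \<Longrightarrow> B (g x) (g y) = B x y"
  and isom_closed: "isom g \<Longrightarrow> x \<in> V \<Longrightarrow> g x \<in> V"
  by (auto simp: isom_def endo_def)

lemma isom_id: "isom (\<lambda>x. x)"
  by (simp add: isom_def endo_id sub)

lemma isom_funpow: "isom g \<Longrightarrow> isom (g ^^ n)"
  by (induction n) (auto simp: isom_def endo_def sub)

lemma isom_inj: "isom g \<Longrightarrow> inj_on g V"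
proof (rule inj_onI)
  fix x y assume g: "isom g" and xy: "x \<in> V" "y \<in> V" "g x = g y"
  have "x + y = 0"
  proof (rule nondeg)
    fix z assume z: "z \<in> V"
    have "B (x + y) z = B (g (x + y)) (g z)" using g xy z by (simp add: isom_B)
    also have "g (x + y) = 0" using g xy endo_add[of V g x y] by (simp add: isom_endo)
    finally show "B (x + y) z = 0" using isom_closed[OF g z] by simp
  qed (use xy in auto)
  then show "x = y" by simp
qed

lemma isom_bij: "isom g \<Longrightarrow> bij_betw g V V"
  using isom_inj[of g] isom_closed[of g] fin
  by (auto simp: bij_betw_def endo_inj_surj image_subset_iff)

lemma isom_inverse:
  assumes "isom g"
  obtains g' where "isom g'" "\<And>x. x \<in> V \<Longrightarrow> g' (g x) = x" "\<And>x. x \<in> V \<Longrightarrow> g (g' x) = x"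
proof -
  define g' where "g' = inv_into V g"
  have b: "bij_betw g V V" using isom_bij[OF assms] .
  have 1: "g' (g x) = x" if "x \<in> V" for x
    using b that by (simp add: g'_def bij_betw_def)
  have 2: "g (g' x) = x" "g' x \<in> V" if "x \<in> V" for x
    using b that by (auto simp: g'_def bij_betw_def f_inv_into_f inv_into_into)
  have "g' (x + y) = g' x + g' y" if "x \<in> V" "y \<in> V" for x y
  proof -
    have "g (g' x + g' y) = x + y" using 2 that assms by (simp add: endo_add[OF isom_endo])
    then show ?thesis using 1[of "g' x + g' y"] 2 that by simp
  qed
  moreover have "B (g' x) (g' y) = B x y" if "x \<in> V" "y \<in> V" for x y
    using isom_B[OF assms, of "g' x" "g' y"] 2 that by simp
  ultimately have "isom g'" using 2 sub by (auto simp: isom_def endo_def)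
  then show ?thesis using that 1 2 by blast
qed

lemma selfadj_act: "selfadj T \<Longrightarrow> selfadj (act T p)"
  unfolding selfadj_def
proof safe
  assume T: "endo V T" and a: "\<forall>x\<in>V. \<forall>y\<in>V. B (T x) y = B x (T y)"
  show "endo V (act T p)" using T by (rule endo_act)
  fix x y assume "x \<in> V" "y \<in> V"
  then show "B (act T p x) y = B x (act T p y)"
  proof (induction p arbitrary: x y)
    case (pCons c p)
    have "B (act T (pCons c p) x) y = B (bsc c x) y + B (T (act T p x)) y"
      using pCons.prems
      by (simp add: act_pCons[OF T] addl bsc_closed sub act_closed[OF T] endo_closed[OF T])
    also have "B (bsc c x) y = B x (bsc c y)" using pCons.prems by (cases c) simp_all
    also have "B (T (act T p x)) y = B (act T p x) (T y)"
      using pCons.prems a by (simp add: act_closed[OF T])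
    also have "\<dots> = B x (act T p (T y))"
      using pCons by (simp add: endo_closed[OF T])
    also have "act T p (T y) = T (act T p y)"
      using act_commute[OF T T] pCons.prems by simp
    also have "B x (bsc c y) + B x (T (act T p y)) = B x (act T (pCons c p) y)"
      using pCons.prems
      by (simp add: act_pCons[OF T] addr bsc_closed sub act_closed[OF T] endo_closed[OF T])
    finally show ?case .
  qed simp
qed

end

subsection \<open>Quadratic forms\<close>

lemma ex_max_card:
  assumes "finite V" "A \<subseteq> Pow V" "A \<noteq> {}"
  obtains W where "W \<in> A" "\<And>W'. W' \<in> A \<Longrightarrow> card W' \<le> card W"
proof -
  have fin: "finite (card ` A)" using assms by (meson finite_Pow_iff finite_imageI finite_subset)
  then have "Max (card ` A) \<in> card ` A" using assms(3) by (intro Max_in) auto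
  then obtain W where "W \<in> A" "card W = Max (card ` A)" by auto
  then show ?thesis using that fin by (metis Max_ge imageI)
qed

lemma subgp_extend:
  assumes W: "subgp W"
  shows "subgp (W \<union> (\<lambda>w. w + v) ` W)"
  unfolding subgp_def
proof (intro conjI ballI)
  show "0 \<in> W \<union> (\<lambda>w. w + v) ` W" using W by (simp add: subgp_0)
  fix x y assume xy: "x \<in> W \<union> (\<lambda>w. w + v) ` W" "y \<in> W \<union> (\<lambda>w. w + v) ` W"
  consider "x \<in> W" "y \<in> W" | b where "x \<in> W" "b \<in> W" "y = b + v"
    | a where "a \<in> W" "x = a + v" "y \<in> W" | a b where "a \<in> W" "b \<in> W" "x = a + v" "y = b + v"
    using xy by auto
  then show "x + y \<in> W \<union> (\<lambda>w. w + v) ` W"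
  proof cases
    case 1
    then show ?thesis using subgp_add[OF W] by blast
  next
    case 2
    then have "x + y = (x + b) + v" by (simp add: add.assoc)
    then show ?thesis using 2 subgp_add[OF W] by blast
  next
    case 3
    then have "x + y = (a + y) + v" by (simp add: ac_simps)
    then show ?thesis using 3 subgp_add[OF W] by blast
  next
    case 4
    then have "x + y = a + b" by (simp add: ac_simps)
    moreover have "a + b \<in> W" using 4 subgp_add[OF W] by blast
    ultimately show ?thesis by simp
  qed
qed

lemma additive_sum:
  assumes V: "subgp V" and f: "f 0 = 0" "\<And>x y. x \<in> V \<Longrightarrow> y \<in> V \<Longrightarrow> f (x + y) = f x + f y"
    and g: "\<And>i. i \<in> I \<Longrightarrow> g i \<in> V"
  shows "f (\<Sum>i\<in>I. g i) = (\<Sum>i\<in>I. f (g i))" "(\<Sum>i\<in>I. g i) \<in> V"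
proof -
  have "f (\<Sum>i\<in>I. g i) = (\<Sum>i\<in>I. f (g i)) \<and> (\<Sum>i\<in>I. g i) \<in> V"
    using g
  proof (induction I rule: infinite_finite_induct)
    case (insert i I)
    then show ?case using V by (simp add: f(2) subgp_add)
  qed (use V f(1) subgp_0 in auto)
  then show "f (\<Sum>i\<in>I. g i) = (\<Sum>i\<in>I. f (g i))" "(\<Sum>i\<in>I. g i) \<in> V" by auto
qed

text \<open>Every orbit has exactly \<open>r\<close> elements: if a smaller positive power of
  \<open>g\<close> fixed a point, Bezout would make \<open>g\<close> itself fix it.\<close>

lemma prime_period_card_dvd:
  fixes g :: "'a \<Rightarrow> 'a" and r :: nat
  assumes "finite Y" "prime r" "\<And>x. x \<in> Y \<Longrightarrow> g x \<in> Y" "\<And>x. x \<in> Y \<Longrightarrow> (g ^^ r) x = x"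
    "\<And>x. x \<in> Y \<Longrightarrow> g x \<noteq> x"
  shows "r dvd card Y"
proof -
  define R where "R = {(x, y). x \<in> Y \<and> (\<exists>i. y = (g ^^ i) x)}"
  have cl: "(g ^^ i) x \<in> Y" if "x \<in> Y" for x i using that assms(3) by (induction i) auto
  have per: "(g ^^ (r * i)) x = x" if "x \<in> Y" for x i
    using assms(4)[OF that] by (induction i) (auto simp: funpow_add)
  have md: "(g ^^ i) x = (g ^^ (i mod r)) x" if "x \<in> Y" for x i
  proof -
    have "(g ^^ i) x = (g ^^ (i mod r + r * (i div r))) x" by simp
    also have "\<dots> = (g ^^ (i mod r)) ((g ^^ (r * (i div r))) x)" by (simp only: funpow_add o_apply)
    finally show ?thesis using per[OF that] by simp
  qed
  have r0: "r > 0" using assms(2) prime_gt_0_nat by blast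
  have eq: "equiv Y R"
  proof (rule equivI)
    show "R \<subseteq> Y \<times> Y" using cl by (auto simp: R_def)
    show "refl_on Y R" by (auto simp: refl_on_def R_def cl intro: exI[of _ 0])
    show "sym R"
    proof (rule symI)
      fix x y assume "(x, y) \<in> R"
      then obtain i where i: "x \<in> Y" "y = (g ^^ i) x" by (auto simp: R_def)
      have "(g ^^ ((r - 1) * i)) y = (g ^^ ((r - 1) * i + i)) x" by (simp add: i funpow_add)
      also have "(r - 1) * i + i = r * i" using r0 by (cases r) auto
      finally have "x = (g ^^ ((r - 1) * i)) y" using per[OF i(1)] by simp
      then show "(y, x) \<in> R" using i cl by (auto simp: R_def)
    qed
    show "trans R"
    proof (rule transI)
      fix x y z assume "(x, y) \<in> R" "(y, z) \<in> R"
      then obtain i j where "x \<in> Y" "z = (g ^^ j) ((g ^^ i) x)" by (auto simp: R_def)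
      then have "z = (g ^^ (j + i)) x" by (simp add: funpow_add)
      then show "(x, z) \<in> R" using \<open>x \<in> Y\<close> by (auto simp: R_def)
    qed
  qed
  have "card C = r" if C: "C \<in> Y // R" for C
  proof -
    obtain x where x: "x \<in> Y" "C = R `` {x}" using C by (rule quotientE)
    have "C = (\<lambda>i. (g ^^ i) x) ` {..<r}"
    proof
      show "C \<subseteq> (\<lambda>i. (g ^^ i) x) ` {..<r}"
      proof
        fix y assume "y \<in> C"
        then obtain i where "y = (g ^^ i) x" using x by (auto simp: R_def)
        then have "y = (g ^^ (i mod r)) x" using md[OF x(1)] by simp
        then show "y \<in> (\<lambda>i. (g ^^ i) x) ` {..<r}" using r0 by auto
      qed
    qed (use x in \<open>auto simp: R_def\<close>)
    moreover have "inj_on (\<lambda>i. (g ^^ i) x) {..<r}"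
    proof (rule linorder_inj_onI)
      fix i j assume ij: "i < j" "i \<in> {..<r}" "j \<in> {..<r}"
      show "(g ^^ i) x \<noteq> (g ^^ j) x"
      proof
        assume e: "(g ^^ i) x = (g ^^ j) x"
        define y d where "y = (g ^^ i) x" and "d = j - i"
        have yX: "y \<in> Y" using x cl by (simp add: y_def)
        have "(g ^^ d) y = (g ^^ (d + i)) x" by (simp add: y_def funpow_add)
        then have fd: "(g ^^ d) y = y" using e ij by (simp add: y_def d_def)
        have fdn: "(g ^^ (d * n)) y = y" for n
          using fd by (induction n) (auto simp: funpow_add)
        have "d > 0" "d < r" using ij by (auto simp: d_def)
        then have "coprime d r" using assms(2)
          by (metis coprime_commute nat_dvd_not_less prime_imp_coprime_nat)
        then obtain a b where "d * a = r * b + 1" using bezout_nat[of d r] \<open>d > 0\<close> by auto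
        then have "(g ^^ (1 + r * b)) y = y" using fdn[of a] by (simp add: ac_simps)
        then have "g y = y" using per[OF yX] by (simp add: funpow_add)
        then show False using assms(5)[OF yX] by simp
      qed
    qed auto
    ultimately show ?thesis by (simp add: card_image)
  qed
  then show ?thesis using equiv_imp_dvd_card[OF assms(1) eq, of r] by auto
qed

context sympl
begin

text \<open>Over the field of two elements homogeneity of a quadratic form only says
  \<open>q 0 = 0\<close>, and this follows from the polarisation identity.\<close>

definition quad :: "('v \<Rightarrow> bit) \<Rightarrow> bool" where
  "quad q \<longleftrightarrow> (\<forall>x\<in>V. \<forall>y\<in>V. q (x + y) = q x + q y + B x y)"

lemma quadD: "quad q \<Longrightarrow> x \<in> V \<Longrightarrow> y \<in> V \<Longrightarrow> q (x + y) = q x + q y + B x y"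
  by (simp add: quad_def)

lemma quad_0: "quad q \<Longrightarrow> q 0 = 0"
  using quadD[of q 0 0] by simp

lemma quad_add_functional: "quad q \<Longrightarrow> v \<in> V \<Longrightarrow> quad (\<lambda>x. q x + B v x)"
  by (simp add: quad_def addr ac_simps)

text \<open>A form on a subspace \<open>W\<close> extends to the span of \<open>W\<close> and one
  more vector \<open>v\<close>, so a subspace of maximal size that carries a form is all of
  \<open>V\<close>.\<close>

lemma quad_exists: "\<exists>q. quad q"
proof -
  define A where "A = {W. W \<subseteq> V \<and> subgp W \<and> (\<exists>q. \<forall>x\<in>W. \<forall>y\<in>W. q (x + y) = q x + q y + B x y)}"
  have "{0} \<in> A" by (auto simp: A_def subgp_def intro!: exI[of _ "\<lambda>_. 0"])
  then have "A \<noteq> {}" by auto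
  moreover have "A \<subseteq> Pow V" by (auto simp: A_def)
  ultimately obtain W where W: "W \<in> A" "\<And>W'. W' \<in> A \<Longrightarrow> card W' \<le> card W"
    using ex_max_card[OF fin, of A] by blast
  then have WV: "W \<subseteq> V" "subgp W"
    and "\<exists>q. \<forall>x\<in>W. \<forall>y\<in>W. q (x + y) = q x + q y + B x y" by (auto simp: A_def)
  then obtain q where q: "\<And>x y. x \<in> W \<Longrightarrow> y \<in> W \<Longrightarrow> q (x + y) = q x + q y + B x y"
    by blast
  have "V \<subseteq> W"
  proof (rule ccontr)
    assume "\<not> V \<subseteq> W"
    then obtain v where v: "v \<in> V" "v \<notin> W" by auto
    define W' where "W' = W \<union> (\<lambda>w. w + v) ` W"
    \<comment> \<open>The value at \<open>v\<close> is chosen as 0, which forces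
      \<open>q w + B w v\<close> at \<open>w + v\<close>; for \<open>x\<close> outside
      \<open>W\<close> the vector \<open>w\<close> is recovered as \<open>x + v\<close>.\<close>
    define q' where "q' = (\<lambda>x. if x \<in> W then q x else q (x + v) + B (x + v) v)"
    have nW: "a + v \<notin> W" if "a \<in> W" for a
      using subgp_add[OF WV(2) that, of "a + v"] v by auto
    have e: "a + v + v = a" for a by (simp add: add.assoc)
    have q'1: "q' a = q a" if "a \<in> W" for a using that by (simp add: q'_def)
    have q'2: "q' (a + v) = q a + B a v" if "a \<in> W" for a using nW[OF that] by (simp add: q'_def e)
    have sw: "(a + v) + (b + v) = a + b" "(a + v) + b = (a + b) + v" "a + (b + v) = (a + b) + v" for a b
      by (simp_all add: ac_simps)
    have "q' (x + y) = q' x + q' y + B x y" if xy: "x \<in> W'" "y \<in> W'" for x y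
    proof -
      consider "x \<in> W" "y \<in> W" | b where "x \<in> W" "b \<in> W" "y = b + v"
        | a where "a \<in> W" "x = a + v" "y \<in> W" | a b where "a \<in> W" "b \<in> W" "x = a + v" "y = b + v"
        using xy by (auto simp: W'_def)
      then show ?thesis
      proof cases
        case 1
        then show ?thesis by (simp add: q'1 q subgp_add[OF WV(2)])
      next
        case 2
        then have "x \<in> V" "b \<in> V" using WV by auto
        then show ?thesis using 2 v
          by (simp add: sw q'1 q'2 q subgp_add[OF WV(2)] addl addr)
      next
        case 3
        then have "y \<in> V" "a \<in> V" using WV by auto
        then show ?thesis using 3 v symm[of v y]
          by (simp add: sw q'1 q'2 q subgp_add[OF WV(2)] addl addr)
      next
        case 4
        then have "a \<in> V" "b \<in> V" using WV by auto
        then have "B x y = B a b + B a v + B b v"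
          using 4 v symm[of v b] alt[of v] by (simp add: addl addr)
        moreover have "q' (x + y) = q a + q b + B a b"
          using 4 by (simp only: sw(1) q'1 q subgp_add[OF WV(2)])
        moreover have "q' x = q a + B a v" "q' y = q b + B b v"
          using 4 q'2 by simp_all
        ultimately show ?thesis
          by (cases "B a v"; cases "B b v"; cases "B a b") simp_all
      qed
    qed
    moreover have "W' \<subseteq> V" using WV v by (auto simp: W'_def)
    moreover have "subgp W'" unfolding W'_def using WV(2) by (rule subgp_extend)
    ultimately have "W' \<in> A" unfolding A_def by blast
    moreover have "W \<subset> W'"
    proof -
      have "v \<in> W'" using subgp_0[OF WV(2)] by (auto simp: W'_def image_iff intro!: bexI[of _ 0])
      then show ?thesis using v by (auto simp: W'_def)
    qed
    then have "card W < card W'"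
      using fin \<open>W' \<subseteq> V\<close> by (meson finite_subset psubset_card_mono)
    ultimately show False using W(2) by fastforce
  qed
  then have "quad q" using q by (auto simp: quad_def)
  then show ?thesis by blast
qed

text \<open>The adjoint of \<open>g\<close> is its inverse \<open>g'\<close>, so a vector is
  orthogonal to the image of \<open>g' - 1\<close> exactly if \<open>g - 1\<close> kills it; the
  converse is the double complement. Differences are sums in characteristic 2.\<close>

lemma perp_coboundary:
  assumes g: "isom g" "isom g'" "\<And>x. x \<in> V \<Longrightarrow> g' (g x) = x" "\<And>x. x \<in> V \<Longrightarrow> g (g' x) = x"
  defines "M \<equiv> (\<lambda>w. g' w + w) ` V"
  shows "subgp M" "M \<subseteq> V" "perp M = {x \<in> V. g x = x}" "perp {x \<in> V. g x = x} = M"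
proof -
  show 1: "subgp M" unfolding subgp_def
  proof (intro conjI ballI)
    show "0 \<in> M" using endo_0[OF isom_endo[OF g(2)]] by (auto simp: M_def image_iff intro!: bexI[of _ 0])
    fix x y assume "x \<in> M" "y \<in> M"
    then obtain a b where ab: "a \<in> V" "b \<in> V" "x = g' a + a" "y = g' b + b" by (auto simp: M_def)
    then have "x + y = g' (a + b) + (a + b)" by (simp add: endo_add[OF isom_endo[OF g(2)]] ac_simps)
    moreover have "a + b \<in> V" using ab by simp
    ultimately show "x + y \<in> M" unfolding M_def by (rule image_eqI)
  qed
  show 2: "M \<subseteq> V" using isom_closed[OF g(2)] by (auto simp: M_def)
  have sw: "B u (g' w) = B (g u) w" if "u \<in> V" "w \<in> V" for u w
    using isom_B[OF g(1), of u "g' w"] isom_closed[OF g(2)] g(4) that by simp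
  show 3: "perp M = {x \<in> V. g x = x}"
  proof (intro Set.set_eqI iffI)
    fix u assume u: "u \<in> perp M"
    then have uV: "u \<in> V" by (simp add: perp_def)
    have "g u + u = 0"
    proof (rule nondeg)
      fix w assume w: "w \<in> V"
      have "B u (g' w + w) = 0" using u w by (simp add: perp_def M_def)
      then show "B (g u + u) w = 0"
        using uV w isom_closed[OF g(1)] isom_closed[OF g(2)] by (simp add: addl addr sw)
    qed (use uV isom_closed[OF g(1)] in simp)
    then show "u \<in> {x \<in> V. g x = x}" using uV by simp
  next
    fix u assume "u \<in> {x \<in> V. g x = x}"
    then show "u \<in> perp M"
      using isom_closed[OF g(2)] by (auto simp: perp_def M_def addr sw)
  qed
  show "perp {x \<in> V. g x = x} = M" using perp_perp[OF 1 2] 3 by simp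
qed

text \<open>For any form \<open>q\<close> the difference between \<open>q (g x)\<close> and
  \<open>q x\<close> is linear in \<open>x\<close>, hence given by a vector \<open>v\<close>. It
  vanishes on the fixed vectors of \<open>g\<close>, so \<open>v = g' w + w\<close> for some
  \<open>w\<close> by \<open>perp_coboundary\<close>, and adding the functional of \<open>w\<close>
  to \<open>q\<close> removes the difference.\<close>

lemma invariant_quad_exists:
  assumes g: "isom g"
  obtains q where "quad q" "\<And>x. x \<in> V \<Longrightarrow> q (g x) = q x"
proof -
  obtain g' where g': "isom g'" "\<And>x. x \<in> V \<Longrightarrow> g' (g x) = x" "\<And>x. x \<in> V \<Longrightarrow> g (g' x) = x"
    using isom_inverse[OF g] by blast
  obtain q where q: "quad q" using quad_exists ..
  define l where "l x = q (g x) + q x" for x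
  have "l (x + y) = l x + l y" if "x \<in> V" "y \<in> V" for x y
    using that by (simp add: l_def endo_add[OF isom_endo[OF g]] quadD[OF q] isom_closed[OF g] isom_B[OF g] ac_simps)
  then obtain v where v: "v \<in> V" "\<And>x. x \<in> V \<Longrightarrow> l x = B v x"
    using functional_subgp[OF sub subset_refl, of l] by blast
  have "v \<in> perp {x \<in> V. g x = x}"
    using v by (auto simp: perp_def simp flip: v(2)) (simp add: l_def)
  then obtain w where w: "w \<in> V" "v = g' w + w"
    using perp_coboundary(4)[OF g g'] by auto
  show ?thesis
  proof (rule that[of "\<lambda>x. q x + B w x"])
    show "quad (\<lambda>x. q x + B w x)" using q w(1) by (rule quad_add_functional)
    fix x assume x: "x \<in> V"
    have "B (g' w) x = B w (g x)"
      using isom_B[OF g, of "g' w" x] isom_closed[OF g'(1)] g'(3) x w by simp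
    then have "q (g x) + q x = B w (g x) + B w x"
      using v(2)[OF x] x w isom_closed[OF g'(1)] by (simp add: l_def addl)
    then have "q (g x) + B w (g x) + (q x + B w x) = 0"
      by (metis add.assoc add.left_commute add_self)
    then show "q (g x) + B w (g x) = q x + B w x" by (simp only: add_eq_0_iff_eq)
  qed
qed

section \<open>Gauss sums, transvections and conjugacy of quadratic forms\<close>

definition gauss :: "('v \<Rightarrow> bit) \<Rightarrow> int" where
  "gauss q = (\<Sum>x\<in>V. chi (q x))"

text \<open>Substituting \<open>y + x\<close> for \<open>y\<close> turns the product of the two sums
  into a sum of \<open>chi (q y)\<close> times a character sum in \<open>x\<close>, which survives
  only for \<open>y = 0\<close>. The sign left undetermined is the Arf invariant of
  \<open>q\<close>.\<close>

lemma gauss_square: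
  assumes q: "quad q"
  shows "gauss q * gauss q = int (card V)"
proof -
  have "gauss q * gauss q = (\<Sum>x\<in>V. \<Sum>y\<in>V. chi (q x + q y))"
    by (simp add: gauss_def sum_product chi_add)
  also have "\<dots> = (\<Sum>x\<in>V. \<Sum>y\<in>V. chi (q x + q (y + x)))"
    by (intro sum.cong[OF refl] sum_subgp_shift[OF sub, symmetric])
  also have "\<dots> = (\<Sum>x\<in>V. \<Sum>y\<in>V. chi (q y) * chi (B y x))"
    by (intro sum.cong refl) (simp add: quadD[OF q] symm ac_simps flip: chi_add)
  also have "\<dots> = (\<Sum>y\<in>V. chi (q y) * (\<Sum>x\<in>V. chi (B y x)))"
    by (subst sum.swap) (simp add: sum_distrib_left)
  also have "\<dots> = (\<Sum>y\<in>V. if y = 0 then int (card V) else 0)"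
  proof (intro sum.cong refl)
    fix y assume y: "y \<in> V"
    have "(\<Sum>x\<in>V. chi (B y x)) = (if \<forall>x\<in>V. B y x = 0 then int (card V) else 0)"
      using y by (intro sum_chi_additive sub fin addr)
    also have "(\<forall>x\<in>V. B y x = 0) \<longleftrightarrow> y = 0" using nondeg[OF y] by auto
    finally show "chi (q y) * (\<Sum>x\<in>V. chi (B y x)) = (if y = 0 then int (card V) else 0)"
      using quad_0[OF q] by simp
  qed
  finally show ?thesis using fin by simp
qed

lemma gauss_nonzero: "quad q \<Longrightarrow> gauss q \<noteq> 0"
  using gauss_square[of q] card_V_pos by auto

lemma gauss_eq_or_neg: "quad q \<Longrightarrow> quad q' \<Longrightarrow> gauss q' = gauss q \<or> gauss q' = - gauss q"
  using gauss_square[of q] gauss_square[of q'] by (metis square_eq_iff)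

text \<open>Completing the square: \<open>q x + B v x = q v + q (x + v)\<close>.\<close>

lemma gauss_shift:
  assumes q: "quad q" and v: "v \<in> V"
  shows "gauss (\<lambda>x. q x + B v x) = chi (q v) * gauss q"
proof -
  have "gauss (\<lambda>x. q x + B v x) = (\<Sum>x\<in>V. chi (q v) * chi (q (x + v)))"
    unfolding gauss_def
  proof (intro sum.cong refl)
    fix x assume x: "x \<in> V"
    have "q x + B v x = q v + q (x + v)" using x v symm[of v x] by (simp add: quadD[OF q] ac_simps)
    then show "chi (q x + B v x) = chi (q v) * chi (q (x + v))" by (simp only: chi_add)
  qed
  also have "\<dots> = chi (q v) * gauss q"
    using sum_subgp_shift[OF sub v, of "\<lambda>x. chi (q x)"] by (simp add: gauss_def flip: sum_distrib_left)
  finally show ?thesis .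
qed

lemma quad_diff:
  assumes "quad q" "quad q'"
  obtains v where "v \<in> V" "\<And>x. x \<in> V \<Longrightarrow> q' x = q x + B v x"
proof -
  have "q (x + y) + q' (x + y) = (q x + q' x) + (q y + q' y)" if "x \<in> V" "y \<in> V" for x y
    using that assms by (simp add: quadD ac_simps)
  then obtain v where v: "v \<in> V" "\<And>x. x \<in> V \<Longrightarrow> q x + q' x = B v x"
    using functional_subgp[OF sub subset_refl, of "\<lambda>x. q x + q' x"] by blast
  then have "q' x = q x + B v x" if "x \<in> V" for x by (simp flip: v(2)[OF that])
  then show ?thesis using that v(1) by blast
qed

definition transvection :: "'v \<Rightarrow> 'v \<Rightarrow> 'v" where
  "transvection v x = x + bsc (B x v) v"

lemma isom_transvection:
  assumes v: "v \<in> V"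
  shows "isom (transvection v)"
  unfolding isom_def endo_def
proof (intro conjI ballI)
  show "subgp V" by (rule sub)
  fix x y assume xy: "x \<in> V" "y \<in> V"
  show "transvection v x \<in> V" using xy v by (simp add: transvection_def bsc_closed sub)
  show "transvection v (x + y) = transvection v x + transvection v y"
    using xy v by (simp add: transvection_def addl bsc_add ac_simps)
  show "B (transvection v x) (transvection v y) = B x y"
    using xy v symm[of v x] symm[of v y]
    by (cases "B x v"; cases "B y v") (simp_all add: transvection_def addl addr alt)
qed

lemma quad_transvection:
  assumes "quad q" "v \<in> V" "x \<in> V"
  shows "q (transvection v x) = q x + B x v * (1 + q v)"
  using assms symm[of v x] by (cases "B x v") (simp_all add: transvection_def quadD ac_simps)

text \<open>Two forms differ by the functional of a vector \<open>v\<close>. By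
  \<open>gauss_shift\<close> equal Gauss sums mean \<open>q v = 0\<close>, and then the transvection
  along \<open>v\<close> carries one form to the other.\<close>

lemma gauss_eq_conjugate:
  assumes q: "quad q" "quad q'" "gauss q = gauss q'"
  obtains \<sigma> where "isom \<sigma>" "\<And>x. x \<in> V \<Longrightarrow> q' x = q (\<sigma> x)"
proof -
  obtain v where v: "v \<in> V" "\<And>x. x \<in> V \<Longrightarrow> q' x = q x + B v x"
    using quad_diff[OF q(1,2)] by blast
  have "gauss q' = gauss (\<lambda>x. q x + B v x)" unfolding gauss_def using v by (intro sum.cong) auto
  then have "chi (q v) = 1" using gauss_shift[OF q(1) v(1)] gauss_nonzero[OF q(1)] q(3) by simp
  then have "q v = 0" by (cases "q v") auto
  then have "q' x = q (transvection v x)" if "x \<in> V" for x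
    using that v symm[of v x] by (simp add: quad_transvection[OF q(1)])
  then show ?thesis using that isom_transvection[OF v(1)] by blast
qed

text \<open>If \<open>q\<close> were 1 at all nonzero vectors, its Gauss sum would be
  \<open>2 - card V\<close>, with square \<open>card V\<close>; this leaves only the sizes 1 and 4.
  The vector serves to show that the orthogonal group of \<open>q\<close> is proper.\<close>

lemma singular_vector_exists:
  assumes q: "quad q" and "card V > 4"
  obtains v where "v \<in> V" "v \<noteq> 0" "q v = 0"
proof (rule ccontr)
  assume "\<not> thesis"
  then have a: "q v = 1" if "v \<in> V" "v \<noteq> 0" for v
    using \<open>\<And>v. v \<in> V \<Longrightarrow> v \<noteq> 0 \<Longrightarrow> q v = 0 \<Longrightarrow> thesis\<close>[of v] that by (cases "q v") auto
  have "gauss q = chi (q 0) + (\<Sum>x\<in>V - {0}. chi (q x))"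
    unfolding gauss_def using fin by (rule sum.remove) simp
  also have "\<dots> = 1 - int (card (V - {0}))" using a quad_0[OF q] by simp
  also have "\<dots> = 2 - int (card V)" using fin assms(2) by simp
  finally have "(2 - int (card V)) * (2 - int (card V)) = int (card V)" using gauss_square[OF q] by simp
  then have "(int (card V) - 1) * (int (card V) - 4) = 0" by (simp add: algebra_simps)
  then show False using assms(2) by auto
qed

text \<open>For a fixed vector \<open>v\<close> the form \<open>q x + B v x\<close> is invariant
  too, and its Gauss sum is that of \<open>q\<close> times \<open>chi (q v)\<close>.\<close>

lemma invariant_vanishes:
  assumes g: "isom g" and q: "quad q" "\<And>x. x \<in> V \<Longrightarrow> q (g x) = q x"
    and same: "\<And>q'. quad q' \<Longrightarrow> (\<And>x. x \<in> V \<Longrightarrow> q' (g x) = q' x) \<Longrightarrow> gauss q' = gauss q"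
    and v: "v \<in> V" "g v = v"
  shows "q v = 0"
proof -
  have "gauss (\<lambda>x. q x + B v x) = gauss q"
  proof (rule same)
    show "quad (\<lambda>x. q x + B v x)" using q(1) v(1) by (rule quad_add_functional)
    show "q (g x) + B v (g x) = q x + B v x" if "x \<in> V" for x
      using isom_B[OF g v(1) that] q(2)[OF that] v(2) by simp
  qed
  then have "chi (q v) = 1" using gauss_shift[OF q(1) v(1)] gauss_nonzero[OF q(1)] by simp
  then show ?thesis by (cases "q v") auto
qed

text \<open>The sum \<open>N\<close> over the orbit of any \<open>y\<close> is fixed, and
  \<open>q\<close> vanishes on fixed vectors, so \<open>B x N = 0\<close> by polarisation. As
  \<open>x\<close> is fixed, \<open>B x N\<close> is \<open>r\<close> times \<open>B x y\<close>,
  which is \<open>B x y\<close> for odd \<open>r\<close>.\<close>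

lemma odd_order_fixed_point_free:
  assumes g: "isom g" "odd r" "\<And>x. x \<in> V \<Longrightarrow> (g ^^ r) x = x"
    and q: "quad q" "\<And>v. v \<in> V \<Longrightarrow> g v = v \<Longrightarrow> q v = 0"
    and x: "x \<in> V" "g x = x"
  shows "x = 0"
proof (rule nondeg[OF x(1)])
  fix y assume y: "y \<in> V"
  define N where "N = (\<Sum>i<r. (g ^^ i) y)"
  have gV: "(g ^^ i) y \<in> V" for i using isom_closed[OF isom_funpow[OF g(1)] y] .
  have E: "endo V g" using g(1) by (rule isom_endo)
  have NV: "N \<in> V" unfolding N_def
    by (rule additive_sum(2)[where f = g, OF sub]) (simp_all add: endo_0[OF E] endo_add[OF E] gV)
  have "g N = (\<Sum>i<r. (g ^^ Suc i) y)"
    unfolding N_def funpow.simps o_apply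
    by (rule additive_sum(1)[OF sub]) (simp_all add: endo_0[OF E] endo_add[OF E] gV)
  also have "\<dots> + y = (\<Sum>i<Suc r. (g ^^ i) y)" by (subst sum.lessThan_Suc_shift) (simp add: ac_simps)
  then have "(\<Sum>i<r. (g ^^ Suc i) y) + y = N + y" using g(3)[OF y] by (simp add: N_def)
  then have "(\<Sum>i<r. (g ^^ Suc i) y) = N" by simp
  finally have gN: "g N = N" .
  have "B x N = q (x + N) + q x + q N" using x NV symm[OF x(1) NV] by (simp add: quadD[OF q(1)] ac_simps)
  also have "\<dots> = 0" using q(2) x NV gN by (simp add: endo_add[OF E])
  finally have "B x N = 0" .
  moreover have "B x N = (\<Sum>i<r. B x ((g ^^ i) y))"
    unfolding N_def by (rule additive_sum(1)[OF sub]) (use x gV addr in simp_all)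
  moreover have "B x ((g ^^ i) y) = B x y" for i
  proof -
    have "(g ^^ i) x = x" using x(2) by (induction i) auto
    then show ?thesis using isom_B[OF isom_funpow[OF g(1)] x(1) y, of i] by simp
  qed
  ultimately have "(\<Sum>i<r. B x y) = 0" by (simp only:)
  moreover have "(\<Sum>i<r. B x y) = B x y" using g(2) by (cases "B x y") (auto elim!: oddE)
  ultimately show "B x y = 0" by (simp only:)
qed

text \<open>The nonzero vectors where \<open>q\<close> takes a given value split into orbits of
  length \<open>r\<close>, so modulo \<open>r\<close> only the zero vector contributes to the Gauss
  sum.\<close>

lemma odd_order_gauss:
  assumes g: "isom g" "prime (r::nat)" "\<And>x. x \<in> V \<Longrightarrow> (g ^^ r) x = x"
    and q: "quad q" "\<And>x. x \<in> V \<Longrightarrow> q (g x) = q x"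
    and free: "\<And>x. x \<in> V \<Longrightarrow> g x = x \<Longrightarrow> x = 0"
  shows "int r dvd gauss q - 1"
proof -
  have E: "endo V g" using g(1) by (rule isom_endo)
  have nz: "g x \<noteq> 0" if "x \<in> V" "x \<noteq> 0" for x
    using isom_inj[OF g(1)] that endo_0[OF E] by (metis inj_onD zero_mem)
  have d: "r dvd card {x \<in> V. x \<noteq> 0 \<and> q x = c}" for c
  proof (rule prime_period_card_dvd[OF _ g(2), where g = g])
    show "finite {x \<in> V. x \<noteq> 0 \<and> q x = c}" using fin by simp
  qed (use nz q free g(3) isom_closed[OF g(1)] in auto)
  have "gauss q = chi (q 0) + (\<Sum>x\<in>V - {0}. chi (q x))"
    unfolding gauss_def using fin by (rule sum.remove) simp
  moreover have "V - {0} = {x \<in> V. x \<noteq> 0 \<and> q x = 0} \<union> {x \<in> V. x \<noteq> 0 \<and> q x = 1}" by auto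
  ultimately have "gauss q = 1 + (\<Sum>x\<in>{x \<in> V. x \<noteq> 0 \<and> q x = 0} \<union> {x \<in> V. x \<noteq> 0 \<and> q x = 1}. chi (q x))"
    using quad_0[OF q(1)] by simp
  also have "\<dots> = 1 + ((\<Sum>x\<in>{x \<in> V. x \<noteq> 0 \<and> q x = 0}. chi (q x)) + (\<Sum>x\<in>{x \<in> V. x \<noteq> 0 \<and> q x = 1}. chi (q x)))"
    using fin by (subst sum.union_disjoint) auto
  also have "\<dots> = 1 + (int (card {x \<in> V. x \<noteq> 0 \<and> q x = 0}) - int (card {x \<in> V. x \<noteq> 0 \<and> q x = 1}))"
    by (simp add: sum.cong)
  finally show ?thesis using d[of 0] d[of 1] by (simp add: dvd_diff)
qed

text \<open>\<open>C\<close> is totally isotropic because \<open>q\<close> vanishes on it, and it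
  contains the image of \<open>g + 1\<close>, which is \<open>perp C\<close>; hence all three agree.
  Averaging the Gauss sum over translations by \<open>C\<close> then leaves only the vectors of
  \<open>C\<close>.\<close>

lemma involution_lagrangian:
  assumes g: "isom g" "\<And>x. x \<in> V \<Longrightarrow> g (g x) = x"
    and q: "quad q" "\<And>v. v \<in> V \<Longrightarrow> g v = v \<Longrightarrow> q v = 0"
  defines "C \<equiv> {x \<in> V. g x = x}"
  shows "perp C = C" "C = (\<lambda>w. g w + w) ` V" "subgp C" "gauss q = int (card C)"
proof -
  define M where "M = (\<lambda>w. g w + w) ` V"
  note pc = perp_coboundary[OF g(1) g(1) g(2) g(2), folded M_def C_def]
  have E: "endo V g" using g(1) by (rule isom_endo)
  have "M \<subseteq> C" using g(2) isom_closed[OF g(1)] by (auto simp: M_def C_def endo_add[OF E] add.commute)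
  moreover have "C \<subseteq> perp C"
  proof
    fix x assume x: "x \<in> C"
    have "B x y = 0" if y: "y \<in> C" for y
    proof -
      have "B x y = q (x + y) + q x + q y" using x y by (simp add: C_def quadD[OF q(1)] ac_simps)
      also have "\<dots> = 0" using q(2) x y by (simp add: C_def endo_add[OF E])
      finally show ?thesis .
    qed
    then show "x \<in> perp C" using x by (simp add: perp_def C_def)
  qed
  ultimately show p: "perp C = C" and "C = (\<lambda>w. g w + w) ` V" using pc(4) by (auto simp: M_def)
  show sC: "subgp C" using subgp_perp[of C] p by (auto simp: C_def)
  have CV: "C \<subseteq> V" by (auto simp: C_def)
  have finC: "finite C" using fin CV by (rule finite_subset[rotated])
  have "int (card C) * gauss q = (\<Sum>c\<in>C. \<Sum>x\<in>V. chi (q (x + c)))"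
  proof -
    have "(\<Sum>x\<in>V. chi (q (x + c))) = gauss q" if "c \<in> C" for c
      using sum_subgp_shift[OF sub, of c "\<lambda>x. chi (q x)"] that CV by (auto simp: gauss_def)
    then show ?thesis by simp
  qed
  also have "\<dots> = (\<Sum>x\<in>V. \<Sum>c\<in>C. chi (q (x + c)))" by (rule sum.swap)
  also have "\<dots> = (\<Sum>x\<in>V. if x \<in> C then int (card C) else 0)"
  proof (intro sum.cong refl)
    fix x assume x: "x \<in> V"
    have "(\<Sum>c\<in>C. chi (q (x + c))) = chi (q x) * (\<Sum>c\<in>C. chi (B x c))"
      unfolding sum_distrib_left
    proof (intro sum.cong refl)
      fix c assume "c \<in> C"
      then show "chi (q (x + c)) = chi (q x) * chi (B x c)"
        using x q(2) by (simp add: C_def quadD[OF q(1)] flip: chi_add)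
    qed
    also have "(\<Sum>c\<in>C. chi (B x c)) = (if \<forall>c\<in>C. B x c = 0 then int (card C) else 0)"
      using x CV by (intro sum_chi_additive sC finC) (auto simp: addr subset_iff)
    also have "(\<forall>c\<in>C. B x c = 0) \<longleftrightarrow> x \<in> C" using x p by (auto simp: perp_def)
    finally show "(\<Sum>c\<in>C. chi (q (x + c))) = (if x \<in> C then int (card C) else 0)"
      using q(2) by (auto simp: C_def)
  qed
  also have "\<dots> = int (card C) * int (card C)"
  proof -
    have "{x \<in> V. x \<in> C} = C" using CV by auto
    then show ?thesis using fin by (simp add: sum.inter_filter[symmetric])
  qed
  finally have "int (card C) * gauss q = int (card C) * int (card C)" .
  moreover have "card C \<noteq> 0" using subgp_0[OF sC] finC by auto
  ultimately show "gauss q = int (card C)" by simp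
qed

end

subsection \<open>Isometries between symplectic spaces with a field of self-adjoint operators\<close>

text \<open>Frobenius is bijective on the residue field: by \<open>irreducible_dvd_fermat\<close>
  the power of \<open>p\<close> with exponent \<open>2 ^ (degree f - 1)\<close> is a square
  root.\<close>

lemma irreducible_sqrt_mod:
  assumes "irreducible (f :: bit poly)"
  obtains s where "f dvd s * s - p"
proof -
  obtain n where n: "degree f = Suc n"
    using degree_irreducible_pos[OF assms] gr0_implies_Suc by blast
  have "p ^ (2 ^ degree f) = p ^ (2 ^ n) * p ^ (2 ^ n)"
    by (simp add: n mult_2 flip: power_add)
  then show ?thesis using that irreducible_dvd_fermat[OF assms, of p] by metis
qed

lemma additive_poly_eq:
  fixes m m' :: "bit poly \<Rightarrow> bit"
  assumes "\<And>p q. m (p + q) = m p + m q" "\<And>p q. m' (p + q) = m' p + m' q"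
    and "\<And>i. i < n \<Longrightarrow> m ([:0, 1:] ^ i) = m' ([:0, 1:] ^ i)" and "degree p < n"
  shows "m p = m' p"
proof -
  have U: "subgp (UNIV :: bit set)" by (simp add: subgp_def)
  have 0: "m 0 = 0" "m' 0 = 0" using assms(1)[of 0 0] assms(2)[of 0 0] by simp_all
  have S: "k (\<Sum>i\<in>I. g i) = (\<Sum>i\<in>I. k (g i))" if "k 0 = 0" "\<And>p q. k (p + q) = k p + k q"
    for k :: "bit poly \<Rightarrow> bit" and g :: "nat \<Rightarrow> bit poly" and I
    by (induction I rule: infinite_finite_induct) (use that in auto)
  have e: "m (monom (coeff p i) i) = m' (monom (coeff p i) i)" if "i \<le> degree p" for i
    using assms(3)[of i] assms(4) that 0
    by (cases "coeff p i") (simp_all add: monom_altdef del: mult_pCons_left)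
  have "m p = m (\<Sum>i\<le>degree p. monom (coeff p i) i)" by (simp add: poly_as_sum_of_monoms)
  also have "\<dots> = (\<Sum>i\<le>degree p. m (monom (coeff p i) i))" by (rule S[OF 0(1) assms(1)])
  also have "\<dots> = (\<Sum>i\<le>degree p. m' (monom (coeff p i) i))" using e by (intro sum.cong) auto
  also have "\<dots> = m' (\<Sum>i\<le>degree p. monom (coeff p i) i)" by (rule S[OF 0(2) assms(2), symmetric])
  finally show ?thesis by (simp add: poly_as_sum_of_monoms)
qed

text \<open>
  The dual of the field of residues modulo \<open>f\<close> is a one-dimensional space over that field.
\<close>

lemma functional_rescale:
  fixes l l' :: "bit poly \<Rightarrow> bit"
  assumes f: "irreducible f"
    and l: "\<And>p q. l (p + q) = l p + l q" "\<And>p. f dvd p \<Longrightarrow> l p = 0"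
    and l': "\<And>p q. l' (p + q) = l' p + l' q" "\<And>p. f dvd p \<Longrightarrow> l' p = 0" "l' p0 \<noteq> 0"
  obtains c where "\<And>p. l' (p * c) = l p"
proof -
  define n where "n = degree f"
  have n: "n > 0" using degree_irreducible_pos[OF f] by (simp add: n_def)
  define D where "D = {p :: bit poly. degree p < n}"
  have D: "finite D" "card D = 2 ^ n" using card_poly_degree_less[OF n] by (simp_all add: D_def)
  \<comment> \<open>\<open>F c\<close> records the basis monomials at which \<open>l'\<close>,
    multiplied by \<open>c\<close>, is 1. It is injective on the \<open>2 ^ n\<close> residues,
    hence onto the \<open>2 ^ n\<close> subsets, and some \<open>c\<close> yields the values of
    \<open>l\<close>.\<close>
  define F where "F c = {i. i < n \<and> l' ([:0, 1:] ^ i * c) = 1}" for c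
  have mod_eq: "m p = m (p mod f)" if "\<And>p q. m (p + q) = m p + m q" "\<And>p. f dvd p \<Longrightarrow> m p = 0"
    for m :: "bit poly \<Rightarrow> bit" and p
    using that(1)[of "p div f * f" "p mod f"] that(2)[of "p div f * f"] by simp
  have dm: "degree (p mod f) < n" for p
    using degree_mod_less[of f p] n f by (fastforce simp: n_def)
  have eqI: "l' (p * c) = m p"
    if "\<And>p q. m (p + q) = m p + m q" "\<And>p. f dvd p \<Longrightarrow> m p = 0"
      "\<And>i. i < n \<Longrightarrow> l' ([:0, 1:] ^ i * c) = m ([:0, 1:] ^ i)" for m c p
  proof -
    have "l' (p * c) = l' ((p mod f) * c)"
      by (rule mod_eq[of "\<lambda>p. l' (p * c)"]) (simp_all add: distrib_right l')
    also have "\<dots> = m (p mod f)"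
      by (rule additive_poly_eq[of "\<lambda>p. l' (p * c)" m n])
        (use that dm in \<open>simp_all add: distrib_right l' del: mult_pCons_left\<close>)
    also have "\<dots> = m p" by (rule mod_eq[of m, symmetric]) (use that in auto)
    finally show ?thesis .
  qed
  have "inj_on F D"
  proof (rule inj_onI)
    fix c d assume cd: "c \<in> D" "d \<in> D" "F c = F d"
    have eq: "l' ([:0, 1:] ^ i * c) = l' ([:0, 1:] ^ i * d)" if "i < n" for i
    proof -
      have "i \<in> F c \<longleftrightarrow> i \<in> F d" using cd(3) by simp
      then show ?thesis using that by (cases "l' ([:0, 1:] ^ i * c)"; cases "l' ([:0, 1:] ^ i * d)")
          (auto simp: F_def)
    qed
    have z: "l' (p * (c - d)) = 0" for p
    proof (rule eqI)
      fix i assume "i < n"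
      then have "l' ([:0, 1:] ^ i * (c - d)) = l' ([:0, 1:] ^ i * c) + l' ([:0, 1:] ^ i * d)"
        using l'(1)[of "[:0, 1:] ^ i * (c - d)" "[:0, 1:] ^ i * d"]
        by (simp add: right_diff_distrib del: mult_pCons_left)
      then show "l' ([:0, 1:] ^ i * (c - d)) = 0" using eq[OF \<open>i < n\<close>] by simp
    qed simp_all
    show "c = d"
    proof (rule ccontr)
      assume "c \<noteq> d"
      moreover have "degree (c - d) < n" using cd by (simp add: D_def degree_diff_less)
      ultimately have "\<not> f dvd c - d" using dvd_imp_degree_le[of f "c - d"] by (auto simp: n_def)
      then obtain u v where "u * f + v * (c - d) = 1" using irreducible_bezout[OF f] by blast
      then have "l' p0 = l' (p0 * (u * f + v * (c - d)))" by simp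
      also have "\<dots> = l' ((p0 * u) * f) + l' ((p0 * v) * (c - d))"
        by (simp only: distrib_left l' mult.assoc)
      also have "\<dots> = 0" using z l'(2) by simp
      finally show False using l'(3) by simp
    qed
  qed
  then have "card (F ` D) = card (Pow {..<n})" using D by (simp add: card_image card_Pow)
  moreover have "F ` D \<subseteq> Pow {..<n}" by (auto simp: F_def)
  ultimately have "F ` D = Pow {..<n}" by (simp add: card_subset_eq)
  moreover have "{i. i < n \<and> l ([:0, 1:] ^ i) = 1} \<in> Pow {..<n}" by auto
  ultimately have "{i. i < n \<and> l ([:0, 1:] ^ i) = 1} \<in> F ` D" by (simp only:)
  then obtain c where c: "{i. i < n \<and> l ([:0, 1:] ^ i) = 1} = F c" by (rule imageE)
  have gen: "l' ([:0, 1:] ^ i * c) = l ([:0, 1:] ^ i)" if "i < n" for i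
  proof -
    have "i \<in> F c \<longleftrightarrow> i \<in> {i. i < n \<and> l ([:0, 1:] ^ i) = 1}" by (simp only: c)
    with that have "l' ([:0, 1:] ^ i * c) = 1 \<longleftrightarrow> l ([:0, 1:] ^ i) = 1"
      unfolding F_def mem_Collect_eq by blast
    then show ?thesis
      by (cases "l' ([:0, 1:] ^ i * c)"; cases "l ([:0, 1:] ^ i)") auto
  qed
  have "l' (p * c) = l p" for p
    using l gen by (rule eqI[where m = l])
  then show ?thesis by (rule that)
qed

section \<open>Orthogonal sums, stable nondegenerate subspaces and graphs of isometries\<close>

lemma sympl_prod:
  assumes "sympl V B" "sympl V' B'"
  shows "sympl (V \<times> V') (\<lambda>u v. B (fst u) (fst v) + B' (snd u) (snd v))"
proof -
  interpret A: sympl V B by fact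
  interpret A': sympl V' B' by fact
  show ?thesis
  proof
    show "finite (V \<times> V')" by (simp add: A.fin A'.fin)
    show "subgp (V \<times> V')" by (auto simp: subgp_def zero_prod_def)
    fix x assume x: "x \<in> V \<times> V'"
      and z: "\<And>y. y \<in> V \<times> V' \<Longrightarrow> B (fst x) (fst y) + B' (snd x) (snd y) = 0"
    have "fst x = 0"
    proof (rule A.nondeg)
      fix y assume "y \<in> V"
      then show "B (fst x) y = 0" using z[of "(y, 0)"] x by auto
    qed (use x in auto)
    moreover have "snd x = 0"
    proof (rule A'.nondeg)
      fix y assume "y \<in> V'"
      then show "B' (snd x) y = 0" using z[of "(0, y)"] x by auto
    qed (use x in auto)
    ultimately show "x = 0" by (simp add: prod_eq_iff)
  qed (auto simp: A.addl A'.addl A.addr A'.addr A.alt A'.alt ac_simps)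
qed

lemma endo_map_prod:
  "endo V T \<Longrightarrow> endo V' T' \<Longrightarrow> endo (V \<times> V') (map_prod T T')"
  by (auto simp: endo_def subgp_def zero_prod_def)

lemma act_map_prod:
  assumes "endo V T" "endo V' T'"
  shows "act (map_prod T T') p z = (act T p (fst z), act T' p (snd z))"
proof (induction p)
  case (pCons a p)
  then show ?case
    by (cases z; cases a)
      (simp_all add: act_pCons[OF assms(1)] act_pCons[OF assms(2)] act_pCons[OF endo_map_prod[OF assms]])
qed (simp add: zero_prod_def)

context sympl
begin

text \<open>With a square root \<open>s\<close> of \<open>p\<close> modulo \<open>f\<close> the
  value becomes \<open>B\<close> of \<open>act T s x\<close> with itself. So the form over the field
  generated by \<open>T\<close> whose trace is \<open>B\<close> is alternating, not merely
  symmetric.\<close>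

lemma selfadj_alternating:
  assumes T: "selfadj T" and f: "irreducible f" "\<And>x. x \<in> V \<Longrightarrow> act T f x = 0" and x: "x \<in> V"
  shows "B (act T p x) x = 0"
proof -
  have E: "endo V T" using T by (rule selfadj_endo)
  obtain s where s: "f dvd s * s - p" using irreducible_sqrt_mod[OF f(1)] .
  have "act T (s * s) x = act T (s * s - p) x + act T p x"
    using act_add[OF E x, of "s * s - p" p] by simp
  also have "act T (s * s - p) x = 0" using act_dvd[OF E s f(2) x] .
  finally have "act T p x = act T s (act T s x)" using x by (simp add: act_mult[OF E])
  then show ?thesis
    using selfadjD[OF selfadj_act[OF T, of s], of "act T s x" x] x by (simp add: act_closed[OF E] alt)
qed

definition stable_nondeg :: "('v \<Rightarrow> 'v) \<Rightarrow> ('v \<Rightarrow> 'v) \<Rightarrow> 'v set \<Rightarrow> bool" where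
  "stable_nondeg T h U \<longleftrightarrow> subgp U \<and> U \<subseteq> V \<and> (\<forall>x\<in>U. T x \<in> U \<and> h x \<in> U) \<and> U \<inter> perp U = {0}"

lemma act_stable:
  assumes "stable_nondeg T h U" "endo V T" "x \<in> U"
  shows "act T p x \<in> U"
proof (induction p)
  case (pCons a p)
  then show ?case using assms
    by (auto simp: stable_nondeg_def act_pCons[OF assms(2)] intro!: subgp_add bsc_closed)
qed (use assms in \<open>auto simp: stable_nondeg_def subgp_0\<close>)

lemma act_perp:
  assumes U: "stable_nondeg T h U" and T: "selfadj T" and x: "x \<in> perp U"
  shows "act T p x \<in> perp U"
proof -
  have E: "endo V T" using T by (rule selfadj_endo)
  have "B (act T p x) u = 0" if "u \<in> U" for u
    using that selfadjD[OF selfadj_act[OF T], of x u p] act_stable[OF U E that, of p] x U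
    by (auto simp: perp_def stable_nondeg_def)
  then show ?thesis using x by (auto simp: perp_def act_closed[OF E])
qed

lemma isom_perp:
  assumes U: "stable_nondeg T h U" and h: "isom h" and x: "x \<in> perp U"
  shows "h x \<in> perp U"
proof -
  have UV: "U \<subseteq> V" "\<And>u. u \<in> U \<Longrightarrow> h u \<in> U" using U by (auto simp: stable_nondeg_def)
  have "inj_on h U" using isom_inj[OF h] UV by (meson inj_on_subset)
  moreover have "finite U" using fin UV by (meson finite_subset)
  ultimately have "h ` U = U" using UV by (intro endo_inj_surj) auto
  have "B (h x) u = 0" if u: "u \<in> U" for u
  proof -
    have "u \<in> h ` U" using \<open>h ` U = U\<close> u by simp
    then obtain v where "v \<in> U" "u = h v" by (rule imageE)
    then show ?thesis using isom_B[OF h, of x v] x UV(1) by (auto simp: perp_def)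
  qed
  then show ?thesis using x isom_closed[OF h] by (auto simp: perp_def)
qed

lemma perp_nondeg:
  assumes U: "stable_nondeg T h U" and x: "x \<in> perp U" and z: "\<And>y. y \<in> perp U \<Longrightarrow> B x y = 0"
  shows "x = 0"
proof (rule nondeg)
  show xV: "x \<in> V" using x by (simp add: perp_def)
  fix v assume "v \<in> V"
  then obtain u w where uw: "u \<in> U" "w \<in> perp U" "v = u + w"
    using perp_split[of U v] U by (auto simp: stable_nondeg_def)
  then have "B x u = 0" "B x w = 0" using x z by (auto simp: perp_def)
  moreover have "u \<in> V" "w \<in> V" using uw U by (auto simp: stable_nondeg_def perp_def)
  ultimately show "B x v = 0" using xV by (simp add: uw addr)
qed

lemma perp_nontrivial:
  assumes U: "stable_nondeg T h U" and "U \<noteq> V"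
  obtains x where "x \<in> perp U" "x \<noteq> 0"
proof -
  have UV: "subgp U" "U \<subseteq> V" "U \<inter> perp U = {0}" using U by (auto simp: stable_nondeg_def)
  then obtain v where v: "v \<in> V" "v \<notin> U" using assms(2) by auto
  obtain u w where uw: "u \<in> U" "w \<in> perp U" "v = u + w" using perp_split[OF UV v(1)] .
  have "w \<noteq> 0" using uw v(2) by auto
  then show ?thesis using that uw(2) by blast
qed

lemma hyperbolic_pair_perp:
  assumes U: "stable_nondeg T h U" and "U \<noteq> V"
  obtains x y where "x \<in> perp U" "y \<in> perp U" "B x y = 1"
proof -
  obtain x where x: "x \<in> perp U" "x \<noteq> 0" using perp_nontrivial[OF assms] .
  then obtain y where "y \<in> perp U" "B x y \<noteq> 0" using perp_nondeg[OF U x(1)] by blast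
  then show ?thesis using that x by simp
qed

lemma functional_act:
  assumes T: "selfadj T" and f: "\<And>x. x \<in> V \<Longrightarrow> act T f x = 0" and xy: "x \<in> V" "y \<in> V"
  shows "B (act T (p + q) x) y = B (act T p x) y + B (act T q x) y"
    and "f dvd p \<Longrightarrow> B (act T p x) y = 0"
  using xy act_dvd[OF selfadj_endo[OF T] _ f xy(1)]
  by (simp_all add: act_add[OF selfadj_endo[OF T]] addl act_closed[OF selfadj_endo[OF T]])

end

text \<open>Two spaces that are to be compared as modules with form. With \<open>h\<close> and
  \<open>h'\<close> the identity this leads to conjugacy of operators; with \<open>T\<close> the sum
  of \<open>h\<close> and its inverse it compares an isometry with a model of it.\<close>

locale block_pair = A: sympl V B + A': sympl V' B'
  for V :: "'v::boolean_group set" and B and V' :: "'w::boolean_group set" and B' +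
  fixes T h :: "'v \<Rightarrow> 'v" and T' h' :: "'w \<Rightarrow> 'w" and f :: "bit poly"
  assumes irr: "irreducible f"
    and T: "A.selfadj T" and T': "A'.selfadj T'"
    and fT: "x \<in> V \<Longrightarrow> act T f x = 0" and fT': "x' \<in> V' \<Longrightarrow> act T' f x' = 0"
    and h: "A.isom h" and h': "A'.isom h'"
    and comm: "x \<in> V \<Longrightarrow> h (T x) = T (h x)" and comm': "x' \<in> V' \<Longrightarrow> h' (T' x') = T' (h' x')"
begin

text \<open>In characteristic 2 this is also the difference of the two forms, so the graph of an
  isometry is totally isotropic for \<open>D\<close>.\<close>

definition D where "D = (\<lambda>u v. B (fst u) (fst v) + B' (snd u) (snd v))"

sublocale P: sympl "V \<times> V'" D
  unfolding D_def by (rule sympl_prod) unfold_locales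

abbreviation TT where "TT \<equiv> map_prod T T'"
abbreviation hh where "hh \<equiv> map_prod h h'"

lemma E: "endo V T" "endo V' T'" "endo V h" "endo V' h'"
  using T T' h h' by (simp_all add: A.selfadj_endo A'.selfadj_endo A.isom_endo A'.isom_endo)

lemma ETT: "endo (V \<times> V') TT" and Ehh: "endo (V \<times> V') hh"
  by (simp_all add: endo_map_prod E)

lemma act_TT: "act TT p z = (act T p (fst z), act T' p (snd z))"
  by (rule act_map_prod) (rule E)+

lemma selfadj_TT: "P.selfadj TT"
  unfolding P.selfadj_def using ETT
  by (auto simp: D_def A.selfadjD[OF T] A'.selfadjD[OF T'])

lemma f_TT: "z \<in> V \<times> V' \<Longrightarrow> act TT f z = 0"
  by (auto simp: act_TT fT fT' zero_prod_def)

lemma comm_hh: "z \<in> V \<times> V' \<Longrightarrow> hh (TT z) = TT (hh z)"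
  by (auto simp: comm comm')

text \<open>Graphs of equivariant isometries between nondegenerate stable subspaces.\<close>

definition good :: "('v \<times> 'w) set \<Rightarrow> bool" where
  "good \<Gamma> \<longleftrightarrow> subgp \<Gamma> \<and> \<Gamma> \<subseteq> V \<times> V' \<and> (\<forall>u\<in>\<Gamma>. TT u \<in> \<Gamma> \<and> hh u \<in> \<Gamma>) \<and>
     (\<forall>u\<in>\<Gamma>. \<forall>v\<in>\<Gamma>. B (fst u) (fst v) = B' (snd u) (snd v)) \<and>
     (\<forall>u\<in>\<Gamma>. (\<forall>v\<in>\<Gamma>. B (fst u) (fst v) = 0) \<longrightarrow> u = 0)"

lemma good_fst:
  assumes "good \<Gamma>"
  shows "A.stable_nondeg T h (fst ` \<Gamma>)" "card (fst ` \<Gamma>) = card \<Gamma>"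
proof -
  have g: "subgp \<Gamma>" "\<Gamma> \<subseteq> V \<times> V'" "\<And>u. u \<in> \<Gamma> \<Longrightarrow> TT u \<in> \<Gamma> \<and> hh u \<in> \<Gamma>"
    "\<And>u. u \<in> \<Gamma> \<Longrightarrow> (\<And>v. v \<in> \<Gamma> \<Longrightarrow> B (fst u) (fst v) = 0) \<Longrightarrow> u = 0"
    using assms unfolding good_def by blast+
  have s: "subgp (fst ` \<Gamma>)" unfolding subgp_def
  proof (intro conjI ballI)
    show "0 \<in> fst ` \<Gamma>" using subgp_0[OF g(1)] by (metis fst_zero imageI)
    fix x y assume "x \<in> fst ` \<Gamma>" "y \<in> fst ` \<Gamma>"
    then obtain u v where "u \<in> \<Gamma>" "v \<in> \<Gamma>" "x = fst u" "y = fst v" by blast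
    then show "x + y \<in> fst ` \<Gamma>" using subgp_add[OF g(1), of u v] by (metis fst_add imageI)
  qed
  have n: "u = 0" if "u \<in> \<Gamma>" "fst u \<in> A.perp (fst ` \<Gamma>)" for u
    using that g(4)[OF that(1)] by (auto simp: A.perp_def)
  have "fst ` \<Gamma> \<inter> A.perp (fst ` \<Gamma>) = {0}"
  proof
    show "fst ` \<Gamma> \<inter> A.perp (fst ` \<Gamma>) \<subseteq> {0}" using n by fastforce
    show "{0} \<subseteq> fst ` \<Gamma> \<inter> A.perp (fst ` \<Gamma>)"
      using subgp_0[OF s] g(2) by (auto simp: A.perp_def)
  qed
  moreover have "T (fst u) \<in> fst ` \<Gamma> \<and> h (fst u) \<in> fst ` \<Gamma>" if "u \<in> \<Gamma>" for u
    using g(3)[OF that] by (metis fst_map_prod imageI)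
  ultimately show "A.stable_nondeg T h (fst ` \<Gamma>)" using s g(2) by (auto simp: A.stable_nondeg_def)
  have "inj_on fst \<Gamma>"
  proof (rule inj_onI)
    fix u v assume uv: "u \<in> \<Gamma>" "v \<in> \<Gamma>" "fst u = fst v"
    have "fst (u + v) = 0" using uv by simp
    then have "u + v = 0"
      using subgp_add[OF g(1) uv(1,2)] g(2) by (intro g(4)) auto
    then show "u = v" by simp
  qed
  then show "card (fst ` \<Gamma>) = card \<Gamma>" by (rule card_image)
qed

end

context block_pair
begin

lemma swap: "block_pair V' B' V B T' h' T h f"
  by unfold_locales (use irr T T' h h' fT fT' comm comm' in auto)

lemma good_swap:
  assumes "good \<Gamma>"
  shows "block_pair.good V' B' V B T' h' T h (prod.swap ` \<Gamma>)"
proof -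
  interpret S: block_pair V' B' V B T' h' T h f by (rule swap)
  have g: "subgp \<Gamma>" "\<Gamma> \<subseteq> V \<times> V'" "\<And>u. u \<in> \<Gamma> \<Longrightarrow> TT u \<in> \<Gamma> \<and> hh u \<in> \<Gamma>"
    "\<And>u v. u \<in> \<Gamma> \<Longrightarrow> v \<in> \<Gamma> \<Longrightarrow> B (fst u) (fst v) = B' (snd u) (snd v)"
    "\<And>u. u \<in> \<Gamma> \<Longrightarrow> (\<And>v. v \<in> \<Gamma> \<Longrightarrow> B (fst u) (fst v) = 0) \<Longrightarrow> u = 0"
    using assms unfolding good_def by blast+
  have "subgp (prod.swap ` \<Gamma>)" using g(1) by (force simp: subgp_def zero_prod_def image_iff)
  moreover have "prod.swap ` \<Gamma> \<subseteq> V' \<times> V" using g(2) by auto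
  moreover have "S.TT u \<in> prod.swap ` \<Gamma> \<and> S.hh u \<in> prod.swap ` \<Gamma>" if "u \<in> prod.swap ` \<Gamma>" for u
    using that g(3) by (force simp: image_iff)
  moreover have "B' (fst u) (fst v) = B (snd u) (snd v)" if "u \<in> prod.swap ` \<Gamma>" "v \<in> prod.swap ` \<Gamma>" for u v
    using that g(4) by force
  moreover have "u = 0" if u: "u \<in> prod.swap ` \<Gamma>" and z: "\<forall>v\<in>prod.swap ` \<Gamma>. B' (fst u) (fst v) = 0" for u
  proof -
    have w: "prod.swap u \<in> \<Gamma>" using u by auto
    have "prod.swap u = 0"
    proof (rule g(5)[OF w])
      fix v assume v: "v \<in> \<Gamma>"
      then have "B' (fst u) (fst (prod.swap v)) = 0" using z by blast
      then show "B (fst (prod.swap u)) (fst v) = 0" using g(4)[OF w v] by simp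
    qed
    then show "u = 0" by (cases u) (simp add: zero_prod_def)
  qed
  ultimately show ?thesis unfolding S.good_def by blast
qed

lemma good_snd:
  assumes "good \<Gamma>"
  shows "A'.stable_nondeg T' h' (snd ` \<Gamma>)" "card (snd ` \<Gamma>) = card \<Gamma>"
proof -
  interpret S: block_pair V' B' V B T' h' T h f by (rule swap)
  have "fst ` (prod.swap ` \<Gamma>) = snd ` \<Gamma>" by (simp add: image_image)
  then show "A'.stable_nondeg T' h' (snd ` \<Gamma>)" "card (snd ` \<Gamma>) = card \<Gamma>"
    using S.good_fst[OF good_swap[OF assms]] by (simp_all add: card_image)
qed

text \<open>The module generated by \<open>z\<close> and \<open>w\<close> is added to \<Gamma>. It
  is orthogonal to \<Gamma> in both components, \<open>eq\<close> makes the mixed products agree,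
  and \<open>selfadj_alternating\<close> kills the products of each generator with its own
  multiples; so the result is isotropic for \<open>D\<close>. \<open>hz\<close> and
  \<open>hw\<close> make it stable under \<open>hh\<close>.\<close>

lemma good_extend:
  assumes \<Gamma>: "good \<Gamma>" and z: "fst z \<in> A.perp (fst ` \<Gamma>)" "snd z \<in> A'.perp (snd ` \<Gamma>)"
    and w: "fst w \<in> A.perp (fst ` \<Gamma>)" "snd w \<in> A'.perp (snd ` \<Gamma>)"
    and eq: "\<And>p. B (act T p (fst z)) (fst w) = B' (act T' p (snd z)) (snd w)"
    and one: "B (fst z) (fst w) = 1"
    and hz: "hh z = act TT p1 z + act TT q1 w" and hw: "hh w = act TT p2 z + act TT q2 w"
  shows "\<exists>\<Gamma>2. good \<Gamma>2 \<and> card \<Gamma> < card \<Gamma>2"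
proof -
  have g: "subgp \<Gamma>" "\<Gamma> \<subseteq> V \<times> V'" "\<And>u. u \<in> \<Gamma> \<Longrightarrow> TT u \<in> \<Gamma>" "\<And>u. u \<in> \<Gamma> \<Longrightarrow> hh u \<in> \<Gamma>"
    "\<And>u v. u \<in> \<Gamma> \<Longrightarrow> v \<in> \<Gamma> \<Longrightarrow> B (fst u) (fst v) = B' (snd u) (snd v)"
    "\<And>u. u \<in> \<Gamma> \<Longrightarrow> (\<And>v. v \<in> \<Gamma> \<Longrightarrow> B (fst u) (fst v) = 0) \<Longrightarrow> u = 0"
    using \<Gamma> unfolding good_def by blast+
  note sf = good_fst(1)[OF \<Gamma>] and ss = good_snd(1)[OF \<Gamma>]
  have zV: "z \<in> V \<times> V'" and wV: "w \<in> V \<times> V'"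
    using z w by (auto simp: A.perp_def A'.perp_def mem_Times_iff)
  note cl = act_closed[OF ETT zV] act_closed[OF ETT wV]
  have cV: "c \<in> V \<times> V'" if "c \<in> \<Gamma>" for c using that g(2) by blast
  define G where "G = {c + (act TT p z + act TT q w) | c p q. c \<in> \<Gamma>}"
  have GI: "c + (act TT p z + act TT q w) \<in> G" if "c \<in> \<Gamma>" for c p q
    unfolding G_def using that by blast
  have GE: "\<exists>c p q. c \<in> \<Gamma> \<and> u = c + (act TT p z + act TT q w)" if "u \<in> G" for u
    using that unfolding G_def mem_Collect_eq by (elim exE conjE) (intro exI conjI)
  have GV: "G \<subseteq> V \<times> V'"
  proof
    fix u assume u: "u \<in> G"
    obtain c p q where "c \<in> \<Gamma>" "u = c + (act TT p z + act TT q w)"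
      using GE[OF u] by (elim exE conjE)
    then show "u \<in> V \<times> V'" using cV cl by (simp only: P.add_mem)
  qed
  have sG: "subgp G" unfolding subgp_def
  proof (intro conjI ballI)
    show "0 \<in> G" using GI[OF subgp_0[OF g(1)], of 0 0] by simp
    fix u v assume uv: "u \<in> G" "v \<in> G"
    obtain c p q d p' q' where *: "c \<in> \<Gamma>" "d \<in> \<Gamma>"
      "u = c + (act TT p z + act TT q w)" "v = d + (act TT p' z + act TT q' w)"
      using GE[OF uv(1)] GE[OF uv(2)] by (elim exE conjE) (rule that)
    have "u + v = (c + d) + (act TT (p + p') z + act TT (q + q') w)"
      using * by (simp add: act_add[OF ETT zV] act_add[OF ETT wV] ac_simps)
    then show "u + v \<in> G" using GI subgp_add[OF g(1)] *(1,2) by simp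
  qed
  have TG: "TT u \<in> G" if u: "u \<in> G" for u
  proof -
    obtain c p q where *: "c \<in> \<Gamma>" "u = c + (act TT p z + act TT q w)"
      using GE[OF u] by (elim exE conjE)
    have "TT u = TT c + (TT (act TT p z) + TT (act TT q w))"
      unfolding *(2) using cV[OF *(1)] cl
      by (simp only: endo_add[OF ETT] P.add_mem)
    also have "\<dots> = TT c + (act TT (pCons 0 p) z + act TT (pCons 0 q) w)"
      by (simp add: act_pCons[OF ETT])
    finally show ?thesis using GI[OF g(3)[OF *(1)]] by simp
  qed
  have hG: "hh u \<in> G" if u: "u \<in> G" for u
  proof -
    obtain c p q where *: "c \<in> \<Gamma>" "u = c + (act TT p z + act TT q w)"
      using GE[OF u] by (elim exE conjE)
    have "hh u = hh c + (hh (act TT p z) + hh (act TT q w))"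
      unfolding *(2) using cV[OF *(1)] cl
      by (simp only: endo_add[OF Ehh] P.add_mem)
    also have "hh (act TT p z) = act TT p (act TT p1 z + act TT q1 w)"
      using act_commute[OF ETT Ehh comm_hh zV] hz by simp
    also have "hh (act TT q w) = act TT q (act TT p2 z + act TT q2 w)"
      using act_commute[OF ETT Ehh comm_hh wV] hw by simp
    also have "act TT p (act TT p1 z + act TT q1 w) + act TT q (act TT p2 z + act TT q2 w)
      = act TT (p * p1 + q * p2) z + act TT (p * q1 + q * q2) w"
      using zV wV cl
      by (simp only: act_add[OF ETT zV] act_add[OF ETT wV] act_mult[OF ETT zV] act_mult[OF ETT wV]
          act_add_right[OF ETT] add.assoc add.commute add.left_commute)
    finally show ?thesis using GI[OF g(4)[OF *(1)]] by simp
  qed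
  have orth: "B (fst c) (fst (act TT p z)) = 0" "B (fst c) (fst (act TT p w)) = 0"
    "B' (snd c) (snd (act TT p z)) = 0" "B' (snd c) (snd (act TT p w)) = 0" if c: "c \<in> \<Gamma>" for c p
  proof -
    have "act T p (fst z) \<in> A.perp (fst ` \<Gamma>)" "act T p (fst w) \<in> A.perp (fst ` \<Gamma>)"
      "act T' p (snd z) \<in> A'.perp (snd ` \<Gamma>)" "act T' p (snd w) \<in> A'.perp (snd ` \<Gamma>)"
      using A.act_perp[OF sf T] A'.act_perp[OF ss T'] z w by blast+
    then show "B (fst c) (fst (act TT p z)) = 0" "B (fst c) (fst (act TT p w)) = 0"
      "B' (snd c) (snd (act TT p z)) = 0" "B' (snd c) (snd (act TT p w)) = 0"
      using c cV[OF c] by (auto simp: act_TT A.perp_def A'.perp_def A.symm A'.symm)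
  qed
  have self: "D (act TT p u) (act TT q u) = 0" if "u \<in> V \<times> V'" for p q u
  proof -
    have "D (act TT p u) (act TT q u) = D (act TT (q * p) u) u"
      using that P.selfadjD[OF P.selfadj_act[OF selfadj_TT], of "act TT p u" u q] act_closed[OF ETT that]
      by (simp add: act_mult[OF ETT])
    then show ?thesis using P.selfadj_alternating[OF selfadj_TT irr f_TT that] by simp
  qed
  have zw: "D (act TT p z) (act TT q w) = 0" for p q
  proof -
    have "D (act TT p z) (act TT q w) = D (act TT (q * p) z) w"
      using zV wV P.selfadjD[OF P.selfadj_act[OF selfadj_TT], of "act TT p z" w q] cl
      by (simp add: act_mult[OF ETT])
    also have "\<dots> = 0" unfolding D_def act_TT fst_conv snd_conv eq by simp
    finally show ?thesis .
  qed
  have wz: "D (act TT q w) (act TT p z) = 0" for p q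
    using zw[of p q] P.symm[OF cl(2) cl(1)] by simp
  have iso: "D u v = 0" if uv: "u \<in> G" "v \<in> G" for u v
  proof -
    obtain c p q d p' q' where *: "c \<in> \<Gamma>" "d \<in> \<Gamma>"
      "u = c + (act TT p z + act TT q w)" "v = d + (act TT p' z + act TT q' w)"
      using GE[OF uv(1)] GE[OF uv(2)] by (elim exE conjE) (rule that)
    have 1: "D c d = 0" using g(5)[OF *(1,2)] by (simp add: D_def)
    have 2: "D c (act TT r z) = 0" "D c (act TT r w) = 0" "D d (act TT r z) = 0" "D d (act TT r w) = 0" for r
      using orth[OF *(1)] orth[OF *(2)] by (simp_all only: D_def add_0)
    have 3: "D (act TT r z) d = 0" "D (act TT r w) d = 0" for r
      using 2(3,4) P.symm[OF cV[OF *(2)] cl(1)] P.symm[OF cV[OF *(2)] cl(2)] by simp_all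
    show ?thesis unfolding *(3,4) using cV[OF *(1)] cV[OF *(2)] cl
      by (simp only: P.addl P.addr P.add_mem 1 2 3 self[OF zV] self[OF wV] zw wz add_0)
  qed
  have nd: "u = 0" if u: "u \<in> G" and zero: "\<And>v. v \<in> G \<Longrightarrow> B (fst u) (fst v) = 0" for u
  proof -
    obtain c p q where *: "c \<in> \<Gamma>" "u = c + (act TT p z + act TT q w)"
      using GE[OF u] by (elim exE conjE)
    have fz: "fst z \<in> V" "fst w \<in> V" "fst c \<in> V" using zV wV cV[OF *(1)] by auto
    have fu: "fst u = fst c + (act T p (fst z) + act T q (fst w))" using * by (simp add: act_TT)
    note clT = act_closed[OF E(1) fz(1)] act_closed[OF E(1) fz(2)]
    have Bfu: "B (fst u) t = B (fst c) t + (B (act T p (fst z)) t + B (act T q (fst w)) t)"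
      if "t \<in> V" for t
      unfolding fu using fz clT that by (simp only: A.addl A.add_mem)
    have "c = 0"
    proof (rule g(6)[OF *(1)])
      fix d assume d: "d \<in> \<Gamma>"
      have dV: "fst d \<in> V" using cV[OF d] by auto
      have "B (fst u) (fst d) = 0" using zero GI[OF d, of 0 0] by simp
      moreover have "B (act T p (fst z)) (fst d) = 0" "B (act T q (fst w)) (fst d) = 0"
        using orth(1,2)[OF d] A.symm[OF dV clT(1)] A.symm[OF dV clT(2)] by (simp_all add: act_TT)
      ultimately show "B (fst c) (fst d) = 0" using Bfu[OF dV] by simp
    qed
    have ac: "act TT s z \<in> G" "act TT s w \<in> G" for s
      using GI[OF subgp_0[OF g(1)], of s 0] GI[OF subgp_0[OF g(1)], of 0 s] by simp_all
    have selfB: "B (act T p (fst x)) (act T s (fst x)) = 0" if "fst x \<in> V" for p s x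
    proof -
      have "B (act T p (fst x)) (act T s (fst x)) = B (act T (s * p) (fst x)) (fst x)"
        using that A.selfadjD[OF A.selfadj_act[OF T], of "act T p (fst x)" "fst x" s] act_closed[OF E(1) that]
        by (simp add: act_mult[OF E(1)])
      then show ?thesis using A.selfadj_alternating[OF T irr fT that] by simp
    qed
    \<comment> \<open>If the residue of \<open>p\<close> were invertible, pairing \<open>u\<close>
      with the multiple of \<open>w\<close> by its inverse would give
      \<open>B (fst z) (fst w)\<close>, which is 1, instead of 0.\<close>
    have "f dvd p"
    proof (rule ccontr)
      assume "\<not> f dvd p"
      then obtain s where s: "act T s (act T p (fst z)) = fst z"
        using act_unit[OF E(1) irr fz(1) fT[OF fz(1)]] by blast
      have "B (fst u) (act T s (fst w)) = 0" using zero[OF ac(2)[of s]] by (simp add: act_TT)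
      then have "B (act T p (fst z)) (act T s (fst w)) = 0"
        using Bfu[OF clT(2)] selfB[of w q s] fz \<open>c = 0\<close> clT by simp
      then have "B (act T s (act T p (fst z))) (fst w) = 0"
        using A.selfadjD[OF A.selfadj_act[OF T], of "act T p (fst z)" "fst w" s] clT fz by simp
      then show False using s one by simp
    qed
    have "f dvd q"
    proof (rule ccontr)
      assume "\<not> f dvd q"
      then obtain s where s: "act T s (act T q (fst w)) = fst w"
        using act_unit[OF E(1) irr fz(2) fT[OF fz(2)]] by blast
      have "B (fst u) (act T s (fst z)) = 0" using zero[OF ac(1)[of s]] by (simp add: act_TT)
      then have "B (act T q (fst w)) (act T s (fst z)) = 0"
        using Bfu[OF clT(1)] selfB[of z p s] fz \<open>c = 0\<close> clT by simp
      then have "B (act T s (act T q (fst w))) (fst z) = 0"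
        using A.selfadjD[OF A.selfadj_act[OF T], of "act T q (fst w)" "fst z" s] clT fz by simp
      then show False using s one A.symm[OF fz(1,2)] by simp
    qed
    show "u = 0" using * \<open>c = 0\<close> act_dvd[OF ETT \<open>f dvd p\<close> f_TT zV] act_dvd[OF ETT \<open>f dvd q\<close> f_TT wV]
      by simp
  qed
  have "good G" unfolding good_def
  proof (intro conjI ballI impI)
    fix u v assume "u \<in> G" "v \<in> G"
    then have "D u v = 0" by (rule iso)
    then show "B (fst u) (fst v) = B' (snd u) (snd v)" by (simp add: D_def)
  qed (use sG GV TG hG nd in auto)
  moreover have "\<Gamma> \<subset> G"
  proof
    show "\<Gamma> \<subseteq> G" using GI[of _ 0 0] by auto
    have "act TT 1 z \<in> G" using GI[OF subgp_0[OF g(1)], of 1 0] by simp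
    then have "z \<in> G" by (simp add: act_one[OF ETT])
    moreover have "z \<notin> \<Gamma>"
    proof
      assume "z \<in> \<Gamma>"
      then have "B (fst w) (fst z) = 0" using w(1) by (auto simp: A.perp_def)
      then show False using one A.symm[of "fst w" "fst z"] zV wV by auto
    qed
    ultimately show "\<Gamma> \<noteq> G" by auto
  qed
  ultimately show ?thesis using GV P.fin by (meson finite_subset psubset_card_mono)
qed

text \<open>Finiteness replaces an induction on dimension: a good graph of maximal size projects
  onto both spaces, for otherwise \<open>step\<close> finds a further block in the two complements.
  Equal cardinalities ensure that neither projection fills its space before the other.\<close>

theorem isometry_exists:
  assumes card: "card V = card V'"
    and step: "\<And>U U'. A.stable_nondeg T h U \<Longrightarrow> A'.stable_nondeg T' h' U' \<Longrightarrow> U \<noteq> V \<Longrightarrow> U' \<noteq> V' \<Longrightarrow>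
      \<exists>z w p1 q1 p2 q2. fst z \<in> A.perp U \<and> snd z \<in> A'.perp U' \<and> fst w \<in> A.perp U \<and> snd w \<in> A'.perp U' \<and>
        (\<forall>p. B (act T p (fst z)) (fst w) = B' (act T' p (snd z)) (snd w)) \<and> B (fst z) (fst w) = 1 \<and>
        hh z = act TT p1 z + act TT q1 w \<and> hh w = act TT p2 z + act TT q2 w"
  obtains \<sigma> where "bij_betw \<sigma> V V'" "\<And>x y. x \<in> V \<Longrightarrow> y \<in> V \<Longrightarrow> \<sigma> (x + y) = \<sigma> x + \<sigma> y"
    "\<And>x y. x \<in> V \<Longrightarrow> y \<in> V \<Longrightarrow> B' (\<sigma> x) (\<sigma> y) = B x y"
    "\<And>x. x \<in> V \<Longrightarrow> \<sigma> (T x) = T' (\<sigma> x)" "\<And>x. x \<in> V \<Longrightarrow> \<sigma> (h x) = h' (\<sigma> x)"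
proof -
  have "good {0}"
    using endo_0[OF ETT] endo_0[OF Ehh] by (auto simp: good_def subgp_def)
  then have "{\<Gamma>. good \<Gamma>} \<noteq> {}" by blast
  moreover have "{\<Gamma>. good \<Gamma>} \<subseteq> Pow (V \<times> V')" by (auto simp: good_def)
  ultimately obtain \<Gamma> where \<Gamma>: "good \<Gamma>" and max: "\<And>\<Gamma>'. good \<Gamma>' \<Longrightarrow> card \<Gamma>' \<le> card \<Gamma>"
    using ex_max_card[OF P.fin, of "{\<Gamma>. good \<Gamma>}"] by (metis mem_Collect_eq)
  have g: "subgp \<Gamma>" "\<Gamma> \<subseteq> V \<times> V'" "\<And>u. u \<in> \<Gamma> \<Longrightarrow> TT u \<in> \<Gamma>" "\<And>u. u \<in> \<Gamma> \<Longrightarrow> hh u \<in> \<Gamma>"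
    "\<And>u v. u \<in> \<Gamma> \<Longrightarrow> v \<in> \<Gamma> \<Longrightarrow> B (fst u) (fst v) = B' (snd u) (snd v)"
    "\<And>u. u \<in> \<Gamma> \<Longrightarrow> (\<And>v. v \<in> \<Gamma> \<Longrightarrow> B (fst u) (fst v) = 0) \<Longrightarrow> u = 0"
    using \<Gamma> unfolding good_def by blast+
  have sub: "fst ` \<Gamma> \<subseteq> V" "snd ` \<Gamma> \<subseteq> V'" using g(2) by auto
  have V: "fst ` \<Gamma> = V \<and> snd ` \<Gamma> = V'"
  proof (rule ccontr)
    assume n: "\<not> ?thesis"
    have "fst ` \<Gamma> = V \<longleftrightarrow> card \<Gamma> = card V"
      using good_fst(2)[OF \<Gamma>] sub(1) A.fin by (metis card_subset_eq)
    moreover have "snd ` \<Gamma> = V' \<longleftrightarrow> card \<Gamma> = card V"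
      using good_snd(2)[OF \<Gamma>] sub(2) A'.fin card by (metis card_subset_eq)
    ultimately have "fst ` \<Gamma> \<noteq> V" "snd ` \<Gamma> \<noteq> V'" using n by auto
    then obtain z w p1 q1 p2 q2 where
      "fst z \<in> A.perp (fst ` \<Gamma>)" "snd z \<in> A'.perp (snd ` \<Gamma>)" "fst w \<in> A.perp (fst ` \<Gamma>)"
      "snd w \<in> A'.perp (snd ` \<Gamma>)" "\<And>p. B (act T p (fst z)) (fst w) = B' (act T' p (snd z)) (snd w)"
      "B (fst z) (fst w) = 1" "hh z = act TT p1 z + act TT q1 w" "hh w = act TT p2 z + act TT q2 w"
      using step[OF good_fst(1)[OF \<Gamma>] good_snd(1)[OF \<Gamma>]] by blast
    then obtain \<Gamma>2 where "good \<Gamma>2" "card \<Gamma> < card \<Gamma>2" using good_extend[OF \<Gamma>] by blast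
    then show False using max by fastforce
  qed
  have ex: "\<exists>x'. (x, x') \<in> \<Gamma>" if "x \<in> V" for x
  proof -
    have "x \<in> fst ` \<Gamma>" using V that by simp
    then show ?thesis by force
  qed
  define \<sigma> where "\<sigma> x = (SOME x'. (x, x') \<in> \<Gamma>)" for x
  have \<sigma>: "(x, \<sigma> x) \<in> \<Gamma>" if "x \<in> V" for x
    using someI_ex[OF ex[OF that]] by (simp add: \<sigma>_def)
  have uniq: "x' = \<sigma> x" if "(x, x') \<in> \<Gamma>" for x x'
  proof -
    have x: "x \<in> V" using that g(2) by auto
    have "(x, x') + (x, \<sigma> x) \<in> \<Gamma>" using subgp_add[OF g(1) that \<sigma>[OF x]] .
    then have *: "(0, x' + \<sigma> x) \<in> \<Gamma>" by simp
    have "(0 :: 'v, x' + \<sigma> x) = 0"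
      using g(2) by (intro g(6)[OF *]) auto
    then show ?thesis by (simp add: zero_prod_def)
  qed
  have closed: "\<sigma> x \<in> V'" if "x \<in> V" for x using \<sigma>[OF that] g(2) by auto
  have "V' \<subseteq> \<sigma> ` V"
  proof
    fix x' assume "x' \<in> V'"
    then have "x' \<in> snd ` \<Gamma>" using V by simp
    then obtain x where "(x, x') \<in> \<Gamma>" by force
    then show "x' \<in> \<sigma> ` V" using uniq g(2) by auto
  qed
  then have im: "\<sigma> ` V = V'" using closed by auto
  then have "inj_on \<sigma> V" using card A.fin by (simp add: eq_card_imp_inj_on)
  show ?thesis
  proof (rule that)
    show "bij_betw \<sigma> V V'" using im \<open>inj_on \<sigma> V\<close> by (simp add: bij_betw_def)
    fix x assume x: "x \<in> V"
    show "\<sigma> (T x) = T' (\<sigma> x)" using uniq g(3)[OF \<sigma>[OF x]] by auto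
    show "\<sigma> (h x) = h' (\<sigma> x)" using uniq g(4)[OF \<sigma>[OF x]] by auto
    fix y assume y: "y \<in> V"
    show "\<sigma> (x + y) = \<sigma> x + \<sigma> y" using uniq subgp_add[OF g(1) \<sigma>[OF x] \<sigma>[OF y]] by auto
    show "B' (\<sigma> x) (\<sigma> y) = B x y" using g(5)[OF \<sigma>[OF x] \<sigma>[OF y]] by simp
  qed
qed

end

context block_pair
begin

text \<open>Pairing the multiples of \<open>x\<close> with \<open>y\<close>, and those of
  \<open>x'\<close> with \<open>y'\<close>, gives two functionals on residues modulo
  \<open>f\<close>. The second is nonzero by \<open>one\<close>, so
  \<open>functional_rescale\<close> matches them by a multiplier \<open>c\<close>.\<close>

lemma rescale:
  assumes x: "x \<in> V" "y \<in> V" and x': "x' \<in> V'" "y' \<in> V'" and one: "B' x' y' = 1"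
  obtains c where "\<And>p. B' (act T' p (act T' c x')) y' = B (act T p x) y"
proof -
  define l where "l p = B (act T p x) y" for p
  define l' where "l' p = B' (act T' p x') y'" for p
  obtain c where c: "\<And>p. l' (p * c) = l p"
  proof (rule functional_rescale[OF irr, of l l' 1])
    show "l' 1 \<noteq> 0" using one by (simp add: l'_def act_one[OF E(2)])
  qed (auto simp: l_def l'_def A.functional_act[OF T fT x] A'.functional_act[OF T' fT' x'])
  have "B' (act T' p (act T' c x')) y' = B (act T p x) y" for p
    using c[of p] x'(1) by (simp add: l_def l'_def act_mult[OF E(2)])
  then show ?thesis using that by blast
qed

end

section \<open>Blocks: hyperbolic planes over a field, and planes spanned by a vector and its
  image\<close>

context sympl
begin

text \<open>The blocks are hyperbolic planes over the residue field of \<open>f\<close>. One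
  generator of the second plane is rescaled so that both planes have the same products.\<close>

lemma selfadj_conjugate:
  assumes T: "selfadj T" "selfadj T'" and f: "irreducible f"
    "\<And>x. x \<in> V \<Longrightarrow> act T f x = 0" "\<And>x. x \<in> V \<Longrightarrow> act T' f x = 0"
  obtains \<sigma> where "isom \<sigma>" "\<And>x. x \<in> V \<Longrightarrow> \<sigma> (T x) = T' (\<sigma> x)"
proof -
  interpret Q: block_pair V B V B T "\<lambda>x. x" T' "\<lambda>x. x" f
    by unfold_locales (use assms isom_id in auto)
  obtain \<sigma> where \<sigma>: "bij_betw \<sigma> V V" "\<And>x y. x \<in> V \<Longrightarrow> y \<in> V \<Longrightarrow> \<sigma> (x + y) = \<sigma> x + \<sigma> y"
    "\<And>x y. x \<in> V \<Longrightarrow> y \<in> V \<Longrightarrow> B (\<sigma> x) (\<sigma> y) = B x y"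
    "\<And>x. x \<in> V \<Longrightarrow> \<sigma> (T x) = T' (\<sigma> x)"
  proof (rule Q.isometry_exists[OF refl])
    fix U U' assume U: "stable_nondeg T (\<lambda>x. x) U" "stable_nondeg T' (\<lambda>x. x) U'" "U \<noteq> V" "U' \<noteq> V"
    obtain x y where xy: "x \<in> perp U" "y \<in> perp U" "B x y = 1"
      using hyperbolic_pair_perp[OF U(1,3)] .
    obtain x' y' where xy': "x' \<in> perp U'" "y' \<in> perp U'" "B x' y' = 1"
      using hyperbolic_pair_perp[OF U(2,4)] .
    have inV: "x \<in> V" "y \<in> V" "x' \<in> V" "y' \<in> V" using xy xy' by (auto simp: perp_def)
    obtain c where c: "\<And>p. B (act T' p (act T' c x')) y' = B (act T p x) y"
      using Q.rescale[OF inV xy'(3)] by blast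
    define z w where "z = (x, act T' c x')" and "w = (y, y')"
    have e: "Q.hh u = u" for u by (cases u) simp
    show "\<exists>z w p1 q1 p2 q2. fst z \<in> perp U \<and> snd z \<in> perp U' \<and> fst w \<in> perp U \<and> snd w \<in> perp U' \<and>
        (\<forall>p. B (act T p (fst z)) (fst w) = B (act T' p (snd z)) (snd w)) \<and> B (fst z) (fst w) = 1 \<and>
        Q.hh z = act Q.TT p1 z + act Q.TT q1 w \<and> Q.hh w = act Q.TT p2 z + act Q.TT q2 w"
      by (rule exI[of _ z], rule exI[of _ w], rule exI[of _ 1], rule exI[of _ 0],
          rule exI[of _ 0], rule exI[of _ 1])
        (use xy xy' c act_perp[OF U(2) T(2)] in \<open>simp add: z_def w_def act_one[OF Q.ETT]\<close>)
  qed blast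
  have "isom \<sigma>" unfolding isom_def endo_def using \<sigma> sub by (auto simp: bij_betw_def)
  then show ?thesis using that \<sigma>(4) by blast
qed

text \<open>Suppose \<open>B x (h x) = 0\<close> on the whole complement. Polarising gives
  \<open>B x (h y) = B y (h x)\<close>, while the quadratic relation gives
  \<open>B y (h x) = B (T y) x + B x (h y)\<close>. So \<open>T y\<close> is orthogonal to the
  complement, hence 0, and \<open>h (h y) = y\<close> contradicts \<open>free\<close>.\<close>

lemma block_generator_exists:
  assumes U: "stable_nondeg T h U" "U \<noteq> V" and T: "selfadj T" and h: "isom h"
    and comm: "\<And>x. x \<in> V \<Longrightarrow> h (T x) = T (h x)"
    and hh: "\<And>x. x \<in> V \<Longrightarrow> h (h x) = T (h x) + x"
    and free: "\<And>x. x \<in> V \<Longrightarrow> h (h x) = x \<Longrightarrow> x = 0"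
  obtains x where "x \<in> perp U" "B x (h x) = 1"
proof (rule ccontr)
  assume "\<not> thesis"
  then have z: "B x (h x) = 0" if "x \<in> perp U" for x
    using \<open>\<And>x. x \<in> perp U \<Longrightarrow> B x (h x) = 1 \<Longrightarrow> thesis\<close>[of x] that by (cases "B x (h x)") auto
  have E: "endo V T" "endo V h" using T h by (simp_all add: selfadj_endo isom_endo)
  obtain y where y: "y \<in> perp U" "y \<noteq> 0" using perp_nontrivial[OF U] .
  have yV: "y \<in> V" using y by (simp add: perp_def)
  have Ty: "T y \<in> perp U" using act_perp[OF U(1) T y(1), of "[:0, 1:]"] by (simp add: act_X[OF E(1)])
  have sp: "subgp (perp U)" using U(1) by (intro subgp_perp) (simp add: stable_nondeg_def)
  have "T y = 0"
  proof (rule perp_nondeg[OF U(1) Ty])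
    fix x assume x: "x \<in> perp U"
    have xV: "x \<in> V" using x by (simp add: perp_def)
    note hV = isom_closed[OF h xV] isom_closed[OF h yV] endo_closed[OF E(1) yV]
    have "B (x + y) (h (x + y)) = 0" using z subgp_add[OF sp x y(1)] by blast
    then have 1: "B x (h y) + B y (h x) = 0"
      using z[OF x] z[OF y(1)] xV yV hV by (simp add: endo_add[OF E(2)] addl addr)
    have "B y (h x) = B (h y) (T (h x) + x)"
      using isom_B[OF h yV hV(1)] hh[OF xV] by simp
    also have "\<dots> = B (h y) (T (h x)) + B (h y) x"
      using xV hV by (simp add: addr endo_closed[OF E(1)])
    also have "B (h y) (T (h x)) = B (h (T y)) (h x)"
      using selfadjD[OF T hV(2,1)] comm[OF yV] by simp
    also have "\<dots> = B (T y) x" using isom_B[OF h hV(3) xV] .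
    also have "B (h y) x = B x (h y)" using symm xV hV by blast
    finally show "B (T y) x = 0" using 1 by (simp add: ac_simps)
  qed
  then have "h (h y) = y" using hh[OF yV] comm[OF yV] endo_0[OF E(2)] by simp
  then show False using free[OF yV] y(2) by blast
qed

end

context block_pair
begin

text \<open>The block of \<open>x\<close> and \<open>h x\<close> is determined by the functional
  sending \<open>p\<close> to \<open>B (act T p x) (h x)\<close>. Replacing \<open>x'\<close> by its
  multiple by \<open>s\<close> multiplies its functional by the square of \<open>s\<close>, so the
  factor from \<open>rescale\<close> must be a square modulo \<open>f\<close>; in characteristic 2
  it always is.\<close>

lemma isometry_exists_quadratic:
  assumes card: "card V = card V'"
    and hh: "\<And>x. x \<in> V \<Longrightarrow> h (h x) = T (h x) + x" "\<And>x. x \<in> V' \<Longrightarrow> h' (h' x) = T' (h' x) + x"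
    and free: "\<And>x. x \<in> V \<Longrightarrow> h (h x) = x \<Longrightarrow> x = 0" "\<And>x. x \<in> V' \<Longrightarrow> h' (h' x) = x \<Longrightarrow> x = 0"
  obtains \<sigma> where "bij_betw \<sigma> V V'" "\<And>x y. x \<in> V \<Longrightarrow> y \<in> V \<Longrightarrow> \<sigma> (x + y) = \<sigma> x + \<sigma> y"
    "\<And>x y. x \<in> V \<Longrightarrow> y \<in> V \<Longrightarrow> B' (\<sigma> x) (\<sigma> y) = B x y"
    "\<And>x. x \<in> V \<Longrightarrow> \<sigma> (h x) = h' (\<sigma> x)"
proof -
  obtain \<sigma> where \<sigma>: "bij_betw \<sigma> V V'" "\<And>x y. x \<in> V \<Longrightarrow> y \<in> V \<Longrightarrow> \<sigma> (x + y) = \<sigma> x + \<sigma> y"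
    "\<And>x y. x \<in> V \<Longrightarrow> y \<in> V \<Longrightarrow> B' (\<sigma> x) (\<sigma> y) = B x y"
    "\<And>x. x \<in> V \<Longrightarrow> \<sigma> (h x) = h' (\<sigma> x)"
  proof (rule isometry_exists[OF card])
    fix U U' assume U: "A.stable_nondeg T h U" "A'.stable_nondeg T' h' U'" "U \<noteq> V" "U' \<noteq> V'"
    obtain x where x: "x \<in> A.perp U" "B x (h x) = 1"
      using A.block_generator_exists[OF U(1,3) T h comm hh(1) free(1)] by blast
    obtain x' where x': "x' \<in> A'.perp U'" "B' x' (h' x') = 1"
      using A'.block_generator_exists[OF U(2,4) T' h' comm' hh(2) free(2)] by blast
    have inV: "x \<in> V" "x' \<in> V'" using x x' by (auto simp: A.perp_def A'.perp_def)
    note hV = A.isom_closed[OF h inV(1)] A'.isom_closed[OF h' inV(2)]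
    obtain c where c: "\<And>p. B' (act T' p (act T' c x')) (h' x') = B (act T p x) (h x)"
      using rescale[OF inV(1) hV(1) inV(2) hV(2) x'(2)] by blast
    obtain s where s: "f dvd s * s - c" using irreducible_sqrt_mod[OF irr] .
    define y where "y = act T' s x'"
    have yV: "y \<in> V'" using inV by (simp add: y_def act_closed[OF E(2)])
    have ss: "act T' s y = act T' c x'"
    proof -
      have "act T' s y = act T' ((s * s - c) + c) x'" using inV by (simp add: y_def act_mult[OF E(2)])
      also have "\<dots> = act T' (s * s - c) x' + act T' c x'" using inV by (simp only: act_add[OF E(2)])
      also have "act T' (s * s - c) x' = 0" using act_dvd[OF E(2) s fT' inV(2)] .
      finally show ?thesis by simp
    qed
    have hy: "h' y = act T' s (h' x')"
      using act_commute[OF E(2) E(4) comm' inV(2)] by (simp add: y_def)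
    have key: "B' (act T' p y) (h' y) = B (act T p x) (h x)" for p
    proof -
      have "B' (act T' p y) (h' y) = B' (act T' s (act T' p y)) (h' x')"
        unfolding hy using A'.selfadjD[OF A'.selfadj_act[OF T'], of "act T' p y" "h' x'" s] yV hV
        by (simp add: act_closed[OF E(2)])
      also have "act T' s (act T' p y) = act T' p (act T' c x')"
        using act_comm[OF E(2) yV, of s p] ss by simp
      finally show ?thesis using c by simp
    qed
    define z w where "z = (x, y)" and "w = hh z"
    have zw: "fst z \<in> A.perp U" "snd z \<in> A'.perp U'" "fst w \<in> A.perp U" "snd w \<in> A'.perp U'"
      using x x' A.isom_perp[OF U(1) h] A'.isom_perp[OF U(2) h'] A'.act_perp[OF U(2) T']
      by (simp_all add: z_def w_def y_def)
    have "hh w = act TT 1 z + act TT [:0, 1:] w"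
      using hh(1)[OF inV(1)] hh(2)[OF yV] by (simp add: act_one[OF ETT] act_X[OF ETT] w_def z_def ac_simps)
    moreover have "hh z = act TT 0 z + act TT 1 w"
      by (simp add: act_one[OF ETT] w_def)
    moreover have "B (act T p (fst z)) (fst w) = B' (act T' p (snd z)) (snd w)" for p
      using key by (simp add: z_def w_def)
    moreover have "B (fst z) (fst w) = 1" using x by (simp add: z_def w_def)
    ultimately show "\<exists>z w p1 q1 p2 q2. fst z \<in> A.perp U \<and> snd z \<in> A'.perp U' \<and> fst w \<in> A.perp U \<and> snd w \<in> A'.perp U' \<and>
        (\<forall>p. B (act T p (fst z)) (fst w) = B' (act T' p (snd z)) (snd w)) \<and> B (fst z) (fst w) = 1 \<and>
        hh z = act TT p1 z + act TT q1 w \<and> hh w = act TT p2 z + act TT q2 w"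
      using zw by blast
  qed blast
  then show ?thesis using that by blast
qed

end

subsection \<open>Fixed-point-free isometries of odd prime order\<close>

declare One_nat_def [simp del]

lemma funpow_one [simp]: "f ^^ 1 = (f :: 'a \<Rightarrow> 'a)"
  by (rule ext) (simp add: One_nat_def)

lemma add_eq_swap: "a = b + c \<Longrightarrow> b = a + (c :: 'a::boolean_group)"
  by (simp add: add.assoc)

context sympl
begin

text \<open>Only \<open>f\<close> is kept as a parameter: by \<open>selfadj_conjugate\<close> all
  operators with the same irreducible \<open>f\<close> are conjugate, so two isometries have
  conjugates commuting with one field as soon as they share \<open>f\<close>.\<close>

definition field_op :: "('v \<Rightarrow> 'v) \<Rightarrow> bit poly \<Rightarrow> bool" where
  "field_op g f \<longleftrightarrow> (\<exists>T. selfadj T \<and> (\<forall>x\<in>V. act T f x = 0) \<and> (\<forall>x\<in>V. g (T x) = T (g x)))"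

end

text \<open>With \<open>X = x + x\<inverse>\<close> the polynomial \<open>repunit_poly n\<close> is the sum
  of all \<open>x powi i\<close> with \<open>\<bar>i\<bar> \<le> n\<close>.\<close>

fun repunit_poly :: "nat \<Rightarrow> bit poly" where
  "repunit_poly 0 = 1"
| "repunit_poly (Suc 0) = [:1, 1:]"
| "repunit_poly (Suc (Suc n)) = [:0, 1:] * repunit_poly (Suc n) + repunit_poly n"

lemma degree_repunit_poly: "degree (repunit_poly n) = n \<and> repunit_poly n \<noteq> 0"
proof (induction n rule: repunit_poly.induct)
  case (3 n)
  have d: "degree ([:0, 1:] * repunit_poly (Suc n)) = Suc (Suc n)"
    using 3 by (subst degree_mult_eq) auto
  have "degree (repunit_poly (Suc (Suc n))) = Suc (Suc n)"
    unfolding repunit_poly.simps(3)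
    by (subst degree_add_eq_left) (use d 3 in auto)
  then show ?case by fastforce
qed auto

text \<open>The reason for the order of 4: for a root of unity x of order \<open>r\<close>, raising
  to the power \<open>2 ^ n\<close> fixes x + 1/x exactly if \<open>2 ^ n\<close> is 1 or -1 modulo
  \<open>r\<close>, that is, if \<open>4 ^ n\<close> is 1.\<close>

lemma ord_4_dvd_iff:
  assumes r: "prime r" "odd r"
  shows "ord r (4::nat) dvd n \<longleftrightarrow> r dvd 2 ^ n - 1 \<or> r dvd 2 ^ n + 1"
proof -
  have "ord r (4::nat) dvd n \<longleftrightarrow> [4 ^ n = 1] (mod r)" by (simp add: ord_divides)
  also have "\<dots> \<longleftrightarrow> r dvd 4 ^ n - 1" using cong_altdef_nat[of 1 "4 ^ n" r] by simp
  also have "(4::nat) ^ n - 1 = (2 ^ n - 1) * (2 ^ n + 1)"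
  proof -
    have "(4::nat) ^ n = 2 ^ n * 2 ^ n" by (simp flip: power_mult_distrib)
    then show ?thesis by (simp add: algebra_simps diff_mult_distrib)
  qed
  finally show ?thesis using r(1) by (simp add: prime_dvd_mult_iff)
qed

locale free_isom = sympl +
  fixes g :: "'a \<Rightarrow> 'a" and r :: nat
  assumes g: "isom g" and r: "prime r" "odd r"
    and period: "x \<in> V \<Longrightarrow> (g ^^ r) x = x" and free: "x \<in> V \<Longrightarrow> g x = x \<Longrightarrow> x = 0"
begin

lemma Eg: "endo V g" using g by (rule isom_endo)

lemma gV: "x \<in> V \<Longrightarrow> (g ^^ n) x \<in> V"
  using isom_closed[OF isom_funpow[OF g]] .

lemma gadd: "x \<in> V \<Longrightarrow> y \<in> V \<Longrightarrow> (g ^^ n) (x + y) = (g ^^ n) x + (g ^^ n) y"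
  using endo_add[OF endo_funpow[OF Eg]] .

lemma gcomp: "(g ^^ m) ((g ^^ n) x) = (g ^^ (m + n)) x"
  by (simp add: funpow_add)

lemma r_pos: "r > 2"
  using r prime_ge_2_nat[of r] by (cases "r = 2") auto

lemma period_mult: "x \<in> V \<Longrightarrow> (g ^^ (r * i)) x = x"
  by (induction i) (auto simp: funpow_add period)

lemma funpow_mod:
  assumes "x \<in> V"
  shows "(g ^^ n) x = (g ^^ (n mod r)) x"
proof -
  have "(g ^^ n) x = (g ^^ (n mod r + r * (n div r))) x" by simp
  then show ?thesis by (simp only: gcomp[symmetric] period_mult[OF assms])
qed

lemma funpow_cong: "x \<in> V \<Longrightarrow> m mod r = n mod r \<Longrightarrow> (g ^^ m) x = (g ^^ n) x"
  using funpow_mod[of x m] funpow_mod[of x n] by simp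

lemma fixed_dvd:
  assumes z: "z \<in> V" "z \<noteq> 0" "(g ^^ j) z = z"
  shows "r dvd j"
proof (rule ccontr)
  assume "\<not> r dvd j"
  then have "coprime j r" using r(1) by (metis coprime_commute prime_imp_coprime_nat)
  moreover have "j \<noteq> 0" using \<open>\<not> r dvd j\<close> by (metis dvd_0_right)
  ultimately obtain a b where "j * a = r * b + 1" using bezout_nat[of j r] by auto
  moreover have "(g ^^ (j * a)) z = z" using z(3) by (induction a) (auto simp: funpow_add)
  ultimately have "(g ^^ (1 + r * b)) z = z" by (simp add: add.commute)
  then have "g z = z" using period_mult[OF z(1)] by (simp add: funpow_add)
  then show False using free z by blast
qed

text \<open>On \<open>V\<close> this is \<open>g\<close> to the power \<open>m\<close> plus \<open>g\<close> to the power \<open>- m\<close>, hence self-adjoint.\<close>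

definition tr :: "nat \<Rightarrow> 'a \<Rightarrow> 'a" where
  "tr m x = (g ^^ m) x + (g ^^ ((r - 1) * m)) x"

lemma inverse_pow: "x \<in> V \<Longrightarrow> (g ^^ (m + (r - 1) * m)) x = x"
proof -
  assume "x \<in> V"
  moreover have "m + (r - 1) * m = r * m" using r_pos by (simp add: diff_mult_distrib)
  ultimately show ?thesis using period_mult by simp
qed

lemma endo_tr: "endo V (tr m)"
  unfolding tr_def by (intro endo_plus endo_funpow Eg)

lemma selfadj_tr: "selfadj (tr m)"
  unfolding selfadj_def
proof (intro conjI ballI)
  show "endo V (tr m)" by (rule endo_tr)
  fix x y assume xy: "x \<in> V" "y \<in> V"
  have "B ((g ^^ m) x) y = B x ((g ^^ ((r - 1) * m)) y)" if "x \<in> V" "y \<in> V" for x y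
    using isom_B[OF isom_funpow[OF g], of x "(g ^^ ((r - 1) * m)) y" m] that
    by (simp add: gV gcomp inverse_pow)
  from this[OF xy] this[OF xy(2,1)] show "B (tr m x) y = B x (tr m y)"
    using xy gV symm by (simp add: tr_def addl addr add.commute)
qed

text \<open>Both cross terms are \<open>x\<close> and cancel, so squaring acts on these sums as
  Frobenius does on x + 1/x.\<close>

lemma tr_tr:
  assumes "x \<in> V"
  shows "tr m (tr m x) = tr (2 * m) x"
proof -
  have "tr m (tr m x) = ((g ^^ (m + m)) x + (g ^^ (m + (r - 1) * m)) x)
      + ((g ^^ ((r - 1) * m + m)) x + (g ^^ ((r - 1) * m + (r - 1) * m)) x)"
    using assms by (simp only: tr_def gadd gV gcomp)
  also have "(g ^^ ((r - 1) * m + m)) x = x" using inverse_pow[OF assms, of m] by (simp only: add.commute)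
  also have "(g ^^ (m + (r - 1) * m)) x = x" using inverse_pow[OF assms] .
  finally have "tr m (tr m x) = (g ^^ (m + m)) x + (g ^^ ((r - 1) * m + (r - 1) * m)) x"
    by (simp only: add.assoc add_self_left)
  moreover have "2 * m = m + m" "(r - 1) * (2 * m) = (r - 1) * m + (r - 1) * m" by simp_all
  ultimately show ?thesis by (simp only: tr_def)
qed

abbreviation A where "A \<equiv> tr 1"

lemma tr_g: "x \<in> V \<Longrightarrow> g (tr m x) = tr m (g x)"
  using endo_add[OF Eg gV gV] by (simp add: tr_def funpow_swap1)

lemma A_pow2: "x \<in> V \<Longrightarrow> (A ^^ (2 ^ n)) x = tr (2 ^ n) x"
proof (induction n arbitrary: x)
  case (Suc n)
  have "(A ^^ (2 ^ Suc n)) x = (A ^^ (2 ^ n)) ((A ^^ (2 ^ n)) x)"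
    by (simp add: mult_2 funpow_add)
  then show ?case using Suc tr_tr[of x "2 ^ n"] endo_closed[OF endo_tr] by simp
qed simp

text \<open>For t in place of \<open>g\<close>, the product of t^m and t^m + t^-m + t + t^-1 factors
  as (t^(m+1) + 1)(t^(m-1) + 1). If this kills a nonzero \<open>x\<close>, one factor kills a
  nonzero vector, and \<open>fixed_dvd\<close> makes \<open>r\<close> divide its exponent.\<close>

lemma tr_eq_dvd:
  assumes x: "x \<in> V" "x \<noteq> 0" "tr m x = A x" and m: "m > 0"
  shows "r dvd m - 1 \<or> r dvd m + 1"
proof (rule disjCI)
  assume n: "\<not> r dvd m + 1"
  define y where "y = (g ^^ (m - 1)) x + x"
  have yV: "y \<in> V" using x gV by (simp add: y_def)
  have "(g ^^ (m + 1)) y + y = (g ^^ (m + 1 + (m - 1))) x + (g ^^ (m + 1)) x + ((g ^^ (m - 1)) x + x)"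
    using x by (simp only: y_def gadd gV gcomp)
  also have "m + 1 + (m - 1) = m + m" using m by simp
  also have "(g ^^ (m - 1)) x = (g ^^ (m + (r - 1))) x"
  proof (rule funpow_cong[OF x(1)])
    have "m + (r - 1) = (m - 1) + r" using m r_pos by simp
    then show "(m - 1) mod r = (m + (r - 1)) mod r" by (simp only: mod_add_self2)
  qed
  also have "(g ^^ (m + m)) x + (g ^^ (m + 1)) x + ((g ^^ (m + (r - 1))) x + x)
    = (g ^^ m) (tr m x + A x)"
  proof -
    have "(g ^^ m) (tr m x + A x) = ((g ^^ (m + m)) x + (g ^^ (m + (r - 1) * m)) x)
       + ((g ^^ (m + 1)) x + (g ^^ (m + (r - 1) * 1)) x)"
      using x(1) by (simp only: tr_def gadd gV gcomp add_mem)
    also have "(g ^^ (m + (r - 1) * m)) x = x" using inverse_pow[OF x(1)] .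
    finally show ?thesis by (simp only: ac_simps mult_1_right mult_1_left)
  qed
  also have "\<dots> = 0" using x(3) endo_0[OF endo_funpow[OF Eg]] by simp
  finally have "(g ^^ (m + 1)) y = y" by (simp only: add_eq_0_iff_eq)
  then have "y = 0" using fixed_dvd[OF yV] n by blast
  then have "(g ^^ (m - 1)) x = x" by (simp add: y_def)
  then show "r dvd m - 1" using fixed_dvd x by blast
qed

lemma tr_cong:
  assumes x: "x \<in> V" and m: "m > 0" "r dvd m - 1 \<or> r dvd m + 1"
  shows "tr m x = A x"
  using m(2)
proof
  assume "r dvd m - 1"
  then obtain c where c: "m = r * c + 1" using m(1) by (metis Suc_diff_1 Suc_eq_plus1 dvdE)
  have "(g ^^ ((r - 1) * m)) x = (g ^^ (r - 1)) x"
    using x by (intro funpow_cong) (auto simp: c add_mult_distrib2 mult.left_commute[of _ r])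
  moreover have "(g ^^ m) x = (g ^^ 1) x" using x by (intro funpow_cong) (auto simp: c)
  ultimately show ?thesis by (simp add: tr_def)
next
  assume "r dvd m + 1"
  then obtain c where c: "m + 1 = r * c" by (auto elim: dvdE)
  have "(m + 1) mod r = (r - 1 + 1) mod r" using c r_pos by simp
  then have "m mod r = (r - 1) mod r" using mod_add_right_eq
    by (metis (no_types) cong_add_rcancel_nat cong_def)
  then have 1: "(g ^^ m) x = (g ^^ (r - 1)) x" using x by (intro funpow_cong)
  have "(g ^^ m) ((g ^^ ((r - 1) * m)) x) = x" using inverse_pow[OF x] by (simp add: gcomp)
  then have "(g ^^ 1) x = (g ^^ 1) ((g ^^ m) ((g ^^ ((r - 1) * m)) x))" by simp
  also have "\<dots> = (g ^^ (r * c)) ((g ^^ ((r - 1) * m)) x)"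
  proof -
    have "1 + (m + (r - 1) * m) = r * c + (r - 1) * m" using c by simp
    then show ?thesis by (simp only: gcomp)
  qed
  also have "\<dots> = (g ^^ ((r - 1) * m)) x" using period_mult gV[OF x] by blast
  finally show ?thesis using 1 by (simp add: tr_def ac_simps)
qed

section \<open>The minimal polynomial of the sum of an isometry and its inverse\<close>

lemma fermat_poly_nonzero: "n > 0 \<Longrightarrow> [:0, 1:] ^ (2 ^ n) - [:0, 1:] \<noteq> (0 :: bit poly)"
proof
  assume "n > 0" "[:0, 1:] ^ (2 ^ n) - [:0, 1:] = (0 :: bit poly)"
  then have "degree ([:0, 1:] ^ (2 ^ n) :: bit poly) = degree ([:0, 1:] :: bit poly)" by simp
  then have "2 ^ n = (1::nat)" by (simp add: degree_power_eq)
  then show False using \<open>n > 0\<close> by simp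
qed

lemma act_fermat: "x \<in> V \<Longrightarrow> act A ([:0, 1:] ^ (2 ^ n) - [:0, 1:]) x = tr (2 ^ n) x + A x"
proof -
  assume x: "x \<in> V"
  have "act A ([:0, 1:] ^ (2 ^ n)) x = act A (([:0, 1:] ^ (2 ^ n) - [:0, 1:]) + [:0, 1:]) x" by simp
  also have "\<dots> = act A ([:0, 1:] ^ (2 ^ n) - [:0, 1:]) x + act A [:0, 1:] x"
    using x by (simp only: act_add[OF endo_tr])
  finally show ?thesis
    using add_eq_swap[of "act A ([:0, 1:] ^ (2 ^ n)) x"] x
    by (simp add: act_X_power[OF endo_tr] act_X[OF endo_tr] A_pow2)
qed

lemma ord_pos: "ord r (4::nat) > 0"
proof -
  have "coprime r (2 * 2)"
    using r(2) by (simp only: coprime_mult_right_iff coprime_right_2_iff_odd) simp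
  then have "ord r 4 \<noteq> 0" by (simp add: ord_eq_0)
  then show ?thesis by simp
qed

text \<open>By the last two clauses the space is a sum of spaces over fields of degree divisible by
  \<open>ord r 4\<close>; they are what \<open>squarefree_pcompose_root\<close> asks of its
  modulus.\<close>

definition is_min_poly :: "bit poly \<Rightarrow> bool" where
  "is_min_poly \<mu> \<longleftrightarrow> \<mu> \<noteq> 0 \<and> (\<forall>x\<in>V. act A \<mu> x = 0) \<and>
     (\<forall>p. (\<forall>x\<in>V. act A p x = 0) \<longrightarrow> \<mu> dvd p) \<and>
     (\<forall>\<phi>. irreducible \<phi> \<and> \<phi> dvd \<mu> \<longrightarrow> ord r (4::nat) dvd degree \<phi>) \<and>
     (\<forall>\<phi>. irreducible \<phi> \<longrightarrow> \<not> \<phi> * \<phi> dvd \<mu>)"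

lemma is_min_polyD:
  assumes "is_min_poly \<mu>"
  shows "\<mu> \<noteq> 0" "x \<in> V \<Longrightarrow> act A \<mu> x = 0"
    "(\<And>x. x \<in> V \<Longrightarrow> act A p x = 0) \<Longrightarrow> \<mu> dvd p"
    "irreducible \<phi> \<Longrightarrow> \<phi> dvd \<mu> \<Longrightarrow> ord r (4::nat) dvd degree \<phi>"
    "irreducible \<phi> \<Longrightarrow> \<not> \<phi> * \<phi> dvd \<mu>"
  using assms by (simp_all add: is_min_poly_def)

text \<open>As \<open>2 ^ e\<close> is 1 or -1 modulo \<open>r\<close>, \<open>A\<close> satisfies
  \<open>F\<close>, whose derivative is 1; so \<mu>, a divisor of \<open>F\<close>, is squarefree.
  By minimality an irreducible factor \<phi> of \<mu> kills some nonzero \<open>y\<close>, at which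
  \<open>A\<close> agrees with its power of exponent \<open>2 ^ degree \<phi>\<close>, and
  \<open>tr_eq_dvd\<close> gives \<open>e dvd degree \<phi>\<close>.\<close>

lemma min_poly_exists: "\<exists>\<mu>. is_min_poly \<mu>"
proof -
  define e where "e = ord r (4::nat)"
  have e: "e > 0" using ord_pos by (simp add: e_def)
  define F :: "bit poly" where "F = [:0, 1:] ^ (2 ^ e) - [:0, 1:]"
  define I where "I = {p. p \<noteq> 0 \<and> (\<forall>x\<in>V. act A p x = 0)}"
  have F: "F \<in> I"
  proof -
    have "tr (2 ^ e) x = A x" if "x \<in> V" for x
      using that ord_4_dvd_iff[OF r, of e] by (intro tr_cong) (simp_all add: e_def)
    then show ?thesis using fermat_poly_nonzero[OF e] by (simp add: I_def F_def act_fermat)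
  qed
  obtain \<mu> where \<mu>: "\<mu> \<in> I" "\<And>p. p \<in> I \<Longrightarrow> degree \<mu> \<le> degree p"
    using ex_has_least_nat[of "\<lambda>p. p \<in> I" F degree] F by blast
  have \<mu>0: "\<mu> \<noteq> 0" and \<mu>V: "\<And>x. x \<in> V \<Longrightarrow> act A \<mu> x = 0" using \<mu>(1) by (auto simp: I_def)
  have dvd: "\<mu> dvd p" if p: "\<And>x. x \<in> V \<Longrightarrow> act A p x = 0" for p
  proof (rule ccontr)
    assume "\<not> \<mu> dvd p"
    then have nz: "p mod \<mu> \<noteq> 0" by (simp add: dvd_eq_mod_eq_0)
    have "act A (p mod \<mu>) x = 0" if x: "x \<in> V" for x
    proof -
      have "act A p x = act A (p div \<mu> * \<mu> + p mod \<mu>) x" by simp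
      also have "\<dots> = act A (p div \<mu> * \<mu>) x + act A (p mod \<mu>) x" using x by (simp only: act_add[OF endo_tr])
      also have "act A (p div \<mu> * \<mu>) x = 0"
        using x by (simp add: act_mult[OF endo_tr] \<mu>V endo_0[OF endo_act[OF endo_tr]])
      finally show ?thesis using p[OF x] by simp
    qed
    then have "p mod \<mu> \<in> I" using nz by (simp add: I_def)
    then have "degree \<mu> \<le> degree (p mod \<mu>)" by (rule \<mu>(2))
    moreover have "degree (p mod \<mu>) < degree \<mu>" using degree_mod_less[OF \<mu>0, of p] nz by auto
    ultimately show False by simp
  qed
  have fac: "e dvd degree \<phi>" if \<phi>: "irreducible \<phi>" "\<phi> dvd \<mu>" for \<phi>
  proof -
    obtain \<nu> where \<nu>: "\<mu> = \<phi> * \<nu>" using \<phi>(2) by (auto simp: dvd_def)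
    have "\<nu> \<noteq> 0" using \<nu> \<mu>0 by auto
    then have "degree \<nu> < degree \<mu>" using \<nu> \<mu>0 degree_irreducible_pos[OF \<phi>(1)]
      by (subst \<nu>, subst degree_mult_eq) auto
    then have "\<nu> \<notin> I" using \<mu>(2) by fastforce
    then obtain x where x: "x \<in> V" "act A \<nu> x \<noteq> 0" using \<open>\<nu> \<noteq> 0\<close> by (auto simp: I_def)
    define y where "y = act A \<nu> x"
    have y: "y \<in> V" "y \<noteq> 0" "act A \<phi> y = 0"
      using x \<mu>V[OF x(1)] \<nu> by (simp_all add: y_def act_closed[OF endo_tr] act_mult[OF endo_tr])
    have "act A ([:0, 1:] ^ (2 ^ degree \<phi>) - [:0, 1:]) y = 0"
      using act_dvd_vector[OF endo_tr y(1,3) irreducible_dvd_fermat[OF \<phi>(1)]] .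
    then have "tr (2 ^ degree \<phi>) y = A y" using act_fermat[OF y(1)] by simp
    then show ?thesis using tr_eq_dvd[OF y(1,2)] ord_4_dvd_iff[OF r] by (simp add: e_def)
  qed
  have sqf: "\<not> \<phi> * \<phi> dvd \<mu>" if \<phi>: "irreducible \<phi>" for \<phi>
  proof
    assume "\<phi> * \<phi> dvd \<mu>"
    moreover have "\<mu> dvd F" using F by (intro dvd) (simp add: I_def)
    ultimately obtain q where q: "F = \<phi> * \<phi> * q" by (meson dvdE dvd_trans)
    have "pderiv F = \<phi> * (pderiv \<phi> * q + pderiv \<phi> * q + \<phi> * pderiv q)"
      by (simp add: q pderiv_mult algebra_simps)
    moreover have "pderiv F = 1"
      using e by (simp add: F_def pderiv_diff pderiv_power pderiv_pCons power_0_left numeral_poly)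
    ultimately have "\<phi> dvd 1" by (metis dvd_triv_left)
    then show False using \<phi> by (simp add: Factorial_Ring.irreducible_def)
  qed
  have "is_min_poly \<mu>" using \<mu>0 \<mu>V dvd fac sqf by (simp add: is_min_poly_def e_def)
  then show ?thesis ..
qed

lemma field_op_dvd_ord:
  assumes f: "irreducible f" "degree f dvd ord r (4::nat)"
  shows "field_op g f"
proof -
  obtain \<mu> where m: "is_min_poly \<mu>" using min_poly_exists ..
  note \<mu> = is_min_polyD[OF m]
  have "degree f dvd degree \<phi>" if "irreducible \<phi>" "\<phi> dvd \<mu>" for \<phi>
    using \<mu>(4)[OF that] f(2) by (rule dvd_trans[rotated])
  then obtain P where P: "\<mu> dvd pcompose f P"
    using squarefree_pcompose_root[OF \<mu>(1) f(1) _ \<mu>(5)] by blast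
  show ?thesis unfolding field_op_def
  proof (rule exI[of _ "act A P"], intro conjI ballI)
    show "selfadj (act A P)" using selfadj_tr by (rule selfadj_act)
    fix x assume x: "x \<in> V"
    show "act (act A P) f x = 0"
      using act_dvd[OF endo_tr P \<mu>(2) x] by (simp add: act_pcompose[OF endo_tr x])
    show "g (act A P x) = act A P (g x)"
    proof (rule act_commute[OF endo_tr Eg _ x])
      show "g (A y) = A (g y)" if "y \<in> V" for y using that by (rule tr_g)
    qed
  qed
qed

lemma orbit_sum_zero:
  assumes x: "x \<in> V"
  shows "(\<Sum>i<r. (g ^^ i) x) = 0"
proof -
  define N where "N = (\<Sum>i<r. (g ^^ i) x)"
  have NV: "N \<in> V" unfolding N_def
    by (rule additive_sum(2)[where f = g, OF sub]) (simp_all add: endo_0[OF Eg] endo_add[OF Eg] gV x)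
  have "g N = (\<Sum>i<r. (g ^^ Suc i) x)"
    unfolding N_def funpow.simps o_apply
    by (rule additive_sum(1)[OF sub]) (simp_all add: endo_0[OF Eg] endo_add[OF Eg] gV x)
  moreover have "(\<Sum>i<r. (g ^^ Suc i) x) + x = (\<Sum>i<Suc r. (g ^^ i) x)"
    by (subst sum.lessThan_Suc_shift) (simp add: ac_simps)
  ultimately have "g N + x = N + x" using period[OF x] by (simp add: N_def)
  then show ?thesis using free[OF NV] by (simp add: N_def)
qed

text \<open>The power of \<open>g\<close> in front clears the negative exponents of the symmetric
  sum. In the recursion \<open>A\<close> shifts the sum up to \<open>n + 1\<close> both ways; the
  overlap cancels modulo 2, and the sum up to \<open>n\<close> fills it again.\<close>

lemma act_repunit_poly:
  assumes x: "x \<in> V"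
  shows "(g ^^ n) (act A (repunit_poly n) x) = (\<Sum>i<2 * n + 1. (g ^^ i) x)"
proof (induction n rule: repunit_poly.induct)
  case 1
  show ?case by (simp add: act_one[OF endo_tr] One_nat_def)
next
  case 2
  have "act A [:1, 1:] x = x + A x"
    by (simp add: act_pCons[OF endo_tr] endo_0[OF endo_tr])
  moreover have "(g ^^ 1) (x + A x) = (g ^^ 1) x + ((g ^^ (1 + 1)) x + (g ^^ (1 + (r - 1) * 1)) x)"
    using x by (simp only: tr_def gadd gV gcomp add_mem)
  moreover have "(g ^^ (1 + (r - 1) * 1)) x = x" using inverse_pow[OF x, of 1] .
  ultimately show ?case by (simp add: numeral_3_eq_3 numeral_2_eq_2 ac_simps)
next
  case (3 n)
  define S where "S m = (\<Sum>i<m. (g ^^ i) x)" for m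
  have SV: "S m \<in> V" for m unfolding S_def
    by (rule additive_sum(2)[where f = g, OF sub]) (simp_all add: endo_0[OF Eg] endo_add[OF Eg] gV x)
  define u v where "u = act A (repunit_poly (Suc n)) x" and "v = act A (repunit_poly n) x"
  have uV: "u \<in> V" "v \<in> V" using x by (simp_all add: u_def v_def act_closed[OF endo_tr])
  have IH: "(g ^^ Suc n) u = S (2 * n + 3)" "(g ^^ n) v = S (2 * n + 1)"
    using 3 by (simp_all add: u_def v_def S_def numeral_3_eq_3)
  have "act A (repunit_poly (Suc (Suc n))) x = A u + v"
    using x by (simp add: act_add[OF endo_tr] act_mult[OF endo_tr] act_X[OF endo_tr] u_def v_def
        del: mult_pCons_left)
  then have "(g ^^ Suc (Suc n)) (act A (repunit_poly (Suc (Suc n))) x)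
      = (g ^^ (Suc (Suc n) + 1)) u + (g ^^ (Suc (Suc n) + (r - 1) * 1)) u + (g ^^ Suc (Suc n)) v"
    using uV by (simp only: tr_def gadd gV gcomp add_mem)
  also have "(g ^^ (Suc (Suc n) + 1)) u = (g ^^ 2) ((g ^^ Suc n) u)"
  proof -
    have "Suc (Suc n) + 1 = 2 + Suc n" by simp
    then show ?thesis by (simp only: gcomp)
  qed
  also have "(g ^^ (Suc (Suc n) + (r - 1) * 1)) u = (g ^^ Suc n) u"
  proof (rule funpow_cong[OF uV(1)])
    have "Suc (Suc n) + (r - 1) * 1 = Suc n + r" using r_pos by simp
    then show "(Suc (Suc n) + (r - 1) * 1) mod r = Suc n mod r" by (simp only: mod_add_self2)
  qed
  also have "(g ^^ Suc (Suc n)) v = (g ^^ 2) ((g ^^ n) v)"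
  proof -
    have "Suc (Suc n) = 2 + n" by simp
    then show ?thesis by (simp only: gcomp)
  qed
  also have "(g ^^ 2) ((g ^^ Suc n) u) + (g ^^ Suc n) u + (g ^^ 2) ((g ^^ n) v)
    = S (2 * n + 3) + (g ^^ 2) (S (2 * n + 3) + S (2 * n + 1))"
    using SV by (simp only: IH gadd) (simp only: ac_simps)
  also have "S (2 * n + 3) + S (2 * n + 1) = (g ^^ (2 * n + 1)) x + (g ^^ (2 * n + 2)) x"
  proof -
    have "S (2 * n + 3) = S (2 * n + 1) + ((g ^^ (2 * n + 1)) x + (g ^^ (2 * n + 2)) x)"
    proof -
      have "2 * n + 3 = Suc (Suc (2 * n + 1))" "2 * n + 2 = Suc (2 * n + 1)" by simp_all
      then show ?thesis unfolding S_def by (simp only: sum.lessThan_Suc add.assoc)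
    qed
    then show ?thesis by (simp add: ac_simps)
  qed
  also have "(g ^^ 2) \<dots> = (g ^^ (2 * n + 3)) x + (g ^^ (2 * n + 4)) x"
  proof -
    have "2 + (2 * n + 1) = 2 * n + 3" "2 + (2 * n + 2) = 2 * n + 4" by simp_all
    then show ?thesis using x by (simp only: gadd gV gcomp)
  qed
  also have "S (2 * n + 3) + \<dots> = S (2 * n + 5)"
  proof -
    have "2 * n + 5 = Suc (Suc (2 * n + 3))" "2 * n + 4 = Suc (2 * n + 3)" by simp_all
    then show ?thesis unfolding S_def by (simp only: sum.lessThan_Suc add.assoc)
  qed
  finally have "(g ^^ Suc (Suc n)) (act A (repunit_poly (Suc (Suc n))) x) = S (2 * n + 5)" .
  moreover have "2 * Suc (Suc n) + 1 = 2 * n + 5" by simp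
  ultimately show ?case by (simp only: S_def)
qed

text \<open>By \<open>hom\<close> the symmetric sum for \<open>e\<close> is the full orbit sum up to
  a power of \<open>g\<close>, and that is a fixed vector, so 0. Hence \<mu> has degree at most
  \<open>e\<close>, while each irreducible factor has degree at least \<open>e\<close>.\<close>

lemma irreducible_annihilator:
  assumes hom: "2 * ord r (4::nat) = r - 1" and V: "V \<noteq> {0}"
  obtains \<phi> where "irreducible \<phi>" "degree \<phi> = ord r (4::nat)" "\<And>x. x \<in> V \<Longrightarrow> act A \<phi> x = 0"
proof -
  define e where "e = ord r (4::nat)"
  obtain \<mu> where m: "is_min_poly \<mu>" using min_poly_exists ..
  note \<mu> = is_min_polyD[OF m, folded e_def]
  have "act A (repunit_poly e) x = 0" if x: "x \<in> V" for x
  proof -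
    have "2 * e + 1 = r" using hom r_pos by (simp add: e_def)
    then have "(g ^^ e) (act A (repunit_poly e) x) = 0"
      using act_repunit_poly[OF x, of e] orbit_sum_zero[OF x] by simp
    then have "(g ^^ e) (act A (repunit_poly e) x) = (g ^^ e) 0"
      using endo_0[OF endo_funpow[OF Eg]] by simp
    then show ?thesis
      using isom_inj[OF isom_funpow[OF g]] act_closed[OF endo_tr x] by (metis inj_onD zero_mem)
  qed
  then have "\<mu> dvd repunit_poly e" by (rule \<mu>(3))
  then have le: "degree \<mu> \<le> e" using degree_repunit_poly[of e] dvd_imp_degree_le by metis
  obtain v where v: "v \<in> V" "v \<noteq> 0" using V zero_mem by blast
  have "degree \<mu> > 0"
  proof (rule ccontr)
    assume "\<not> degree \<mu> > 0"
    then have "\<mu> dvd 1" using \<mu>(1) by (simp add: is_unit_iff_degree)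
    then have "act A 1 v = 0" using act_dvd[OF endo_tr _ \<mu>(2) v(1)] by blast
    then show False using v by (simp add: act_one[OF endo_tr])
  qed
  then obtain \<phi> where \<phi>: "irreducible \<phi>" "\<phi> dvd \<mu>" using irreducible_dvd_exists by blast
  have "e \<le> degree \<phi>" using \<mu>(4)[OF \<phi>] degree_irreducible_pos[OF \<phi>(1)] by (rule dvd_imp_le)
  moreover have "degree \<phi> \<le> degree \<mu>" using \<phi>(2) \<mu>(1) by (rule dvd_imp_degree_le)
  ultimately have deg: "degree \<phi> = e" "degree \<mu> = degree \<phi>" using le by auto
  obtain \<nu> where \<nu>: "\<mu> = \<phi> * \<nu>" using \<phi>(2) by (auto simp: dvd_def)
  then have "degree \<nu> = 0" "\<nu> \<noteq> 0" using deg \<mu>(1) by (auto simp: degree_mult_eq)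
  then have "\<nu> dvd 1" by (simp add: is_unit_iff_degree)
  then have "\<mu> dvd \<phi>" using \<nu> by (metis dvd_mult_unit_iff dvd_refl)
  then have "act A \<phi> x = 0" if "x \<in> V" for x using act_dvd[OF endo_tr _ \<mu>(2) that] by blast
  then show ?thesis using that \<phi>(1) deg(1) unfolding e_def by blast
qed

lemma g_quadratic:
  assumes x: "x \<in> V"
  shows "g (g x) = A (g x) + x"
proof -
  have "(g ^^ (r - 1)) (g x) = (g ^^ Suc (r - 1)) x" by (simp only: funpow_Suc_right o_apply)
  also have "Suc (r - 1) = r" using r_pos by simp
  finally have "(g ^^ (r - 1)) (g x) = x" using period[OF x] by simp
  then show ?thesis by (simp add: tr_def add.assoc)
qed

lemma g_square_free:
  assumes x: "x \<in> V" "g (g x) = x"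
  shows "x = 0"
proof (rule ccontr)
  assume "x \<noteq> 0"
  moreover have "(g ^^ 2) x = x" using x(2) by (simp add: numeral_2_eq_2)
  ultimately have "r dvd 2" using fixed_dvd x(1) by blast
  then show False using r_pos by (auto dest: dvd_imp_le)
qed

end

subsection \<open>Tensor products with a space of bit vectors\<close>

text \<open>The tensor product of \<open>W\<close> with the bit vectors of length \<open>b\<close>,
  as tuples. Entries from \<open>b\<close> on are 0 so that equal tuples are equal
  functions.\<close>

definition pw :: "nat \<Rightarrow> 'v::boolean_group set \<Rightarrow> (nat \<Rightarrow> 'v) set" where
  "pw b W = {\<phi>. (\<forall>i<b. \<phi> i \<in> W) \<and> (\<forall>i\<ge>b. \<phi> i = 0)}"

text \<open>The tensor product of \<open>B\<close> with the bilinear form on bit vectors that has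
  Gram matrix \<open>M\<close>.\<close>

definition gram_form ::
    "nat \<Rightarrow> (nat \<Rightarrow> nat \<Rightarrow> bit) \<Rightarrow> ('v \<Rightarrow> 'v \<Rightarrow> bit) \<Rightarrow> (nat \<Rightarrow> 'v) \<Rightarrow> (nat \<Rightarrow> 'v) \<Rightarrow> bit" where
  "gram_form b M B \<phi> \<psi> = (\<Sum>i<b. \<Sum>j<b. M i j * B (\<phi> i) (\<psi> j))"

definition ptw :: "('v \<Rightarrow> 'v) \<Rightarrow> (nat \<Rightarrow> 'v) \<Rightarrow> nat \<Rightarrow> 'v" where
  "ptw g \<phi> = (\<lambda>i. g (\<phi> i))"

definition single :: "nat \<Rightarrow> 'v::zero \<Rightarrow> nat \<Rightarrow> 'v" where
  "single i c = (\<lambda>j. if j = i then c else 0)"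

lemma ptw_apply: "ptw g \<phi> i = g (\<phi> i)"
  by (simp add: ptw_def)

lemma sum_fun_apply: "(\<Sum>i\<in>I. f i) j = (\<Sum>i\<in>I. f i j :: 'v::boolean_group)"
  by (induction I rule: infinite_finite_induct) simp_all

lemma single_pw: "subgp W \<Longrightarrow> i < b \<Longrightarrow> c \<in> W \<Longrightarrow> single i c \<in> pw b W"
  by (auto simp: single_def pw_def subgp_0)

lemma card_pw:
  assumes "finite W"
  shows "finite (pw b W) \<and> card (pw b W) = card W ^ b"
proof (induction b)
  case 0
  have "pw 0 W = {\<lambda>_. 0}" by (auto simp: pw_def)
  then show ?case by simp
next
  case (Suc b)
  define F where "F = (\<lambda>(\<phi>, x :: 'a). \<phi>(b := x) :: nat \<Rightarrow> 'a)"
  have inj: "inj_on F (pw b W \<times> W)"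
  proof (rule inj_onI, clarsimp simp: F_def)
    fix \<phi> x \<psi> y assume *: "\<phi> \<in> pw b W" "\<psi> \<in> pw b W" "\<phi>(b := x) = \<psi>(b := y)"
    have "\<phi> i = \<psi> i" for i
      using fun_cong[OF *(3), of i] *(1,2) by (cases "i = b") (auto simp: pw_def)
    then show "\<phi> = \<psi> \<and> x = y" using fun_cong[OF *(3), of b] by auto
  qed
  have "pw (Suc b) W \<subseteq> F ` (pw b W \<times> W)"
  proof
    fix \<phi> assume \<phi>: "\<phi> \<in> pw (Suc b) W"
    have "\<phi> = F (\<phi>(b := 0), \<phi> b)" by (auto simp: F_def)
    moreover have "(\<phi>(b := 0), \<phi> b) \<in> pw b W \<times> W" using \<phi> by (auto simp: pw_def le_Suc_eq)
    ultimately show "\<phi> \<in> F ` (pw b W \<times> W)" by (rule image_eqI)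
  qed
  moreover have "F ` (pw b W \<times> W) \<subseteq> pw (Suc b) W" by (auto simp: F_def pw_def less_Suc_eq)
  ultimately have eq: "pw (Suc b) W = F ` (pw b W \<times> W)" by blast
  show ?case unfolding eq using Suc assms card_image[OF inj] by (simp add: card_cartesian_product)
qed

lemma sum_symmetric_zero:
  fixes s :: "nat \<Rightarrow> nat \<Rightarrow> bit"
  assumes "\<And>i j. i < n \<Longrightarrow> j < n \<Longrightarrow> s i j = s j i" "\<And>i. i < n \<Longrightarrow> s i i = 0"
  shows "(\<Sum>i<n. \<Sum>j<n. s i j) = 0"
  using assms
proof (induction n)
  case (Suc n)
  have "(\<Sum>i<Suc n. \<Sum>j<Suc n. s i j)
      = (\<Sum>i<n. \<Sum>j<n. s i j) + (\<Sum>i<n. s i n) + ((\<Sum>j<n. s n j) + s n n)"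
    by (simp add: sum.distrib)
  also have "(\<Sum>j<n. s n j) = (\<Sum>i<n. s i n)" using Suc.prems by (intro sum.cong) auto
  finally show ?case using Suc by simp
qed simp

lemma subgp_pw: "subgp W \<Longrightarrow> subgp (pw b W)"
  by (auto simp: subgp_def pw_def)

context sympl
begin

lemma gram_form_additive:
  assumes "\<phi> \<in> pw b V" "\<psi> \<in> pw b V" "\<chi> \<in> pw b V"
  shows "gram_form b M B (\<phi> + \<psi>) \<chi> = gram_form b M B \<phi> \<chi> + gram_form b M B \<psi> \<chi>"
    and "gram_form b M B \<chi> (\<phi> + \<psi>) = gram_form b M B \<chi> \<phi> + gram_form b M B \<chi> \<psi>"
  unfolding gram_form_def sum.distrib[symmetric]
  by (intro sum.cong refl; use assms in \<open>simp add: pw_def addl addr distrib_left\<close>)+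

lemma gram_form_single:
  assumes "\<phi> \<in> pw b V" "j < b" "c \<in> V"
  shows "gram_form b M B \<phi> (single j c) = (\<Sum>i<b. M i j * B (\<phi> i) c)"
  unfolding gram_form_def
proof (intro sum.cong refl)
  fix i assume "i \<in> {..<b}"
  then have "\<phi> i \<in> V" using assms(1) by (simp add: pw_def)
  then have "(\<Sum>j'<b. M i j' * B (\<phi> i) (single j c j')) = (\<Sum>j'<b. if j' = j then M i j * B (\<phi> i) c else 0)"
    by (intro sum.cong) (auto simp: single_def)
  then show "(\<Sum>j'<b. M i j' * B (\<phi> i) (single j c j')) = M i j * B (\<phi> i) c"
    using assms(2) by simp
qed

text \<open>The hypothesis \<open>nd\<close> is a triangularity condition: testing \<phi> against
  tuples supported at the single place \<open>j\<close> isolates its coordinate \<open>i0\<close>.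
  The identity matrix and the anti-triangular Hankel matrix both satisfy it.\<close>

lemma sympl_gram:
  assumes M: "\<And>i j. M i j = M j i"
    and nd: "\<And>\<phi>. \<phi> \<in> pw b V \<Longrightarrow> \<phi> \<noteq> (\<lambda>_. 0) \<Longrightarrow>
      \<exists>i0<b. \<exists>j<b. \<phi> i0 \<noteq> 0 \<and> M i0 j = 1 \<and> (\<forall>i<b. i \<noteq> i0 \<longrightarrow> M i j = 0 \<or> \<phi> i = 0)"
  shows "sympl (pw b V) (gram_form b M B)"
proof
  show "finite (pw b V)" using card_pw[OF fin] by blast
  show "subgp (pw b V)" using sub by (rule subgp_pw)
  show "gram_form b M B \<phi> \<phi> = 0" if "\<phi> \<in> pw b V" for \<phi>
    unfolding gram_form_def
  proof (rule sum_symmetric_zero)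
    show "M i j * B (\<phi> i) (\<phi> j) = M j i * B (\<phi> j) (\<phi> i)" if "i < b" "j < b" for i j
      using that \<open>\<phi> \<in> pw b V\<close> M[of i j] symm[of "\<phi> i" "\<phi> j"] by (simp add: pw_def)
    show "M i i * B (\<phi> i) (\<phi> i) = 0" if "i < b" for i
      using that \<open>\<phi> \<in> pw b V\<close> by (simp add: pw_def alt)
  qed
  show "\<phi> = 0" if \<phi>: "\<phi> \<in> pw b V" and z: "\<And>\<psi>. \<psi> \<in> pw b V \<Longrightarrow> gram_form b M B \<phi> \<psi> = 0" for \<phi>
  proof (rule ccontr)
    assume "\<phi> \<noteq> 0"
    then have "\<phi> \<noteq> (\<lambda>_. 0)" by (simp add: zero_fun_def)
    then have "\<exists>i0<b. \<exists>j<b. \<phi> i0 \<noteq> 0 \<and> M i0 j = 1 \<and> (\<forall>i<b. i \<noteq> i0 \<longrightarrow> M i j = 0 \<or> \<phi> i = 0)"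
      by (rule nd[OF \<phi>])
    then obtain i0 j where ij: "i0 < b" "j < b" "\<phi> i0 \<noteq> 0" "M i0 j = 1"
      and *: "\<forall>i<b. i \<noteq> i0 \<longrightarrow> M i j = 0 \<or> \<phi> i = 0"
      by (elim exE conjE)
    have ij5: "M i j = 0 \<or> \<phi> i = 0" if "i < b" "i \<noteq> i0" for i using * that by simp
    have "\<phi> i0 = 0"
    proof (rule nondeg)
      show "\<phi> i0 \<in> V" using \<phi> ij by (simp add: pw_def)
      fix c assume c: "c \<in> V"
      have "(\<Sum>i<b. M i j * B (\<phi> i) c) = (\<Sum>i<b. if i = i0 then B (\<phi> i0) c else 0)"
      proof (intro sum.cong refl)
        fix i assume "i \<in> {..<b}"
        then show "M i j * B (\<phi> i) c = (if i = i0 then B (\<phi> i0) c else 0)"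
          using ij(4) ij5[of i] c by (cases "i = i0") auto
      qed
      then have "gram_form b M B \<phi> (single j c) = B (\<phi> i0) c"
        using gram_form_single[OF \<phi> ij(2) c, of M] ij(1) by simp
      then show "B (\<phi> i0) c = 0"
        using z[OF single_pw[OF sub ij(2) c]] by (simp only:)
    qed
    then show False using ij(3) by simp
  qed
qed (simp_all add: gram_form_additive)

lemma endo_ptw:
  assumes T: "endo V T"
  shows "endo (pw b V) (ptw T)"
  unfolding endo_def
proof (intro conjI ballI)
  show "subgp (pw b V)" using sub by (rule subgp_pw)
  fix \<phi> assume \<phi>: "\<phi> \<in> pw b V"
  then show "ptw T \<phi> \<in> pw b V" by (simp add: pw_def ptw_def endo_closed[OF T] endo_0[OF T])
  fix \<psi> assume \<psi>: "\<psi> \<in> pw b V"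
  have mem: "\<phi> i \<in> V" "\<psi> i \<in> V" for i
    using \<phi> \<psi> by (cases "i < b"; simp add: pw_def)+
  show "ptw T (\<phi> + \<psi>) = ptw T \<phi> + ptw T \<psi>"
    by (rule ext) (simp add: ptw_def endo_add[OF T] mem)
qed

lemma isom_ptw:
  assumes "sympl (pw b V) (gram_form b M B)" "isom g"
  shows "sympl.isom (pw b V) (gram_form b M B) (ptw g)"
  unfolding sympl.isom_def[OF assms(1)]
proof (intro conjI ballI)
  show "endo (pw b V) (ptw g)" using isom_endo[OF assms(2)] by (rule endo_ptw)
  fix \<phi> \<psi> assume "\<phi> \<in> pw b V" "\<psi> \<in> pw b V"
  then show "gram_form b M B (ptw g \<phi>) (ptw g \<psi>) = gram_form b M B \<phi> \<psi>"
    unfolding gram_form_def by (intro sum.cong refl) (simp add: ptw_def pw_def isom_B[OF assms(2)])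
qed

lemma selfadj_ptw:
  assumes "sympl (pw b V) (gram_form b M B)" "selfadj T"
  shows "sympl.selfadj (pw b V) (gram_form b M B) (ptw T)"
  unfolding sympl.selfadj_def[OF assms(1)]
proof (intro conjI ballI)
  show "endo (pw b V) (ptw T)" using selfadj_endo[OF assms(2)] by (rule endo_ptw)
  fix \<phi> \<psi> assume "\<phi> \<in> pw b V" "\<psi> \<in> pw b V"
  then show "gram_form b M B (ptw T \<phi>) \<psi> = gram_form b M B \<phi> (ptw T \<psi>)"
    unfolding gram_form_def by (intro sum.cong refl) (simp add: ptw_def pw_def selfadjD[OF assms(2)])
qed

lemma act_ptw:
  assumes T: "endo V T"
  shows "act (ptw T) p \<phi> = ptw (act T p) \<phi>"
proof (induction p)
  case (pCons a p)
  have "bsc a \<phi> i = bsc a (\<phi> i)" for i by (cases a) simp_all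
  then have "bsc a \<phi> + ptw T (ptw (act T p) \<phi>) = ptw (act T (pCons a p)) \<phi>"
    by (intro ext) (simp add: ptw_apply act_pCons[OF T])
  moreover have "act (ptw T) (pCons a p) \<phi> = bsc a \<phi> + ptw T (ptw (act T p) \<phi>)"
    by (simp only: act_pCons[OF endo_ptw[OF T]] pCons.IH)
  ultimately show ?case by (simp only:)
qed (simp add: ptw_def zero_fun_def)

lemma sympl_power: "sympl (pw c V) (gram_form c (\<lambda>i j. if i = j then 1 else 0) B)"
proof (rule sympl_gram)
  fix \<phi> assume \<phi>: "\<phi> \<in> pw c V" "\<phi> \<noteq> (\<lambda>_. 0)"
  then obtain i where i: "\<phi> i \<noteq> 0" by auto
  then have "i < c" using \<phi>(1) by (metis (mono_tags, lifting) linorder_not_less mem_Collect_eq pw_def)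
  then show "\<exists>i0<c. \<exists>j<c. \<phi> i0 \<noteq> 0 \<and> (if i0 = j then 1 else 0) = (1::bit) \<and>
      (\<forall>i<c. i \<noteq> i0 \<longrightarrow> (if i = j then 1 else 0) = (0::bit) \<or> \<phi> i = 0)"
    using i by (intro exI[of _ i] conjI) auto
qed auto

end

text \<open>
  The matrix with entries \<open>hankel f (i + j)\<close> is the Gram matrix of the form sending two residues
  modulo \<open>f\<close> to the top coefficient of their product; multiplication by the indeterminate,
  whose matrix is \<open>companion f\<close>, is self-adjoint for it.
\<close>

definition hankel :: "bit poly \<Rightarrow> nat \<Rightarrow> bit" where
  "hankel f n = coeff ([:0, 1:] ^ n mod f) (degree f - 1)"

definition companion :: "bit poly \<Rightarrow> (nat \<Rightarrow> 'v::boolean_group) \<Rightarrow> nat \<Rightarrow> 'v" where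
  "companion f \<phi> i = (if i < degree f
     then (if i = 0 then 0 else \<phi> (i - 1)) + bsc (coeff f i) (\<phi> (degree f - 1)) else 0)"

lemma hankel_small: "degree f > 0 \<Longrightarrow> n < degree f \<Longrightarrow> hankel f n = (if n = degree f - 1 then 1 else 0)"
  by (simp add: hankel_def mod_poly_less degree_monom_eq flip: monom_altdef[of 1, simplified])

text \<open>A multiple of \<open>f\<close> by a power of the indeterminate is 0 modulo
  \<open>f\<close>; this is its top coefficient, \<open>f\<close> being monic.\<close>

lemma hankel_recurrence:
  assumes "degree f > 0"
  shows "hankel f (n + degree f) = (\<Sum>i<degree f. coeff f i * hankel f (n + i))"
proof -
  define h where "h p = coeff (p mod f) (degree f - 1)" for p
  have h_add: "h (p + q) = h p + h q" for p q by (simp add: h_def poly_mod_add_left)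
  have h_smult: "h (smult c p) = c * h p" for c p by (simp add: h_def mod_smult_left)
  have h_sum: "h (\<Sum>i\<in>I. g i) = (\<Sum>i\<in>I. h (g i))" for I :: "nat set" and g
    by (induction I rule: infinite_finite_induct) (simp_all add: h_add, simp_all add: h_def)
  have f: "f = (\<Sum>i\<le>degree f. smult (coeff f i) ([:0, 1:] ^ i))"
    by (subst (1) poly_as_sum_of_monoms[of f, symmetric]) (simp add: monom_altdef)
  have "[:0, 1:] ^ n * f = [:0, 1:] ^ n * (\<Sum>i\<le>degree f. smult (coeff f i) ([:0, 1:] ^ i))"
    using f by (rule arg_cong)
  then have "h ([:0, 1:] ^ n * f) = h (\<Sum>i\<le>degree f. smult (coeff f i) ([:0, 1:] ^ (n + i)))"
    by (simp add: sum_distrib_left power_add del: mult_pCons_left)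
  also have "\<dots> = (\<Sum>i\<le>degree f. coeff f i * hankel f (n + i))"
    by (simp add: h_sum h_smult) (simp add: h_def hankel_def)
  also have "\<dots> = (\<Sum>i<degree f. coeff f i * hankel f (n + i)) + coeff f (degree f) * hankel f (n + degree f)"
    by (simp flip: lessThan_Suc_atMost)
  also have "coeff f (degree f) = 1"
    using assms by (metis bit_not_zero_iff degree_0 leading_coeff_0_iff less_numeral_extra(3))
  finally have "0 = (\<Sum>i<degree f. coeff f i * hankel f (n + i)) + hankel f (n + degree f)"
    by (simp add: h_def)
  then show ?thesis by (metis add_eq_0_iff_eq)
qed

locale sympl_tensor = sympl +
  fixes f :: "bit poly"
  assumes deg: "degree f > 0"
begin

abbreviation n where "n \<equiv> degree f"
abbreviation TV where "TV \<equiv> pw n V"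
abbreviation TB where "TB \<equiv> gram_form n (\<lambda>i j. hankel f (i + j)) B"

lemma sympl_TB: "sympl TV TB"
proof (rule sympl_gram)
  show "hankel f (i + j) = hankel f (j + i)" for i j by (simp add: add.commute)
  fix \<phi> assume \<phi>: "\<phi> \<in> TV" "\<phi> \<noteq> (\<lambda>_. 0)"
  define I where "I = {i. i < n \<and> \<phi> i \<noteq> 0}"
  have fin: "finite I" by (simp add: I_def)
  have "I \<noteq> {}" using \<phi> by (auto simp: I_def pw_def fun_eq_iff) (metis linorder_not_less)
  \<comment> \<open>The sequence \<open>hankel f\<close> is 0 below index \<open>n - 1\<close> and 1
    at \<open>n - 1\<close>. So in column \<open>n - 1 - i0\<close> the entries before row
    \<open>i0\<close> vanish, and after row \<open>i0\<close> the tuple \<phi> does,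
    \<open>i0\<close> being the last index of its support.\<close>
  define i0 where "i0 = Max I"
  have "i0 \<in> I" using Max_in[OF fin \<open>I \<noteq> {}\<close>] by (simp add: i0_def)
  then have i0: "i0 < n" "\<phi> i0 \<noteq> 0" by (auto simp: I_def)
  have le: "i \<le> i0" if "i < n" "\<phi> i \<noteq> 0" for i
    using Max_ge[OF fin, of i] that by (simp add: i0_def I_def)
  have 1: "hankel f (i0 + (n - 1 - i0)) = 1" using i0 hankel_small[OF deg, of "n - 1"] by simp
  have 2: "hankel f (i + (n - 1 - i0)) = 0 \<or> \<phi> i = 0" if "i < n" "i \<noteq> i0" for i
  proof (cases "\<phi> i = 0")
    case False
    then have "i < i0" using le[OF that(1)] that(2) by simp
    then have "i + (n - 1 - i0) < n - 1" using i0 by simp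
    then show ?thesis using hankel_small[OF deg, of "i + (n - 1 - i0)"] by simp
  qed simp
  show "\<exists>i0<n. \<exists>j<n. \<phi> i0 \<noteq> 0 \<and> hankel f (i0 + j) = 1 \<and>
      (\<forall>i<n. i \<noteq> i0 \<longrightarrow> hankel f (i + j) = 0 \<or> \<phi> i = 0)"
    by (rule exI[of _ i0], intro conjI i0, rule exI[of _ "n - 1 - i0"]) (use i0 1 2 deg in auto)
qed

sublocale TS: sympl TV TB by (rule sympl_TB)

lemma companion_closed: "\<phi> \<in> TV \<Longrightarrow> companion f \<phi> \<in> TV"
  using sub deg by (auto simp: pw_def companion_def intro!: bsc_closed add_mem)

lemma endo_companion: "endo TV (companion f)"
  unfolding endo_def
proof (intro conjI ballI)
  show "subgp TV" by (rule TS.sub)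
  fix \<phi> \<psi> :: "nat \<Rightarrow> 'a"
  show "companion f (\<phi> + \<psi>) = companion f \<phi> + companion f \<psi>"
    by (rule ext) (simp add: companion_def bsc_add_right ac_simps)
qed (rule companion_closed)

text \<open>The companion matrix shifts the Hankel index by one, the last coordinate being taken
  care of by \<open>hankel_recurrence\<close>. The result is symmetric in the two tuples, and this
  gives self-adjointness.\<close>

lemma TB_companion:
  assumes \<phi>: "\<phi> \<in> TV" and \<psi>: "\<psi> \<in> TV"
  shows "TB (companion f \<phi>) \<psi> = (\<Sum>i<n. \<Sum>j<n. hankel f (Suc (i + j)) * B (\<phi> i) (\<psi> j))"
proof -
  have in1: "\<phi> i \<in> V" "\<psi> i \<in> V" if "i < n" for i using \<phi> \<psi> that by (simp_all add: pw_def)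
  obtain m where m: "n = Suc m" using deg gr0_implies_Suc by blast
  have inner: "(\<Sum>i<n. hankel f (i + j) * B (companion f \<phi> i) (\<psi> j))
      = (\<Sum>i<n. hankel f (Suc (i + j)) * B (\<phi> i) (\<psi> j))" if j: "j < n" for j
  proof -
    have "(\<Sum>i<n. hankel f (i + j) * B (companion f \<phi> i) (\<psi> j))
      = (\<Sum>i<n. hankel f (i + j) * B (if i = 0 then 0 else \<phi> (i - 1)) (\<psi> j)
          + coeff f i * hankel f (j + i) * B (\<phi> m) (\<psi> j))"
    proof (intro sum.cong refl)
      fix i assume "i \<in> {..<n}"
      then have "(if i = 0 then 0 else \<phi> (i - 1)) \<in> V" "\<phi> m \<in> V" using in1 m by auto
      then show "hankel f (i + j) * B (companion f \<phi> i) (\<psi> j)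
        = hankel f (i + j) * B (if i = 0 then 0 else \<phi> (i - 1)) (\<psi> j)
          + coeff f i * hankel f (j + i) * B (\<phi> m) (\<psi> j)"
        using \<open>i \<in> {..<n}\<close> in1[OF j] sub m
        by (simp add: companion_def addl bsc_closed B_bsc distrib_left ac_simps)
    qed
    also have "\<dots> = (\<Sum>i<n. hankel f (i + j) * B (if i = 0 then 0 else \<phi> (i - 1)) (\<psi> j))
          + hankel f (j + n) * B (\<phi> m) (\<psi> j)"
      by (simp add: sum.distrib hankel_recurrence[OF deg, of j] sum_distrib_right)
    also have "(\<Sum>i<n. hankel f (i + j) * B (if i = 0 then 0 else \<phi> (i - 1)) (\<psi> j))
        = (\<Sum>i<m. hankel f (Suc (i + j)) * B (\<phi> i) (\<psi> j))"
      unfolding m sum.lessThan_Suc_shift using in1[OF j] by simp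
    finally show ?thesis unfolding m by (simp add: ac_simps)
  qed
  have "(\<Sum>j<n. \<Sum>i<n. hankel f (i + j) * B (companion f \<phi> i) (\<psi> j))
      = (\<Sum>j<n. \<Sum>i<n. hankel f (Suc (i + j)) * B (\<phi> i) (\<psi> j))"
    by (rule sum.cong[OF refl]) (rule inner, simp)
  then show ?thesis unfolding gram_form_def
    by (subst sum.swap, subst (2) sum.swap)
qed

lemma selfadj_companion: "TS.selfadj (companion f)"
  unfolding TS.selfadj_def
proof (intro conjI ballI)
  show "endo TV (companion f)" by (rule endo_companion)
  fix \<phi> \<psi> assume *: "\<phi> \<in> TV" "\<psi> \<in> TV"
  have "TB \<phi> (companion f \<psi>) = TB (companion f \<psi>) \<phi>"
    using * companion_closed by (intro TS.symm)
  also have "\<dots> = (\<Sum>i<n. \<Sum>j<n. hankel f (Suc (i + j)) * B (\<psi> i) (\<phi> j))"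
    using * by (simp add: TB_companion)
  also have "\<dots> = (\<Sum>j<n. \<Sum>i<n. hankel f (Suc (i + j)) * B (\<psi> i) (\<phi> j))" by (rule sum.swap)
  also have "\<dots> = (\<Sum>i<n. \<Sum>j<n. hankel f (Suc (i + j)) * B (\<phi> i) (\<psi> j))"
    using * symm by (intro sum.cong refl) (simp add: pw_def add.commute)
  finally show "TB (companion f \<phi>) \<psi> = TB \<phi> (companion f \<psi>)" using * by (simp add: TB_companion)
qed

lemma companion_single:
  "i < n - 1 \<Longrightarrow> companion f (single i c) = single (Suc i) c"
  by (rule ext) (auto simp: companion_def single_def)

lemma companion_funpow_single: "i < n \<Longrightarrow> (companion f ^^ i) (single 0 c) = single i c"
  by (induction i) (simp_all add: companion_single)

lemma act_sum:
  assumes T: "endo W T" and x: "x \<in> W"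
  shows "act T p x = (\<Sum>i\<le>degree p. bsc (coeff p i) ((T ^^ i) x))"
proof -
  have S: "act T (\<Sum>i\<in>I. q i) x = (\<Sum>i\<in>I. act T (q i) x)" for I :: "nat set" and q
    by (induction I rule: infinite_finite_induct) (simp_all add: act_add[OF T x])
  have "act T p x = act T (\<Sum>i\<le>degree p. smult (coeff p i) ([:0, 1:] ^ i)) x"
    by (subst (1) poly_as_sum_of_monoms[of p, symmetric]) (simp add: monom_altdef)
  then show ?thesis by (simp add: S act_smult[OF T] act_X_power[OF T x])
qed

text \<open>Powers of the companion matrix below \<open>n\<close> move a tuple supported at 0 along
  the places, and the \<open>n\<close>-th power spreads it with the coefficients of
  \<open>f\<close>, so \<open>f\<close> kills it. Every tuple is a sum of images of such tuples
  under powers of the companion matrix.\<close>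

lemma act_companion:
  assumes \<phi>: "\<phi> \<in> TV"
  shows "act (companion f) f \<phi> = 0"
proof -
  obtain m where m: "n = Suc m" using deg gr0_implies_Suc by blast
  have lc: "coeff f n = 1"
    using deg by (metis bit_not_zero_iff degree_0 leading_coeff_0_iff less_numeral_extra(3))
  have s0: "act (companion f) f (single 0 c) = 0" if c: "c \<in> V" for c
  proof -
    have "act (companion f) f (single 0 c) = (\<Sum>i\<le>n. bsc (coeff f i) ((companion f ^^ i) (single 0 c)))"
      by (rule act_sum[OF endo_companion]) (rule single_pw[OF sub deg c])
    also have "\<dots> = (\<Sum>i<n. bsc (coeff f i) ((companion f ^^ i) (single 0 c)))
        + bsc (coeff f n) ((companion f ^^ n) (single 0 c))"
      by (simp flip: lessThan_Suc_atMost)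
    also have "(\<Sum>i<n. bsc (coeff f i) ((companion f ^^ i) (single 0 c)))
        = (\<Sum>i<n. bsc (coeff f i) (single i c))"
      by (intro sum.cong refl) (simp add: companion_funpow_single)
    also have "bsc (coeff f n) ((companion f ^^ n) (single 0 c)) = companion f (single m c)"
      using companion_funpow_single[of m c] by (simp add: m lc[unfolded m])
    also have "(\<Sum>i<n. bsc (coeff f i) (single i c)) = companion f (single m c)"
    proof
      fix j
      have "(\<Sum>i<n. bsc (coeff f i) (single i c)) j = (\<Sum>i<n. if i = j then bsc (coeff f j) c else 0)"
        unfolding sum_fun_apply
      proof (intro sum.cong refl)
        fix i show "bsc (coeff f i) (single i c) j = (if i = j then bsc (coeff f j) c else 0)"
          by (cases "coeff f i") (auto simp: single_def)
      qed
      also have "\<dots> = companion f (single m c) j"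
        using m by (auto simp: companion_def single_def)
      finally show "(\<Sum>i<n. bsc (coeff f i) (single i c)) j = companion f (single m c) j" .
    qed
    finally show ?thesis by (simp add: zero_fun_def)
  qed
  have sV: "single i (\<phi> i) \<in> TV" "\<phi> i \<in> V" if "i < n" for i
    using single_pw[OF sub that] \<phi> that by (simp_all add: pw_def)
  have \<phi>_eq: "\<phi> = (\<Sum>i<n. single i (\<phi> i))"
  proof
    fix j
    have "(\<Sum>i<n. single i (\<phi> i)) j = (\<Sum>i<n. if i = j then \<phi> j else 0)"
      unfolding sum_fun_apply by (intro sum.cong) (auto simp: single_def)
    then show "\<phi> j = (\<Sum>i<n. single i (\<phi> i)) j" using \<phi> by (auto simp: pw_def)
  qed
  have "act (companion f) f (\<Sum>i<n. single i (\<phi> i)) = (\<Sum>i<n. act (companion f) f (single i (\<phi> i)))"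
  proof (rule additive_sum(1)[OF TS.sub])
    show "act (companion f) f 0 = (0 :: nat \<Rightarrow> 'a)" by (rule endo_0[OF endo_act[OF endo_companion]])
    show "act (companion f) f (x + y) = act (companion f) f x + act (companion f) f y"
      if "x \<in> TV" "y \<in> TV" for x y using that by (rule act_add_right[OF endo_companion])
  qed (use sV in auto)
  also have "\<dots> = 0"
  proof (intro sum.neutral ballI)
    fix i assume i: "i \<in> {..<n}"
    have p: "endo TV (companion f ^^ i)" using endo_companion by (rule endo_funpow)
    have "act (companion f) f (single i (\<phi> i)) = act (companion f) f ((companion f ^^ i) (single 0 (\<phi> i)))"
      using i by (simp add: companion_funpow_single)
    also have "\<dots> = (companion f ^^ i) (act (companion f) f (single 0 (\<phi> i)))"
      using act_commute[OF endo_companion p, of "single 0 (\<phi> i)" f] single_pw[OF sub deg] sV i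
      by (simp add: funpow_swap1)
    also have "\<dots> = 0" using s0 sV i endo_0[OF p] by simp
    finally show "act (companion f) f (single i (\<phi> i)) = 0" .
  qed
  finally show ?thesis using \<phi>_eq by simp
qed

lemma companion_ptw:
  assumes g: "endo V g" and \<phi>: "\<phi> \<in> TV"
  shows "ptw g (companion f \<phi>) = companion f (ptw g \<phi>)"
proof
  fix i
  have "\<phi> (i - 1) \<in> V" "\<phi> (n - 1) \<in> V" if "i < n" using \<phi> that by (auto simp: pw_def)
  then show "ptw g (companion f \<phi>) i = companion f (ptw g \<phi>) i"
    using endo_add[OF g, of "\<phi> (i - 1)" "bsc (coeff f i) (\<phi> (n - 1))"] bsc_closed[OF sub]
    by (auto simp: ptw_def companion_def endo_bsc[OF g] endo_0[OF g])
qed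

end

section \<open>Homogeneous modules: one block, and tensor products of its powers with a
  field\<close>

context free_isom
begin

text \<open>The block is generated over the field of \<phi> by a vector \<open>x\<close> with
  \<open>B x (g x) = 1\<close> and by \<open>g x\<close>; \<open>g_quadratic\<close> makes it stable
  under \<open>g\<close>. Such an \<open>x\<close> comes from \<open>block_generator_exists\<close>
  applied to the zero subspace, whose complement is \<open>V\<close>.\<close>

lemma homogeneous_block_exists:
  assumes \<phi>: "irreducible \<phi>" "\<And>x. x \<in> V \<Longrightarrow> act A \<phi> x = 0" and V: "V \<noteq> {0}"
  shows "\<exists>P. sympl P B \<and> P \<subseteq> V \<and> (\<forall>x\<in>P. g x \<in> P \<and> A x \<in> P) \<and> card P = 2 ^ (2 * degree \<phi>)"
proof -
  define e where "e = degree \<phi>"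
  have e: "e > 0" using degree_irreducible_pos[OF \<phi>(1)] by (simp add: e_def)
  note E = endo_tr[of 1]
  have p0: "perp {0} = V" by (auto simp: perp_def)
  have "stable_nondeg A g {0}"
    using endo_0[OF E] endo_0[OF Eg] by (auto simp: stable_nondeg_def subgp_def p0)
  then obtain x where x: "x \<in> perp {0}" "B x (g x) = 1"
    using block_generator_exists[OF _ V[symmetric] selfadj_tr g tr_g g_quadratic g_square_free] by blast
  define y where "y = g x"
  have xy: "x \<in> V" "y \<in> V" "B x y = 1" using x p0 isom_closed[OF g] by (auto simp: y_def)
  define F where "F = (\<lambda>(p, q). act A p x + act A q y)"
  define P where "P = range F"
  note cl = act_closed[OF E xy(1)] act_closed[OF E xy(2)]
  have PI: "act A p x + act A q y \<in> P" for p q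
    unfolding P_def F_def by (rule range_eqI[of _ _ "(p, q)"]) simp
  have PE: "\<exists>p q. u = act A p x + act A q y" if "u \<in> P" for u
    using that by (auto simp: P_def F_def)
  have PV: "P \<subseteq> V" using cl by (auto simp: P_def F_def)
  have sP: "subgp P" unfolding subgp_def
  proof (intro conjI ballI)
    show "0 \<in> P" using PI[of 0 0] by simp
    fix u v assume uv: "u \<in> P" "v \<in> P"
    obtain p q where u: "u = act A p x + act A q y" using PE[OF uv(1)] by (elim exE)
    obtain p' q' where v: "v = act A p' x + act A q' y" using PE[OF uv(2)] by (elim exE)
    have "u + v = act A (p + p') x + act A (q + q') y"
      using xy by (simp add: u v act_add[OF E] ac_simps)
    then show "u + v \<in> P" using PI by simp
  qed
  have mv: "B (act A p u) (act A s w) = B (act A (s * p) u) w" if "u \<in> V" "w \<in> V" for p s u w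
    using that selfadjD[OF selfadj_act[OF selfadj_tr[of 1]], of "act A p u" w s] act_closed[OF E that(1)]
    by (simp add: act_mult[OF E])
  have self: "B (act A p u) (act A s u) = 0" if "u \<in> V" for p s u
    using mv[OF that that] selfadj_alternating[OF selfadj_tr \<phi> that] by simp
  \<comment> \<open>Pairing with all multiples of one generator detects whether the coefficient of
    the other is 0 modulo \<phi>. This yields nondegeneracy as well as uniqueness of the
    coefficients, hence the cardinality.\<close>
  have dvd1: "\<phi> dvd p" if "\<forall>s. B (act A p x + act A q y) (act A s y) = 0" for p q
  proof (rule ccontr)
    assume "\<not> \<phi> dvd p"
    then obtain s where s: "act A s (act A p x) = x"
      using act_unit[OF E \<phi>(1) xy(1) \<phi>(2)[OF xy(1)]] by blast
    have "B (act A p x + act A q y) (act A s y) = 0" using that by blast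
    then have "B (act A p x) (act A s y) = 0" using self[OF xy(2)] cl by (simp add: addl)
    then have "B (act A s (act A p x)) y = 0" using mv[OF xy(1,2)] xy by (simp add: act_mult[OF E])
    then show False using s xy by simp
  qed
  have dvd2: "\<phi> dvd q" if "\<forall>s. B (act A p x + act A q y) (act A s x) = 0" for p q
  proof (rule ccontr)
    assume "\<not> \<phi> dvd q"
    then obtain s where s: "act A s (act A q y) = y"
      using act_unit[OF E \<phi>(1) xy(2) \<phi>(2)[OF xy(2)]] by blast
    have "B (act A p x + act A q y) (act A s x) = 0" using that by blast
    then have "B (act A q y) (act A s x) = 0" using self[OF xy(1)] cl by (simp add: addl)
    then have "B (act A s (act A q y)) x = 0" using mv[OF xy(2,1)] xy by (simp add: act_mult[OF E])
    then show False using s xy symm[OF xy(1,2)] by simp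
  qed
  have ann: "act A p u = 0" if "\<phi> dvd p" "u \<in> V" for p u
    using act_dvd[OF E that(1) \<phi>(2) that(2)] .
  have "sympl P B"
  proof
    show "finite P" using fin PV by (rule finite_subset[rotated])
    fix u assume u: "u \<in> P" and z: "\<And>v. v \<in> P \<Longrightarrow> B u v = 0"
    obtain p q where pq: "u = act A p x + act A q y" using PE[OF u] by (elim exE)
    have "\<forall>s. B (act A p x + act A q y) (act A s y) = 0" "\<forall>s. B (act A p x + act A q y) (act A s x) = 0"
      using z PI[of 0] PI[of _ 0] by (simp_all add: pq)
    then have "\<phi> dvd p" "\<phi> dvd q" using dvd1 dvd2 by blast+
    then show "u = 0" using ann xy by (simp add: pq)
  qed (use sP PV addl addr alt in \<open>auto simp: subset_iff\<close>)
  moreover have "g u \<in> P \<and> A u \<in> P" if u: "u \<in> P" for u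
  proof
    obtain p q where pq: "u = act A p x + act A q y" using PE[OF u] by (elim exE)
    have "A u = A (act A p x) + A (act A q y)" unfolding pq using cl by (rule endo_add[OF E])
    also have "\<dots> = act A (pCons 0 p) x + act A (pCons 0 q) y" by (simp add: act_pCons[OF E])
    finally show "A u \<in> P" using PI by simp
    have gA: "g (act A p u) = act A p (g u)" if "u \<in> V" for p u
    proof (rule act_commute[OF E Eg _ that])
      show "g (A v) = A (g v)" if "v \<in> V" for v using that by (rule tr_g)
    qed
    have "g u = g (act A p x) + g (act A q y)" unfolding pq using cl by (rule endo_add[OF Eg])
    also have "g (act A p x) = act A p y" using gA xy by (simp add: y_def)
    also have "g (act A q y) = act A q (A y + x)"
      using gA[OF xy(2)] g_quadratic[OF xy(1)] by (simp add: y_def)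
    also have "\<dots> = act A (q * [:0, 1:]) y + act A q x"
      using xy by (simp add: act_add_right[OF E] endo_closed[OF E] act_mult[OF E] act_X[OF E]
          del: mult_pCons_right)
    finally have "g u = act A q x + act A (p + q * [:0, 1:]) y"
      using xy by (simp add: act_add[OF E] ac_simps del: mult_pCons_right)
    then show "g u \<in> P" using PI by simp
  qed
  moreover have "card P = 2 ^ (2 * e)"
  proof -
    define D where "D = {p :: bit poly. degree p < e}"
    have D: "finite D" "card D = 2 ^ e" using card_poly_degree_less[OF e] by (simp_all add: D_def)
    have modD: "p mod \<phi> \<in> D" for p
      using degree_mod_less[of \<phi> p] \<phi>(1) e by (fastforce simp: D_def e_def)
    have am: "act A (p mod \<phi>) u = act A p u" if "u \<in> V" for p u
    proof -
      have "act A p u = act A (p div \<phi> * \<phi> + p mod \<phi>) u" by simp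
      also have "\<dots> = act A (p div \<phi> * \<phi>) u + act A (p mod \<phi>) u" using that by (rule act_add[OF E])
      also have "act A (p div \<phi> * \<phi>) u = 0" using ann that by simp
      finally show ?thesis by simp
    qed
    have "F ` (D \<times> D) = P"
    proof
      show "P \<subseteq> F ` (D \<times> D)"
      proof
        fix u assume u: "u \<in> P"
        obtain p q where pq: "u = act A p x + act A q y" using PE[OF u] by (elim exE)
        have "u = F (p mod \<phi>, q mod \<phi>)" using am xy by (simp add: F_def pq)
        then show "u \<in> F ` (D \<times> D)" using modD by blast
      qed
    qed (auto simp: P_def)
    moreover have "inj_on F (D \<times> D)"
    proof (rule inj_onI, clarsimp simp: F_def)
      fix p q p' q' assume *: "p \<in> D" "q \<in> D" "p' \<in> D" "q' \<in> D"
        "act A p x + act A q y = act A p' x + act A q' y"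
      have "act A (p + p') x + act A (q + q') y
        = (act A p x + act A q y) + (act A p' x + act A q' y)"
        using xy by (simp add: act_add[OF E] ac_simps)
      also have "\<dots> = 0" using *(5) by simp
      finally have z: "act A (p + p') x + act A (q + q') y = 0" .
      have "\<phi> dvd p + p'" "\<phi> dvd q + q'"
        using dvd1[of "p + p'" "q + q'"] dvd2[of "p + p'" "q + q'"] cl by (simp_all add: z)
      moreover have "degree (p + p') < e" "degree (q + q') < e"
        using * by (simp_all add: D_def degree_add_less)
      ultimately have z: "p + p' = 0" "q + q' = 0"
        using dvd_imp_degree_le[of \<phi>] by (fastforce simp: e_def)+
      have pp: "a = b" if "a + b = 0" for a b :: "bit poly"
      proof (rule poly_eqI)
        fix i have "coeff a i + coeff b i = 0" using that by (metis coeff_0 coeff_add)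
        then show "coeff a i = coeff b i" by (simp only: add_eq_0_iff_eq)
      qed
      show "p = p' \<and> q = q'" using pp z by blast
    qed
    ultimately have "card P = card (D \<times> D)" using card_image by metis
    then show ?thesis using D by (simp add: card_cartesian_product mult_2 power_add)
  qed
  ultimately show ?thesis using PV unfolding e_def by (intro exI[of _ P]) simp
qed

text \<open>The model consists of \<open>c\<close> orthogonal copies of one block, tensored with the
  residue field of \<open>f\<close>; the exponent in \<open>card\<close> is the block dimension
  \<open>2 * ord r 4\<close> times \<open>degree f\<close> times \<open>c\<close>. An isometry
  identifies \<open>V\<close> with the model compatibly with \<open>g\<close>, and multiplication by
  the indeterminate is pulled back.\<close>

lemma field_op_homogeneous:
  assumes hom: "2 * ord r (4::nat) = r - 1" and V: "V \<noteq> {0}"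
    and f: "irreducible f" and card: "card V = 2 ^ (2 * (ord r (4::nat) * (degree f * c)))"
  shows "field_op g f"
proof -
  have "\<exists>\<phi>. irreducible \<phi> \<and> degree \<phi> = ord r (4::nat) \<and> (\<forall>x\<in>V. act A \<phi> x = 0)"
    by (rule irreducible_annihilator[OF hom V]) (intro exI conjI ballI)
  then obtain \<phi> where \<phi>1: "irreducible \<phi>" "degree \<phi> = ord r (4::nat)" and "\<forall>x\<in>V. act A \<phi> x = 0"
    by (elim exE conjE)
  then have \<phi>: "irreducible \<phi>" "degree \<phi> = ord r (4::nat)" "\<And>x. x \<in> V \<Longrightarrow> act A \<phi> x = 0"
    by simp_all
  have "\<exists>P. sympl P B \<and> P \<subseteq> V \<and> (\<forall>x\<in>P. g x \<in> P \<and> A x \<in> P) \<and> card P = 2 ^ (2 * degree \<phi>)"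
    by (rule homogeneous_block_exists[OF \<phi>(1) _ V]) (rule \<phi>(3))
  then obtain P where P: "sympl P B" "P \<subseteq> V" "\<forall>x\<in>P. g x \<in> P \<and> A x \<in> P" "card P = 2 ^ (2 * degree \<phi>)"
    by (elim exE conjE)
  note E = endo_tr[of 1]
  have df: "degree f > 0" using f by (rule degree_irreducible_pos)
  interpret PP: sympl P B by fact
  define D :: "nat \<Rightarrow> nat \<Rightarrow> bit" where "D = (\<lambda>i j. if i = j then 1 else 0)"
  define W where "W = pw c P"
  define BW where "BW = gram_form c D B"
  have sW: "sympl W BW" unfolding W_def BW_def D_def by (rule PP.sympl_power)
  interpret PW: sympl W BW by fact
  interpret TN: sympl_tensor W BW f by unfold_locales (rule df)
  have EP: "endo P g" "endo P A"
    using P(2,3) Eg E PP.sub by (auto simp: endo_def subset_iff)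
  have "PP.isom g" unfolding PP.isom_def using EP(1) P(2) isom_B[OF g] by (auto simp: subset_iff)
  then have gW: "PW.isom (ptw g)"
    using PP.isom_ptw[OF sW[unfolded W_def BW_def]] by (simp add: W_def BW_def)
  have "PP.selfadj A" unfolding PP.selfadj_def using EP(2) P(2) selfadjD[OF selfadj_tr] by (auto simp: subset_iff)
  then have AW: "PW.selfadj (ptw A)"
    using PP.selfadj_ptw[OF sW[unfolded W_def BW_def]] by (simp add: W_def BW_def)
  \<comment> \<open>Two layers of tuples: the inner one for the \<open>c\<close> copies, the outer
    one for the residue field.\<close>
  define g2 where "g2 = ptw (ptw g)"
  define A2 where "A2 = ptw (ptw A)"
  have g2: "TN.TS.isom g2" unfolding g2_def using PW.isom_ptw[OF TN.sympl_TB gW] .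
  have A2: "TN.TS.selfadj A2" unfolding A2_def using PW.selfadj_ptw[OF TN.sympl_TB AW] .
  have entry: "z i l \<in> V" if "z \<in> TN.TV" for z i l
    using that P(2) zero_mem by (cases "i < degree f"; cases "l < c") (auto simp: pw_def W_def)
  have actA2: "act A2 p z = ptw (ptw (act A p)) z" for p z
  proof -
    have "act (ptw A) p = ptw (act A p)" by (rule ext) (rule PP.act_ptw[OF EP(2)])
    then show ?thesis unfolding A2_def PW.act_ptw[OF PW.selfadj_endo[OF AW]] by (simp only:)
  qed
  interpret Q: block_pair V B TN.TV TN.TB A g A2 g2 \<phi>
  proof unfold_locales
    show "act A2 \<phi> z = 0" if "z \<in> TN.TV" for z
      unfolding actA2 using entry[OF that] \<phi>(3) by (simp add: ptw_def fun_eq_iff)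
    show "g2 (A2 z) = A2 (g2 z)" if "z \<in> TN.TV" for z
      using entry[OF that] tr_g by (simp add: g2_def A2_def ptw_def)
  qed (use \<phi> g2 A2 selfadj_tr g tr_g in auto)
  have cardW: "card W = (2 ^ (2 * degree \<phi>)) ^ c"
    using card_pw[OF PP.fin, of c] P(4) by (simp add: W_def)
  have "card TN.TV = card V"
    using card_pw[OF PW.fin, of "degree f"] card
    by (simp add: cardW \<phi>(2) ac_simps flip: power_mult)
  then have cV: "card V = card TN.TV" ..
  obtain \<sigma> where \<sigma>: "bij_betw \<sigma> V TN.TV" "\<And>x y. x \<in> V \<Longrightarrow> y \<in> V \<Longrightarrow> \<sigma> (x + y) = \<sigma> x + \<sigma> y"
    "\<And>x y. x \<in> V \<Longrightarrow> y \<in> V \<Longrightarrow> TN.TB (\<sigma> x) (\<sigma> y) = B x y"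
    "\<And>x. x \<in> V \<Longrightarrow> \<sigma> (g x) = g2 (\<sigma> x)"
  proof (rule Q.isometry_exists_quadratic[OF cV])
    show "g (g x) = A (g x) + x" if "x \<in> V" for x using that by (rule g_quadratic)
    show "x = 0" if "x \<in> V" "g (g x) = x" for x using that by (rule g_square_free)
    show "g2 (g2 z) = A2 (g2 z) + z" if "z \<in> TN.TV" for z
      using entry[OF that] g_quadratic by (simp add: g2_def A2_def ptw_def fun_eq_iff)
    show "z = 0" if "z \<in> TN.TV" "g2 (g2 z) = z" for z
    proof -
      have "g (g (z i l)) = z i l" for i l
        using fun_cong[OF fun_cong[OF that(2), of i], of l] by (simp add: g2_def ptw_def)
      then have "z i l = 0" for i l using g_square_free[OF entry[OF that(1)]] by blast
      then show ?thesis by (simp add: fun_eq_iff)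
    qed
  qed blast
  define \<tau> where "\<tau> = inv_into V \<sigma>"
  have \<tau>1: "\<tau> (\<sigma> x) = x" if "x \<in> V" for x using \<sigma>(1) that by (simp add: \<tau>_def bij_betw_def)
  have \<tau>2: "\<sigma> (\<tau> z) = z" "\<tau> z \<in> V" if "z \<in> TN.TV" for z
    using \<sigma>(1) that by (auto simp: \<tau>_def bij_betw_def f_inv_into_f inv_into_into)
  have \<sigma>V: "\<sigma> x \<in> TN.TV" if "x \<in> V" for x using \<sigma>(1) that by (auto simp: bij_betw_def)
  have \<sigma>0: "\<sigma> 0 = 0" using \<sigma>(2)[of 0 0] by simp
  have inj: "x = y" if "x \<in> V" "y \<in> V" "\<sigma> x = \<sigma> y" for x y using \<tau>1 that by metis
  define T where "T x = \<tau> (companion f (\<sigma> x))" for x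
  have \<sigma>T: "\<sigma> (T x) = companion f (\<sigma> x)" "T x \<in> V" if "x \<in> V" for x
    using \<tau>2 TN.companion_closed[OF \<sigma>V[OF that]] by (simp_all add: T_def)
  have ET: "endo V T" unfolding endo_def
  proof (intro conjI ballI)
    fix x y assume xy: "x \<in> V" "y \<in> V"
    show "T (x + y) = T x + T y"
    proof (rule inj)
      show "\<sigma> (T (x + y)) = \<sigma> (T x + T y)"
        using xy \<sigma>T \<sigma>V by (simp add: \<sigma>(2) endo_add[OF TN.endo_companion])
    qed (use xy \<sigma>T in simp_all)
  qed (use sub \<sigma>T in auto)
  show ?thesis unfolding field_op_def
  proof (rule exI[of _ T], intro conjI ballI)
    show "selfadj T" unfolding selfadj_def
    proof (intro conjI ballI ET)
      fix x y assume xy: "x \<in> V" "y \<in> V"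
      show "B (T x) y = B x (T y)"
        using \<sigma>(3)[OF \<sigma>T(2)[OF xy(1)] xy(2)] \<sigma>(3)[OF xy(1) \<sigma>T(2)[OF xy(2)]]
          TN.TS.selfadjD[OF TN.selfadj_companion \<sigma>V[OF xy(1)] \<sigma>V[OF xy(2)]]
        by (simp add: \<sigma>T xy)
    qed
    fix x assume x: "x \<in> V"
    have "\<sigma> (act T f x) = act (companion f) f (\<sigma> x)"
      by (rule act_intertwine[OF ET TN.endo_companion \<sigma>(2) \<sigma>0 \<sigma>T(1) x])
    also have "\<dots> = \<sigma> 0" using TN.act_companion[OF \<sigma>V[OF x]] \<sigma>0 by simp
    finally show "act T f x = 0" using inj[OF act_closed[OF ET x] zero_mem] by simp
    show "g (T x) = T (g x)"
    proof (rule inj)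
      show "\<sigma> (g (T x)) = \<sigma> (T (g x))"
        using \<sigma>(4) \<sigma>T x isom_closed[OF g] PW.isom_endo[OF gW] \<sigma>V[OF x]
        by (simp add: g2_def TN.companion_ptw)
    qed (use x \<sigma>T isom_closed[OF g] in simp_all)
  qed
qed

end

subsection \<open>Involutions\<close>

lemma irreducible_no_root:
  fixes f :: "'a::field poly"
  assumes f: "irreducible f" "degree f \<ge> 2"
  shows "poly f a \<noteq> 0"
proof
  assume "poly f a = 0"
  then have "[:- a, 1:] dvd f" by (simp only: poly_eq_0_iff_dvd)
  then obtain h where h: "f = [:- a, 1:] * h" by (rule dvdE)
  have "h \<noteq> 0" using f h by (auto simp: Factorial_Ring.irreducible_def)
  have "[:- a, 1:] dvd 1 \<or> h dvd 1" using f(1) h by (simp add: Factorial_Ring.irreducible_def)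
  then have "degree h = 0" using \<open>h \<noteq> 0\<close> by (auto simp: is_unit_iff_degree)
  then have "degree f = 1" unfolding h using \<open>h \<noteq> 0\<close> by (subst degree_mult_eq) auto
  then show False using f(2) by simp
qed

text \<open>Some irreducible polynomial of degree 2 exists, and having no root at 0 and at 1 leaves
  a single candidate.\<close>

lemma irreducible_quadratic_bit: "irreducible [:1, 1, 1 :: bit:]"
proof -
  obtain f :: "bit poly" where f: "irreducible f" "degree f = 2"
    using irreducible_exists_prime_degree[OF two_is_prime_nat] .
  define a b where "a = coeff f 0" and "b = coeff f 1"
  have c2: "coeff f 2 = 1"
    using f(2) leading_coeff_0_iff[of f] by (cases "coeff f 2") auto
  have e: "f = [:a, b, 1:]"
  proof (rule poly_eqI)
    fix i :: nat
    consider "i = 0" | "i = 1" | "i = 2" | "i > 2" by linarith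
    then show "coeff f i = coeff [:a, b, 1:] i"
    proof cases
      case 4
      then have "coeff f i = 0" using f(2) by (intro coeff_eq_0) simp
      moreover have "coeff [:a, b, 1:] i = 0" using 4 by (intro coeff_eq_0) simp
      ultimately show ?thesis by simp
    qed (use c2 in \<open>simp_all add: a_def b_def numeral_2_eq_2 One_nat_def\<close>)
  qed
  have "poly f 0 \<noteq> 0" "poly f 1 \<noteq> 0" using irreducible_no_root[OF f(1)] f(2) by simp_all
  then have "a = 1" "b = 1" by (cases a; cases b; simp add: e)+
  then show ?thesis using f(1) e by simp
qed

context sympl
begin

text \<open>With \<open>N = h + 1\<close>, the fixed space \<open>C\<close> is kernel and image of
  \<open>N\<close>. A suitable complement \<open>W\<close> of \<open>C\<close> is mapped
  isomorphically onto \<open>C\<close> by \<open>N\<close>, so \<open>V\<close> is a double of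
  \<open>C\<close>, on which the field with four elements acts and \<open>h\<close> induces its
  automorphism. For the second claim, \<open>B (j c) d\<close> is a symplectic form on
  \<open>C\<close>, so \<open>card C\<close> is the square of a Gauss sum.\<close>

lemma involution_semilinear_op:
  assumes h: "isom h" "\<And>x. x \<in> V \<Longrightarrow> h (h x) = x"
    and q: "quad q" "\<And>x. x \<in> V \<Longrightarrow> q (h x) = q x" "\<And>v. v \<in> V \<Longrightarrow> h v = v \<Longrightarrow> q v = 0"
  shows "\<exists>T. selfadj T \<and> (\<forall>x\<in>V. T (T x) = T x + x) \<and> (\<forall>x\<in>V. h (T x) = T (h x) + h x)"
    and "\<exists>s. s * s = card {x \<in> V. h x = x}"
proof -
  define C where "C = {x \<in> V. h x = x}"
  have lag: "perp C = C" "C = (\<lambda>w. h w + w) ` V" "subgp C"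
    unfolding C_def by (rule involution_lagrangian[OF h(1) _ q(1)]; (erule h(2) | erule (1) q(3)))+
  have Eh: "endo V h" using h(1) by (rule isom_endo)
  define N where "N x = h x + x" for x
  have EN: "endo V N" unfolding N_def using endo_plus[OF Eh endo_id[OF sub]] .
  have NV: "N x \<in> V" if "x \<in> V" for x using endo_closed[OF EN that] .
  have Nadd: "N (x + y) = N x + N y" if "x \<in> V" "y \<in> V" for x y using endo_add[OF EN that] .
  have N0: "N 0 = 0" using endo_0[OF EN] .
  have CV: "C \<subseteq> V" by (auto simp: C_def)
  have NC: "N x \<in> C" if "x \<in> V" for x
    using that h(2) isom_closed[OF h(1)] by (simp add: C_def N_def endo_add[OF Eh] add.commute)
  have Csurj: "\<exists>x\<in>V. c = N x" if "c \<in> C" for c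
  proof -
    have "c \<in> (\<lambda>w. h w + w) ` V" unfolding lag(2)[symmetric] by (rule that)
    then obtain w where "w \<in> V" "c = N w" unfolding N_def by (elim imageE)
    then show ?thesis by (intro bexI[of _ w])
  qed
  have CN: "x \<in> C \<longleftrightarrow> x \<in> V \<and> N x = 0" for x by (auto simp: C_def N_def)
  have CC: "B c d = 0" if "c \<in> C" "d \<in> C" for c d
  proof -
    have "c \<in> perp C" using that(1) lag(1) by simp
    then show ?thesis using that(2) by (simp add: perp_def)
  qed
  have Nadj: "B (N x) y = B x (N y)" if "x \<in> V" "y \<in> V" for x y
    using that isom_B[OF h(1), of x "h y"] h(2) isom_closed[OF h(1)]
    by (simp add: N_def addl addr)
  have Nself: "B x (N x) = 0" if x: "x \<in> V" for x
  proof -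
    have "q (x + N x) = q x + q (N x) + B x (N x)" using x NV by (intro quadD[OF q(1)])
    moreover have "x + N x = h x" by (simp add: N_def ac_simps)
    moreover have "q (N x) = 0" using q(3) NC[OF x] by (simp add: C_def)
    ultimately show ?thesis using q(2)[OF x] by simp
  qed
  \<comment> \<open>Partial candidates for \<open>W\<close>. The condition on \<open>B w w'\<close>
    is what self-adjointness needs: the contribution to \<open>B (T x) y\<close> with both
    components in \<open>W\<close> will be \<open>B w w' + B (N w) w'\<close>.\<close>
  define \<A> where "\<A> = {W. subgp W \<and> W \<subseteq> V \<and> W \<inter> C = {0} \<and> (\<forall>w\<in>W. \<forall>w'\<in>W. B w w' = B (N w) w')}"
  have "{0} \<in> \<A>" using CV subgp_0[OF lag(3)] N0 by (auto simp: \<A>_def subgp_def)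
  then have "\<A> \<noteq> {}" by auto
  moreover have "\<A> \<subseteq> Pow V" by (auto simp: \<A>_def)
  ultimately obtain W where W: "W \<in> \<A>" and max: "\<And>W'. W' \<in> \<A> \<Longrightarrow> card W' \<le> card W"
    using ex_max_card[OF fin] by metis
  have sW: "subgp W" and WV: "W \<subseteq> V" and WC: "W \<inter> C = {0}"
    and WB: "\<And>w w'. w \<in> W \<Longrightarrow> w' \<in> W \<Longrightarrow> B w w' = B (N w) w'"
    using W by (simp_all add: \<A>_def)
  have inj: "w = w'" if "w \<in> W" "w' \<in> W" "N w = N w'" for w w'
  proof -
    have "w + w' \<in> V" using that WV by (simp add: subset_iff)
    moreover have "N (w + w') = 0" using that WV by (simp add: Nadd subset_iff)
    ultimately have "w + w' \<in> W \<inter> C" using subgp_add[OF sW that(1,2)] by (simp add: CN)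
    then show ?thesis using WC by auto
  qed
  define j where "j = inv_into W N"
  have j: "j (N w) = w" if "w \<in> W" for w
    using that inj by (simp add: j_def inv_into_f_f inj_on_def)
  \<comment> \<open>If \<open>c\<close> were missed, \<open>W\<close> could be enlarged by a
    preimage \<open>y0\<close> of \<open>c\<close> corrected by some \<open>N t\<close>, which
    leaves \<open>N y0\<close> unchanged. Compatibility with \<open>W\<close> asks that
    \<open>B t (N w) = B (w + N w) y0\<close> for all \<open>w\<close>; the right side is a
    functional of \<open>N w\<close>, as \<open>N\<close> is injective on \<open>W\<close>.\<close>
  have full: "\<exists>w\<in>W. c = N w" if cC: "c \<in> C" for c
  proof (rule ccontr)
    assume nc: "\<not> ?thesis"
    obtain y0 where y0: "y0 \<in> V" "c = N y0" using Csurj[OF cC] by (elim bexE)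
    define K where "K = N ` W"
    have K: "subgp K" "K \<subseteq> V"
    proof -
      show "K \<subseteq> V" using WV NV by (auto simp: K_def)
      show "subgp K" unfolding subgp_def
      proof (intro conjI ballI)
        show "0 \<in> K" using subgp_0[OF sW] N0 by (metis K_def imageI)
        fix a b assume "a \<in> K" "b \<in> K"
        then obtain u v where uv: "u \<in> W" "v \<in> W" "a = N u" "b = N v" by (auto simp: K_def)
        then have "a + b = N (u + v)" using WV by (simp add: Nadd subset_iff)
        then show "a + b \<in> K" using subgp_add[OF sW uv(1,2)] by (simp add: K_def)
      qed
    qed
    define l where "l a = B (j a + a) y0" for a
    have ladd: "l (a + b) = l a + l b" if ab: "a \<in> K" "b \<in> K" for a b
    proof -
      obtain u v where uv: "u \<in> W" "v \<in> W" "a = N u" "b = N v" using ab by (auto simp: K_def)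
      have V: "u \<in> V" "v \<in> V" using uv WV by auto
      have "a + b = N (u + v)" using uv V by (simp add: Nadd)
      then have "j (a + b) = u + v" using j subgp_add[OF sW uv(1,2)] by simp
      moreover have "j a = u" "j b = v" using uv j by simp_all
      ultimately show ?thesis using V NV y0 uv by (simp add: l_def addl ac_simps)
    qed
    obtain t where t: "t \<in> V" "\<And>a. a \<in> K \<Longrightarrow> l a = B t a"
      using functional_subgp[OF K ladd] by metis
    define y where "y = y0 + N t"
    have yV: "y \<in> V" using y0 t NV by (simp add: y_def)
    have Ny: "N y = c" using y0 t NV NC[OF t(1)] by (simp add: y_def Nadd CN)
    have wy: "B w y = B (N w) y" if w: "w \<in> W" for w
    proof -
      have wV: "w \<in> V" using w WV by auto
      have "B (w + N w) y0 = B t (N w)"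
        using t(2)[of "N w"] w j by (simp add: l_def K_def)
      also have "\<dots> = B w (N t)" using Nadj[OF wV t(1)] symm[OF t(1) NV[OF wV]] by simp
      finally have "B w y0 + B (N w) y0 = B w (N t)" using wV NV y0 by (simp add: addl)
      moreover have "B (N w) (N t) = 0" using CC NC wV t by simp
      ultimately show ?thesis using wV NV y0 t
        by (cases "B w y0"; cases "B (N w) y0") (simp_all add: y_def addr)
    qed
    have yw: "B y w = B (N y) w" if w: "w \<in> W" for w
    proof -
      have wV: "w \<in> V" using w WV by auto
      have "B y w = B (N w) y" using wy[OF w] symm[OF yV wV] by simp
      also have "\<dots> = B y (N w)" using symm NV wV yV by simp
      also have "\<dots> = B (N y) w" using Nadj[OF yV wV] by simp
      finally show ?thesis .
    qed
    have yy: "B y y = B (N y) y" using Nself[OF yV] symm NV yV by (simp add: alt)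
    define W' where "W' = W \<union> (\<lambda>w. w + y) ` W"
    have s': "subgp W'" unfolding W'_def using sW by (rule subgp_extend)
    have W'V: "W' \<subseteq> V" using WV yV by (auto simp: W'_def)
    have nC: "w + y \<notin> C" if w: "w \<in> W" for w
    proof
      assume "w + y \<in> C"
      then have "N (w + y) = 0" by (simp add: CN)
      then have "N w = c" using w WV yV Ny by (simp add: Nadd subset_iff)
      then show False using nc w by blast
    qed
    have "W' \<inter> C = {0}" using WC nC by (auto simp: W'_def)
    moreover have "B u v = B (N u) v" if uv: "u \<in> W'" "v \<in> W'" for u v
    proof -
      have r: "B u v = B (N u) v" if "u \<in> V" "u = w \<or> u = w + y" "w \<in> W" "v = w' \<or> v = w' + y" "w' \<in> W" for u v w w'
      proof -
        have V: "w \<in> V" "w' \<in> V" using that WV by auto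
        note NV' = NV[OF V(1)] NV[OF V(2)] NV[OF yV]
        note e = WB[OF that(3,5)] wy[OF that(3)] yw[OF that(5)] yy
        have 1: "B w (w' + y) = B (N w) (w' + y)"
          using V yV NV' by (simp only: addr e)
        have 2: "B (w + y) w' = B (N (w + y)) w'"
          using V yV NV' by (simp only: addl Nadd e)
        have 3: "B (w + y) (w' + y) = B (N (w + y)) (w' + y)"
          using V yV NV' by (simp only: addl addr Nadd add_mem e)
        show ?thesis using that(2,4) 1 2 3 e(1) by (elim disjE) (simp_all only:)
      qed
      obtain w w' where "w \<in> W" "u = w \<or> u = w + y" "w' \<in> W" "v = w' \<or> v = w' + y"
        using uv unfolding W'_def by blast
      moreover have "u \<in> V" using W'V uv(1) by auto
      ultimately show ?thesis using r by blast
    qed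
    ultimately have "W' \<in> \<A>" using s' W'V by (simp add: \<A>_def)
    then have "card W' \<le> card W" by (rule max)
    moreover have "W \<subset> W'"
    proof -
      have "0 + y \<in> W'" unfolding W'_def using subgp_0[OF sW] by blast
      then have "y \<in> W'" by simp
      moreover have "y \<notin> W" using nc Ny by auto
      moreover have "W \<subseteq> W'" by (simp add: W'_def)
      ultimately show ?thesis by blast
    qed
    then have "card W < card W'" using W'V fin by (meson finite_subset psubset_card_mono)
    ultimately show False by simp
  qed
  have jC: "j c \<in> W" "N (j c) = c" if "c \<in> C" for c
  proof -
    obtain w where "w \<in> W" "c = N w" using full[OF \<open>c \<in> C\<close>] by (elim bexE)
    then show "j c \<in> W" "N (j c) = c" using j by simp_all
  qed
  have jV: "j c \<in> V" if "c \<in> C" for c using jC(1)[OF that] WV by auto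
  have jadd: "j (c + d) = j c + j d" if "c \<in> C" "d \<in> C" for c d
  proof -
    have "c + d = N (j c + j d)" using that jC jV by (simp add: Nadd)
    then show ?thesis using j[OF subgp_add[OF sW jC(1)[OF that(1)] jC(1)[OF that(2)]]] by simp
  qed
  have j0: "j 0 = 0" using j[OF subgp_0[OF sW]] N0 by simp
  have Cadd: "c + d \<in> C" if "c \<in> C" "d \<in> C" for c d using subgp_add[OF lag(3) that] .
  define R where "R x = x + j (N x)" for x
  have RC: "R x \<in> C" if "x \<in> V" for x
    using that jV[OF NC[OF that]] jC(2)[OF NC[OF that]] by (simp add: R_def CN Nadd NV)
  have Radd: "R (x + y) = R x + R y" if "x \<in> V" "y \<in> V" for x y
    using that NC by (simp add: R_def Nadd jadd ac_simps)
  \<comment> \<open>Here \<open>j (N x)\<close> and \<open>R x\<close> are the components of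
    \<open>x\<close> in \<open>W\<close> and \<open>C\<close>. With \<open>W\<close> identified with
    \<open>C\<close> by \<open>N\<close>, components (a, b) go to (a + b, a), a map with
    characteristic polynomial X^2 + X + 1.\<close>
  define T where "T x = j (N x) + N x + j (R x)" for x
  have TV: "T x \<in> V" if "x \<in> V" for x using that jV[OF NC] jV[OF RC] NV by (simp add: T_def)
  have Tadd: "T (x + y) = T x + T y" if "x \<in> V" "y \<in> V" for x y
    using that NC RC by (simp add: T_def Nadd jadd Radd ac_simps)
  have ET: "endo V T" using TV Tadd sub by (simp add: endo_def)
  have NT: "N (T x) = N x + R x" if x: "x \<in> V" for x
    using jV[OF NC[OF x]] jV[OF RC[OF x]] jC(2)[OF NC[OF x]] jC(2)[OF RC[OF x]] NV[OF x] NC[OF x]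
    by (simp add: T_def Nadd CN)
  have TT: "T (T x) = T x + x" if x: "x \<in> V" for x
  proof -
    have jn: "j (N (T x)) = j (N x) + j (R x)" using NT[OF x] jadd NC[OF x] RC[OF x] by simp
    have "R (T x) = T x + (j (N x) + j (R x))" by (simp only: R_def[of "T x"] jn)
    also have "\<dots> = N x" by (simp add: T_def ac_simps)
    finally have RT: "R (T x) = N x" .
    have "T (T x) = j (N x) + j (R x) + (N x + R x) + j (N x)"
      by (simp only: T_def[of "T x"] NT[OF x] RT jadd[OF NC[OF x] RC[OF x]])
    then show ?thesis by (simp add: T_def R_def ac_simps)
  qed
  have hT: "h (T x) = T (h x) + h x" if x: "x \<in> V" for x
  proof -
    have hN: "h y = y + N y" for y by (simp add: N_def ac_simps)
    have NN: "N (N x) = 0" using NC[OF x] by (simp add: CN)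
    have "T (N x) = j (N x)" by (simp add: T_def R_def NN j0)
    then have "T (h x) = T x + j (N x)" using x NV by (simp add: hN Tadd)
    moreover have "h (T x) = T x + (N x + R x)" using NT[OF x] by (simp add: hN[of "T x"])
    ultimately show ?thesis by (simp add: hN[of x] R_def ac_simps)
  qed
  have adj: "B (T x) y = B x (T y)" if xy: "x \<in> V" "y \<in> V" for x y
  proof -
    have formula: "B (T x) y = B (j (N x)) (R y) + B (R x) (j (N y)) + B (j (R x)) (R y)"
      if xy: "x \<in> V" "y \<in> V" for x y
    proof -
      define w c w' c' where "w = j (N x)" and "c = R x" and "w' = j (N y)" and "c' = R y"
      have mem: "w \<in> W" "w' \<in> W" "c \<in> C" "c' \<in> C"
        using jC(1) NC RC xy by (simp_all add: w_def w'_def c_def c'_def)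
      then have V: "w \<in> V" "w' \<in> V" "c \<in> V" "c' \<in> V" "j c \<in> V" using WV CV jV by auto
      have Nw: "N w = N x" using jC(2) NC xy by (simp add: w_def)
      have y: "y = w' + c'" by (simp add: w'_def c'_def R_def ac_simps)
      have Tx: "T x = w + N w + j c" by (simp add: T_def Nw) (simp add: w_def c_def)
      have "B (T x) y = (B w w' + B (N w) w') + B w c' + B (N w) c' + B (j c) w' + B (j c) c'"
        unfolding Tx y using V NV by (simp add: addl addr ac_simps)
      also have "B w w' + B (N w) w' = 0" using WB[OF mem(1,2)] by simp
      also have "B (N w) c' = 0" using CC NC V mem by simp
      also have "B (j c) w' = B c w'" using WB[OF jC(1)[OF mem(3)] mem(2)] jC(2)[OF mem(3)] by simp
      finally show ?thesis by (simp add: w_def c_def w'_def c'_def)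
    qed
    have "B (j (R x)) (R y) = B (R x) (j (R y))"
      using Nadj[OF jV[OF RC[OF xy(1)]] jV[OF RC[OF xy(2)]]] jC(2)[OF RC[OF xy(1)]] jC(2)[OF RC[OF xy(2)]]
      by simp
    moreover have "B (R y) (j (N x)) = B (j (N x)) (R y)" "B (j (N y)) (R x) = B (R x) (j (N y))"
      "B (j (R y)) (R x) = B (R x) (j (R y))" "B x (T y) = B (T y) x"
      using symm xy jV NC RC CV TV by (simp_all add: subset_iff)
    ultimately show ?thesis using formula[OF xy] formula[OF xy(2,1)] by (simp add: ac_simps)
  qed
  have "selfadj T" using ET adj by (simp add: selfadj_def)
  then show "\<exists>T. selfadj T \<and> (\<forall>x\<in>V. T (T x) = T x + x) \<and> (\<forall>x\<in>V. h (T x) = T (h x) + h x)"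
    using TT hT by (intro exI[of _ T] conjI ballI)
  have "sympl C (\<lambda>c d. B (j c) d)"
  proof
    show "finite C" using fin CV by (rule finite_subset[rotated])
    show "subgp C" by (rule lag(3))
    fix c assume c: "c \<in> C"
    show "B (j c) c = 0" using Nself[OF jV[OF c]] jC(2)[OF c] by simp
    assume "\<And>d. d \<in> C \<Longrightarrow> B (j c) d = 0"
    then have "j c \<in> perp C" using jV[OF c] by (simp add: perp_def)
    then have "j c \<in> W \<inter> C" using lag(1) jC(1)[OF c] by simp
    then have "j c = 0" using WC by auto
    then show "c = 0" using jC(2)[OF c] N0 by simp
  qed (use CV jV in \<open>simp_all add: jadd addl addr subset_iff\<close>)
  then interpret S: sympl C "\<lambda>c d. B (j c) d" .
  obtain q' where "S.quad q'" using S.quad_exists ..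
  then have "S.gauss q' * S.gauss q' = int (card C)" by (rule S.gauss_square)
  then have "int (nat \<bar>S.gauss q'\<bar> * nat \<bar>S.gauss q'\<bar>) = int (card C)" by (simp add: abs_mult[symmetric])
  then have "nat \<bar>S.gauss q'\<bar> * nat \<bar>S.gauss q'\<bar> = card C" by (simp only: of_nat_eq_iff)
  then show "\<exists>s. s * s = card {x \<in> V. h x = x}" unfolding C_def by (rule exI)
qed

end

subsection \<open>Pairs of isometries with conjugates in a common proper subgroup\<close>

context sympl
begin

text \<open>
  Isometries are functions on the whole type of which only the values on \<open>V\<close> matter, hence
  the last clause.
\<close>

definition subgroup_pred :: "(('v \<Rightarrow> 'v) \<Rightarrow> bool) \<Rightarrow> bool" where
  "subgroup_pred Q \<longleftrightarrow> Q (\<lambda>x. x) \<and>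
     (\<forall>a b. isom a \<and> isom b \<and> Q a \<and> Q b \<longrightarrow> Q (\<lambda>x. a (b x))) \<and>
     (\<forall>a b. isom a \<and> isom b \<and> Q a \<and> (\<forall>x\<in>V. a (b x) = x) \<longrightarrow> Q b) \<and>
     (\<forall>a b. Q a \<and> (\<forall>x\<in>V. b x = a x) \<longrightarrow> Q b)"

text \<open>Conjugates are described by the equation they satisfy on \<open>V\<close>, which avoids
  inverses of \<sigma> and \<tau> as functions.\<close>

definition conj_proper :: "('v \<Rightarrow> 'v) \<Rightarrow> ('v \<Rightarrow> 'v) \<Rightarrow> bool" where
  "conj_proper g h \<longleftrightarrow> (\<exists>Q \<sigma> \<tau>. subgroup_pred Q \<and> isom \<sigma> \<and> isom \<tau> \<and>
     (\<forall>g'. isom g' \<and> (\<forall>x\<in>V. g' (\<sigma> x) = \<sigma> (g x)) \<longrightarrow> Q g') \<and>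
     (\<forall>h'. isom h' \<and> (\<forall>x\<in>V. h' (\<tau> x) = \<tau> (h x)) \<longrightarrow> Q h') \<and> (\<exists>t. isom t \<and> \<not> Q t))"

lemma conj_proper_sym: "conj_proper g h \<Longrightarrow> conj_proper h g"
  unfolding conj_proper_def by (elim exE conjE) (intro exI conjI; assumption)

lemma isom_surj:
  assumes "isom \<sigma>" "x \<in> V"
  obtains y where "y \<in> V" "x = \<sigma> y"
proof -
  have "x \<in> \<sigma> ` V" using isom_bij[OF assms(1)] assms(2) by (simp add: bij_betw_def)
  then show ?thesis by (rule imageE) (rule that)
qed

text \<open>The subgroup is the orthogonal group of \<open>q\<close>. It is proper: the transvection
  along a nonzero \<open>v\<close> with \<open>q v = 0\<close> changes \<open>q\<close> at every
  \<open>x\<close> not orthogonal to \<open>v\<close>.\<close>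

lemma conj_proper_quad:
  assumes card: "card V > 4" and q: "quad q" "quad q'" "gauss q = gauss q'"
    and g: "\<And>x. x \<in> V \<Longrightarrow> q (g x) = q x" and h: "\<And>x. x \<in> V \<Longrightarrow> q' (h x) = q' x"
    and gh: "isom g" "isom h"
  shows "conj_proper g h"
proof -
  obtain \<sigma> where \<sigma>: "isom \<sigma>" "\<And>x. x \<in> V \<Longrightarrow> q' x = q (\<sigma> x)"
    using gauss_eq_conjugate[OF q] by metis
  define Q where "Q = (\<lambda>a. \<forall>x\<in>V. q (a x) = q x)"
  have "subgroup_pred Q" unfolding subgroup_pred_def Q_def
  proof (intro conjI allI impI ballI; (elim conjE)?)
    fix a b x assume "\<forall>x\<in>V. q (a x) = q x" "\<forall>x\<in>V. q (b x) = q x" "x \<in> V" "isom b"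
    then show "q (a (b x)) = q x" using isom_closed by simp
  next
    fix a b x assume "\<forall>x\<in>V. q (a x) = q x" "\<forall>x\<in>V. a (b x) = x" "x \<in> V" "isom b"
    then show "q (b x) = q x" using isom_closed by metis
  qed simp_all
  moreover have "Q g'" if g': "isom g'" "\<forall>x\<in>V. g' x = g x" for g'
    using g' g by (simp add: Q_def)
  moreover have "Q h'" if h': "isom h'" "\<forall>x\<in>V. h' (\<sigma> x) = \<sigma> (h x)" for h'
    unfolding Q_def
  proof
    fix x assume "x \<in> V"
    then obtain y where y: "y \<in> V" "x = \<sigma> y" using isom_surj[OF \<sigma>(1)] by metis
    have "q (h' x) = q' (h y)" using y h'(2) \<sigma>(2) isom_closed[OF gh(2)] by simp
    also have "\<dots> = q x" using h y \<sigma>(2) by simp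
    finally show "q (h' x) = q x" .
  qed
  moreover have "\<exists>t. isom t \<and> \<not> Q t"
  proof -
    obtain v where v: "v \<in> V" "v \<noteq> 0" "q v = 0" using singular_vector_exists[OF q(1) card] .
    then obtain x where x: "x \<in> V" "B v x \<noteq> 0" using nondeg by metis
    then have "q (transvection v x) \<noteq> q x"
      using quad_transvection[OF q(1) v(1) x(1)] v symm[OF v(1) x(1)] by simp
    then have "\<not> Q (transvection v)" using x(1) unfolding Q_def by metis
    then show ?thesis using isom_transvection[OF v(1)] by metis
  qed
  ultimately show ?thesis unfolding conj_proper_def
    using isom_id \<sigma>(1) by (intro exI[of _ Q] exI[of _ "\<lambda>x. x"] exI[of _ \<sigma>]) simp
qed

lemma act_eigenvector:
  assumes T: "endo V T" and v: "v \<in> V" "T v = bsc c v"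
  shows "act T p v = bsc (poly p c) v"
proof (induction p)
  case (pCons a p)
  have "T (bsc (poly p c) v) = bsc (poly p c) (bsc c v)" using v(2) endo_bsc[OF T] by simp
  then show ?case using pCons by (simp add: act_pCons[OF T] bsc_add mult.commute[of c] bsc_mult)
qed simp

text \<open>
  The second alternative for \<open>h\<close> makes it act semilinearly over the field with four elements
  generated by \<open>T'\<close>; then \<open>f\<close> is its minimal polynomial.
\<close>

lemma conj_proper_field:
  assumes card: "card V > 4" and f: "irreducible f" "degree f \<ge> 2"
    and T: "selfadj T" "\<And>x. x \<in> V \<Longrightarrow> act T f x = 0" "\<And>x. x \<in> V \<Longrightarrow> g (T x) = T (g x)"
    and T': "selfadj T'" "\<And>x. x \<in> V \<Longrightarrow> act T' f x = 0"
      "(\<forall>x\<in>V. h (T' x) = T' (h x)) \<or> (\<forall>x\<in>V. h (T' x) = T' (h x) + h x)"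
    and gh: "isom g" "isom h"
  shows "conj_proper g h"
proof -
  note E = selfadj_endo[OF T(1)] selfadj_endo[OF T'(1)]
  obtain \<sigma> where \<sigma>: "isom \<sigma>" "\<And>x. x \<in> V \<Longrightarrow> \<sigma> (T' x) = T (\<sigma> x)"
    using selfadj_conjugate[OF T'(1) T(1) f(1) T'(2) T(2)] by metis
  define Q where "Q = (\<lambda>a. (\<forall>x\<in>V. a (T x) = T (a x)) \<or> (\<forall>x\<in>V. a (T x) = T (a x) + a x))"
  have TV: "T x \<in> V" if "x \<in> V" for x using endo_closed[OF E(1) that] .
  \<comment> \<open>The bit \<open>c\<close> records whether \<open>a\<close> commutes with
    \<open>T\<close> or conjugates it to \<open>T + 1\<close>; these bits add under
    composition.\<close>
  have Qc: "Q a \<longleftrightarrow> (\<exists>c. \<forall>x\<in>V. a (T x) = T (a x) + bsc c (a x))" for a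
  proof
    assume "Q a"
    then show "\<exists>c. \<forall>x\<in>V. a (T x) = T (a x) + bsc c (a x)"
      unfolding Q_def by (elim disjE) (rule exI[of _ 0], simp, rule exI[of _ 1], simp)
  next
    assume "\<exists>c. \<forall>x\<in>V. a (T x) = T (a x) + bsc c (a x)"
    then obtain c where c: "\<forall>x\<in>V. a (T x) = T (a x) + bsc c (a x)" ..
    then show "Q a" unfolding Q_def by (cases c) simp_all
  qed
  have "subgroup_pred Q" unfolding subgroup_pred_def
  proof (intro conjI allI impI; (elim conjE)?)
    show "Q (\<lambda>x. x)" by (simp add: Q_def)
    fix a b assume ab: "isom a" "isom b" "Q a" "Q b"
    then obtain c d where c: "\<forall>x\<in>V. a (T x) = T (a x) + bsc c (a x)"
      and d: "\<forall>x\<in>V. b (T x) = T (b x) + bsc d (b x)" unfolding Qc by (elim exE)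
    have "a (b (T x)) = T (a (b x)) + bsc (c + d) (a (b x))" if x: "x \<in> V" for x
    proof -
      have bx: "b x \<in> V" using isom_closed[OF ab(2) x] .
      have "a (b (T x)) = a (T (b x)) + a (bsc d (b x))"
        using d x bx TV bsc_closed[OF sub bx] by (simp add: endo_add[OF isom_endo[OF ab(1)]])
      then show ?thesis
        using c bx by (simp add: endo_bsc[OF isom_endo[OF ab(1)]] bsc_add add.assoc)
    qed
    then show "Q (\<lambda>x. a (b x))" unfolding Qc by (intro exI[of _ "c + d"] ballI)
  next
    fix a b assume ab: "isom a" "isom b" "Q a" "\<forall>x\<in>V. a (b x) = x"
    then obtain c where c: "\<forall>x\<in>V. a (T x) = T (a x) + bsc c (a x)" unfolding Qc by (elim exE)
    have "b (T x) = T (b x) + bsc c (b x)" if x: "x \<in> V" for x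
    proof (rule inj_onD[OF isom_inj[OF ab(1)]])
      have bx: "b x \<in> V" using isom_closed[OF ab(2) x] .
      note m = TV[OF bx] bsc_closed[OF sub bx]
      have "a (T (b x) + bsc c (b x)) = T x + bsc c x + bsc c x"
        using m c bx ab(4) x by (simp add: endo_add[OF isom_endo[OF ab(1)]] endo_bsc[OF isom_endo[OF ab(1)]])
      then show "a (b (T x)) = a (T (b x) + bsc c (b x))" using ab(4) TV[OF x] by (simp add: add.assoc)
      show "b (T x) \<in> V" using isom_closed[OF ab(2) TV[OF x]] .
      show "T (b x) + bsc c (b x) \<in> V" using m by simp
    qed
    then show "Q b" unfolding Qc by (intro exI[of _ c] ballI)
  next
    fix a b assume "Q a" "\<forall>x\<in>V. b x = a x"
    then show "Q b" using TV by (simp add: Q_def)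
  qed
  moreover have "Q g'" if g': "isom g'" "\<forall>x\<in>V. g' x = g x" for g'
    using g' T(3) TV by (simp add: Q_def)
  moreover have "Q h'" if h': "isom h'" "\<forall>x\<in>V. h' (\<sigma> x) = \<sigma> (h x)" for h'
  proof -
    obtain c where c: "\<forall>x\<in>V. h (T' x) = T' (h x) + bsc c (h x)"
      using T'(3) by (elim disjE) (metis add_0_right bsc_simps(1), metis bsc_simps(2))
    have "h' (T x) = T (h' x) + bsc c (h' x)" if "x \<in> V" for x
    proof -
      obtain y where y: "y \<in> V" "x = \<sigma> y" using isom_surj[OF \<sigma>(1) \<open>x \<in> V\<close>] by metis
      have hy: "h y \<in> V" using isom_closed[OF gh(2) y(1)] .
      have "h' (T x) = h' (\<sigma> (T' y))" using \<sigma>(2) y by simp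
      also have "\<dots> = \<sigma> (h (T' y))" using h'(2) endo_closed[OF E(2) y(1)] by simp
      also have "\<dots> = \<sigma> (T' (h y)) + \<sigma> (bsc c (h y))"
        using c y hy endo_closed[OF E(2) hy] bsc_closed[OF sub hy]
        by (simp add: endo_add[OF isom_endo[OF \<sigma>(1)]])
      also have "\<dots> = T (\<sigma> (h y)) + bsc c (\<sigma> (h y))"
        using \<sigma>(2) hy by (simp add: endo_bsc[OF isom_endo[OF \<sigma>(1)]])
      finally show ?thesis using h'(2) y by simp
    qed
    then show ?thesis unfolding Qc by (intro exI[of _ c] ballI)
  qed
  moreover have "\<exists>t. isom t \<and> \<not> Q t"
  proof -
    have "V \<noteq> {0}" using card by auto
    then obtain v where v: "v \<in> V" "v \<noteq> 0" using zero_mem by auto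
    \<comment> \<open>If the transvection commuted with \<open>T\<close>, then \<open>v\<close>
      would be an eigenvector of \<open>T\<close> and its eigenvalue a root of \<open>f\<close> in
      the field of two elements. In the other case every \<open>x\<close> would be a combination of
      \<open>v\<close> and \<open>T v\<close>, and \<open>card V\<close> at most 4.\<close>
    have "\<not> Q (transvection v)"
    proof
      assume "Q (transvection v)"
      then obtain c where "\<forall>x\<in>V. transvection v (T x) = T (transvection v x) + bsc c (transvection v x)"
        unfolding Qc by (elim exE)
      then have c: "T x + bsc (B (T x) v) v = T x + bsc (B x v) (T v) + bsc c (x + bsc (B x v) v)"
        if "x \<in> V" for x
        using that v bsc_closed[OF sub v(1)]
        by (simp add: transvection_def endo_add[OF E(1)] endo_bsc[OF E(1)])
      have c': "bsc c x = bsc (B (T x) v) v + bsc (B x v) (T v) + bsc c (bsc (B x v) v)" if "x \<in> V" for x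
      proof -
        have "bsc (B (T x) v) v = bsc (B x v) (T v) + bsc c (x + bsc (B x v) v)"
          using c[OF that] by (metis add.assoc add_left_cancel)
        then show ?thesis by (simp add: bsc_add_right ac_simps)
      qed
      show False
      proof (cases "c = 0")
        case True
        obtain x where x: "x \<in> V" "B v x \<noteq> 0" using nondeg v by metis
        then have "B x v = 1" using symm[OF v(1) x(1)] by simp
        then have "T v = bsc (B (T x) v) v" using c'[OF x(1)] True by simp
        then have "act T f v = bsc (poly f (B (T x) v)) v" by (rule act_eigenvector[OF E(1) v(1)])
        then have "act T f v = v" using irreducible_no_root[OF f] by (simp add: bsc_def)
        then show False using T(2)[OF v(1)] v(2) by simp
      next
        case False
        then have c1: "c = 1" by simp
        have "V \<subseteq> {0, v, T v, v + T v}"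
        proof
          fix x assume "x \<in> V"
          then have "x = bsc (B (T x) v) v + bsc (B x v) (T v) + bsc (B x v) v"
            using c' c1 by simp
          then show "x \<in> {0, v, T v, v + T v}"
            by (cases "B (T x) v"; cases "B x v") (simp_all add: ac_simps)
        qed
        then have "card V \<le> card {0, v, T v, v + T v}" by (intro card_mono) auto
        also have "\<dots> \<le> 4" by (simp add: card_insert_if)
        finally show False using card by simp
      qed
    qed
    then show ?thesis using isom_transvection[OF v(1)] by metis
  qed
  ultimately show ?thesis unfolding conj_proper_def
    using isom_id \<sigma>(1) by (intro exI[of _ Q] exI[of _ "\<lambda>x. x"] exI[of _ \<sigma>]) simp
qed

end

subsection \<open>Arithmetic\<close>

text \<open>For \<open>e\<close> among 1, 2, 3, 6 the prime factors of \<open>4 ^ e - 1\<close> are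
  among 3, 5, 7, 13, and the only one for which the order of 4 is exactly \<open>e\<close> is
  \<open>2 * e + 1\<close>.\<close>

lemma half_ord_4:
  assumes r: "prime r" "odd r" and e: "ord r (4::nat) dvd 6"
  shows "2 * ord r (4::nat) = r - 1"
proof -
  define e where "e = ord r (4::nat)"
  have min: "e dvd n" if "r dvd 4 ^ n - 1" for n
    using that cong_altdef_nat[of 1 "4 ^ n" r] ord_divides[of 4 n r] by (simp add: e_def)
  have self: "r dvd 4 ^ e - 1"
    using cong_altdef_nat[of 1 "4 ^ e" r] ord_divides[of 4 e r] by (simp add: e_def)
  have pr: "r dvd p \<Longrightarrow> r = p" if "prime p" for p :: nat using primes_dvd_imp_eq[OF r(1) that] .
  have "prime (3::nat)" "prime (5::nat)" "prime (7::nat)" "prime (13::nat)" by simp_all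
  note pr = pr[OF this(1)] pr[OF this(2)] pr[OF this(3)] pr[OF this(4)]
  have "e \<in> {1, 2, 3, 6}"
  proof -
    have e6: "e dvd 6" using e by (simp only: e_def)
    then have "e \<le> 6" by (auto dest: dvd_imp_le)
    moreover have "e \<noteq> 0" using e6 by (cases "e = 0") simp_all
    ultimately have "e \<in> {1, 2, 3, 4, 5, 6}" by auto
    then show ?thesis using e6 by auto
  qed
  then consider "e = 1" | "e = 2" | "e = 3" | "e = 6" by auto
  then show ?thesis
  proof cases
    case 1
    then have "r = 3" using self pr(1) by simp
    then show ?thesis using 1 by (simp add: e_def)
  next
    case 2
    then have "r dvd 3 * 5" using self by simp
    then have "r = 3 \<or> r = 5" using pr(1,2) r(1) prime_dvd_multD by blast
    then show ?thesis using 2 min[of 1] by (auto simp: e_def)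
  next
    case 3
    then have "r dvd 3 * (3 * 7)" using self by simp
    then have "r = 3 \<or> r = 7" using pr(1,3) r(1) prime_dvd_multD by blast
    then show ?thesis using 3 min[of 1] by (auto simp: e_def)
  next
    case 4
    then have "r dvd 3 * (3 * (5 * (7 * 13)))" using self by simp
    then have "r = 3 \<or> r = 5 \<or> r = 7 \<or> r = 13" using pr r(1) prime_dvd_multD by metis
    then show ?thesis using 4 min[of 1] min[of 2] min[of 3] by (auto simp: e_def)
  qed
qed

text \<open>\<open>4 ^ 5 - 1 = 3 * 11 * 31\<close> and \<open>4 ^ 9 - 1 = 27 * 7 * 19 * 73\<close>.
  The primes 31 and 73 divide \<open>2 ^ 45 - 1\<close>, so the hypothesis \<open>k\<close> excludes
  them, and only 11 and 19 are left.\<close>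

lemma half_ord_4_dvd_45:
  assumes r: "prime r" "odd r" and k: "r dvd 2 ^ 45 + 1"
    and e: "ord r (4::nat) = 5 \<or> ord r (4::nat) = 9"
  shows "2 * ord r (4::nat) = r - 1"
proof -
  define e where "e = ord r (4::nat)"
  have min: "e dvd n" if "r dvd 4 ^ n - 1" for n
    using that cong_altdef_nat[of 1 "4 ^ n" r] ord_divides[of 4 n r] by (simp add: e_def)
  have self: "r dvd 4 ^ e - 1"
    using cong_altdef_nat[of 1 "4 ^ e" r] ord_divides[of 4 e r] by (simp add: e_def)
  have pr: "r dvd p \<Longrightarrow> r = p" if "prime p" for p :: nat using primes_dvd_imp_eq[OF r(1) that] .
  have "prime (3::nat)" "prime (11::nat)" "prime (31::nat)" "prime (7::nat)" "prime (19::nat)" "prime (73::nat)"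
    by simp_all
  note pr = pr[OF this(1)] pr[OF this(2)] pr[OF this(3)] pr[OF this(4)] pr[OF this(5)] pr[OF this(6)]
  consider "e = 5" | "e = 9" using assms(4) by (auto simp: e_def)
  then show ?thesis
  proof cases
    case 1
    then have "r dvd 3 * (11 * 31)" using self by simp
    then have "r = 3 \<or> r = 11 \<or> r = 31" using pr r(1) prime_dvd_multD by metis
    moreover have "r \<noteq> 31" using k by (auto simp: dvd_eq_mod_eq_0)
    ultimately show ?thesis using 1 min[of 1] by (auto simp: e_def)
  next
    case 2
    then have "r dvd 3 * (3 * (3 * (7 * (19 * 73))))" using self by simp
    then have "r = 3 \<or> r = 7 \<or> r = 19 \<or> r = 73" using pr r(1) prime_dvd_multD by metis
    moreover have "r \<noteq> 73" using k by (auto simp: dvd_eq_mod_eq_0)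
    ultimately show ?thesis using 2 min[of 1] min[of 3] by (auto simp: e_def)
  qed
qed

definition special :: "nat \<Rightarrow> bool" where
  "special k \<longleftrightarrow> (\<exists>p a. prime p \<and> a > 0 \<and> (k = p ^ a \<or> k = 2 * p ^ a \<or> k = 3 * p ^ a \<or> k = 6 * p ^ a)) \<or> k = 45"

lemma special_gt_1:
  assumes "special k"
  shows "k > 1"
proof (cases "k = 45")
  case False
  then obtain p a where pa: "prime p" "a > 0"
    and k: "k = p ^ a \<or> k = 2 * p ^ a \<or> k = 3 * p ^ a \<or> k = 6 * p ^ a"
    using assms unfolding special_def by (elim disjE exE conjE) auto
  have "p ^ a > 1" using prime_gt_1_nat[OF pa(1)] pa(2) by (rule one_less_power)
  then show ?thesis using k by auto
qed simp

text \<open>The prime \<open>p\<close> divides at most one of the two, and a divisor of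
  \<open>6 * p ^ a\<close> prime to \<open>p\<close> divides 6.\<close>

lemma special_coprime_divisors:
  assumes k: "k = p ^ a \<or> k = 2 * p ^ a \<or> k = 3 * p ^ a \<or> k = 6 * p ^ a" and p: "prime (p::nat)"
    and e: "e dvd k" "e' dvd k" "coprime e e'"
  shows "e dvd 6 \<or> e' dvd 6"
proof -
  have "k dvd 6 * p ^ a" using k by (auto simp: mult_dvd_mono)
  then have d: "x dvd 6" if "x dvd k" "\<not> p dvd x" for x
  proof -
    have "coprime x (p ^ a)"
      using that(2) p by (metis coprime_commute coprime_power_right_iff prime_imp_coprime_nat)
    moreover have "x dvd 6 * p ^ a" using that(1) \<open>k dvd 6 * p ^ a\<close> by (rule dvd_trans)
    ultimately show ?thesis by (simp add: coprime_dvd_mult_left_iff)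
  qed
  have "\<not> p dvd e \<or> \<not> p dvd e'"
    using e(3) p by (metis coprime_common_divisor_nat not_prime_1 nat_dvd_1_iff_1)
  then show ?thesis using d e by blast
qed

text \<open>A common prime factor of the two orders serves directly. For coprime orders, one of them
  is half of its prime minus 1; it accepts every prime divisor of \<open>k\<close>, so
  \<open>b\<close> is chosen for the other. If the other order is 1, its prime is 3, and any
  \<open>b\<close> will do.\<close>

lemma common_field_degree:
  assumes k: "special k" and r: "prime r" "odd r" "r dvd 2 ^ k + 1" and s: "prime s" "odd s"
    and e: "ord r (4::nat) dvd k" "ord s (4::nat) dvd k"
  shows "\<exists>b. prime b \<and> b dvd k \<and> (b dvd ord r 4 \<or> 2 * ord r (4::nat) = r - 1) \<and>
    (b dvd ord s 4 \<or> 2 * ord s (4::nat) = s - 1)"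
proof -
  define e f where "e = ord r (4::nat)" and "f = ord s (4::nat)"
  note ef = e[folded e_def f_def]
  obtain b0 where b0: "prime b0" "b0 dvd k" using special_gt_1[OF k] prime_factor_nat[of k] by auto
  have pd: "\<exists>b. prime b \<and> b dvd k \<and> b dvd x" if "x dvd k" "x \<noteq> 1" for x
    using prime_factor_nat[OF that(2)] that(1) dvd_trans by metis
  have hom: "?thesis" if "2 * e = r - 1 \<or> 2 * f = s - 1"
  proof -
    have "\<exists>b. prime b \<and> b dvd k \<and> (b dvd e \<or> 2 * e = r - 1) \<and> (b dvd f \<or> 2 * f = s - 1)"
      using that
    proof
      assume h: "2 * e = r - 1"
      show ?thesis
      proof (cases "f = 1")
        case True
        then have "2 * f = s - 1" using half_ord_4[OF s] by (simp add: f_def)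
        then show ?thesis using b0 h by metis
      next
        case False
        then show ?thesis using pd[OF ef(2)] h by metis
      qed
    next
      assume h: "2 * f = s - 1"
      show ?thesis
      proof (cases "e = 1")
        case True
        then have "2 * e = r - 1" using half_ord_4[OF r(1,2)] by (simp add: e_def)
        then show ?thesis using b0 h by metis
      next
        case False
        then show ?thesis using pd[OF ef(1)] h by metis
      qed
    qed
    then show ?thesis by (simp add: e_def f_def)
  qed
  show ?thesis
  proof (cases "coprime e f")
    case False
    then have "gcd e f \<noteq> 1" by (simp add: coprime_iff_gcd_eq_1)
    then obtain b where "prime b" "b dvd gcd e f" using prime_factor_nat by metis
    then have "prime b \<and> b dvd k \<and> (b dvd e \<or> 2 * e = r - 1) \<and> (b dvd f \<or> 2 * f = s - 1)"
      using ef(1) by (auto intro: dvd_trans)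
    then show ?thesis unfolding e_def f_def by (rule exI)
  next
    case True
    have "2 * e = r - 1 \<or> 2 * f = s - 1"
    proof (cases "k = 45")
      case False
      then obtain p a where "prime p" "k = p ^ a \<or> k = 2 * p ^ a \<or> k = 3 * p ^ a \<or> k = 6 * p ^ a"
        using k unfolding special_def by blast
      then have "e dvd 6 \<or> f dvd 6" using special_coprime_divisors ef True by metis
      then show ?thesis using half_ord_4 r s unfolding e_def f_def by metis
    next
      case k45: True
      have div45: "x \<in> {1, 3, 5, 9, 15, 45}" if x: "x dvd 45" for x :: nat
      proof -
        obtain y where y: "45 = x * y" using x by (rule dvdE)
        have small: "z = 1 \<or> z = 3 \<or> z = 5" if "z dvd 45" "z \<le> 6" for z :: nat
        proof -
          have "z = 0 \<or> z = 1 \<or> z = 2 \<or> z = 3 \<or> z = 4 \<or> z = 5 \<or> z = 6"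
            using that(2) by arith
          then show ?thesis using that(1) by (elim disjE) simp_all
        qed
        have "x \<le> 6 \<or> y \<le> 6"
        proof (rule ccontr)
          assume "\<not> (x \<le> 6 \<or> y \<le> 6)"
          then have "7 * 7 \<le> x * y" by (intro mult_le_mono) simp_all
          then show False using y by simp
        qed
        then show ?thesis
        proof
          assume "x \<le> 6"
          then show ?thesis using small[OF x] by auto
        next
          assume "y \<le> 6"
          moreover have "y dvd 45" by (simp add: y)
          ultimately have "y = 1 \<or> y = 3 \<or> y = 5" by (intro small)
          then show ?thesis using y by (elim disjE) simp_all
        qed
      qed
      have ex: "x dvd 6 \<or> x = 5 \<or> x = 9 \<or> x = 15 \<or> x = 45" if "x dvd 45" for x :: nat
        using div45[OF that] by auto
      have nc: "\<not> coprime (15::nat) 5" "\<not> coprime (15::nat) 9"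
        by (rule not_coprimeI[of 5], simp_all) (rule not_coprimeI[of 3], simp_all)
      \<comment> \<open>If neither order divides 6, coprimality leaves 5 and 9 in some order, so
        \<open>e\<close> is one of them and the condition \<open>r dvd 2 ^ 45 + 1\<close>
        applies.\<close>
      have "e dvd 6 \<or> f dvd 6 \<or> e = 5 \<or> e = 9"
        using ex[of e] ex[of f] ef k45 True nc by auto
      then show ?thesis
        using half_ord_4[OF r(1,2)] half_ord_4[OF s] half_ord_4_dvd_45[OF r(1,2)] r(3) k45
        unfolding e_def f_def by auto
    qed
    then show ?thesis by (rule hom)
  qed
qed

section \<open>Combining the cases\<close>

context sympl
begin

text \<open>If \<open>b\<close> does not divide \<open>ord r 4\<close>, it divides the cofactor of
  that order in \<open>k\<close>, which leaves room for a tensor factor of dimension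
  \<open>b\<close>.\<close>

lemma field_op_prime_degree:
  assumes fr: "free_isom V B g r" and card: "card V = 2 ^ (2 * k)" and k: "k > 0"
    and e: "ord r (4::nat) dvd k" and b: "prime b" "b dvd k" "b dvd ord r 4 \<or> 2 * ord r (4::nat) = r - 1"
    and f: "irreducible f" "degree f = b"
  shows "field_op g f"
proof -
  interpret F: free_isom V B g r by fact
  show ?thesis
  proof (cases "b dvd ord r (4::nat)")
    case True
    then show ?thesis using F.field_op_dvd_ord f by simp
  next
    case False
    obtain m where m: "k = ord r (4::nat) * m" using e by (rule dvdE)
    then have "b dvd m" using b False by (simp add: prime_dvd_mult_iff)
    then obtain c where c: "m = b * c" by (rule dvdE)
    have "V \<noteq> {0}"
    proof
      assume "V = {0}"
      moreover have "1 < card V" unfolding card using k by (intro one_less_power) simp_all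
      ultimately show False by simp
    qed
    then show ?thesis
      using F.field_op_homogeneous[of f c] b(3) False f card m c by simp
  qed
qed

lemma conj_proper_opposite_types:
  assumes card: "card V = 2 ^ (2 * k)" and k: "special k"
    and g: "isom g" "prime r" "\<And>x. x \<in> V \<Longrightarrow> (g ^^ r) x = x"
    and h: "isom h" "prime s" "\<And>x. x \<in> V \<Longrightarrow> (h ^^ s) x = x"
    and q: "quad q" "\<And>x. x \<in> V \<Longrightarrow> q (g x) = q x" "\<And>v. v \<in> V \<Longrightarrow> g v = v \<Longrightarrow> q v = 0"
    and q': "quad q'" "\<And>x. x \<in> V \<Longrightarrow> q' (h x) = q' x" "\<And>v. v \<in> V \<Longrightarrow> h v = v \<Longrightarrow> q' v = 0"
    and sign: "gauss q < 0" "gauss q' > 0"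
  shows "conj_proper g h"
proof -
  have k1: "k > 1" using special_gt_1[OF k] .
  have "(2::nat) ^ 4 \<le> 2 ^ (2 * k)" using k1 by (intro power_increasing) auto
  then have card4: "card V > 4" using card by simp
  have val: "gauss p = 2 ^ k \<or> gauss p = - (2 ^ k)" if "quad p" for p
  proof -
    have "gauss p * gauss p = 2 ^ k * 2 ^ k" using gauss_square[OF that] card by (simp add: mult_2 power_add)
    then show ?thesis by (simp only: square_eq_iff)
  qed
  have gq: "gauss q = - (2 ^ k)" and gq': "gauss q' = 2 ^ k"
    using val[OF q(1)] val[OF q'(1)] sign by auto
  have "r \<noteq> 2"
  proof
    assume "r = 2"
    then have "g (g x) = x" if "x \<in> V" for x using g(3)[OF that] by (simp add: numeral_2_eq_2)
    then have "gauss q = int (card {x \<in> V. g x = x})"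
      by (intro involution_lagrangian(4)[OF g(1) _ q(1)]) (use q(3) in auto)
    then show False using sign by simp
  qed
  then have or: "odd r" using g(2) primes_dvd_imp_eq[OF two_is_prime_nat g(2)] by auto
  have free: "x = 0" if "x \<in> V" "g x = x" for x
  proof (rule odd_order_fixed_point_free[OF g(1) or _ q(1) _ that])
    show "(g ^^ r) y = y" if "y \<in> V" for y using that by (rule g(3))
    show "q y = 0" if "y \<in> V" "g y = y" for y using that by (rule q(3))
  qed
  interpret G: free_isom V B g r
  proof (unfold_locales, goal_cases)
    case 1 show ?case by (rule g(1))
  next
    case 2 show ?case by (rule g(2))
  next
    case 3 show ?case by (rule or)
  next
    case (4 x) then show ?case by (rule g(3))
  next
    case (5 x) then show ?case by (rule free)
  qed
  have "int r dvd gauss q - 1"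
    by (rule odd_order_gauss[OF g(1,2) _ q(1)]) (rule g(3) q(2) free; assumption)+
  also have "gauss q - 1 = - int (2 ^ k + 1)" by (simp add: gq)
  finally have rk: "r dvd 2 ^ k + 1" by (simp only: dvd_minus_iff of_nat_dvd_iff)
  have er: "ord r (4::nat) dvd k" using ord_4_dvd_iff[OF g(2) or, of k] rk by simp
  show ?thesis
  proof (cases "s = 2")
    case True
    then have hh: "h (h x) = x" if "x \<in> V" for x using h(3)[OF that] by (simp add: numeral_2_eq_2)
    have "\<exists>T. selfadj T \<and> (\<forall>x\<in>V. T (T x) = T x + x) \<and> (\<forall>x\<in>V. h (T x) = T (h x) + h x)"
      by (rule involution_semilinear_op(1)[OF h(1) _ q'(1)]) (rule hh q'(2,3); assumption)+
    then obtain T' where T': "selfadj T'" "\<forall>x\<in>V. T' (T' x) = T' x + x" "\<forall>x\<in>V. h (T' x) = T' (h x) + h x"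
      by (elim exE conjE)
    have "\<exists>c. c * c = card {x \<in> V. h x = x}"
      by (rule involution_semilinear_op(2)[OF h(1) _ q'(1)]) (rule hh q'(2,3); assumption)+
    then obtain c where c: "c * c = card {x \<in> V. h x = x}" by (elim exE)
    have "gauss q' = int (card {x \<in> V. h x = x})"
      by (rule involution_lagrangian(4)[OF h(1) _ q'(1)]) (rule hh q'(3); assumption)+
    then have "int (card {x \<in> V. h x = x}) = int (2 ^ k)" using gq' by simp
    \<comment> \<open>The fixed space has \<open>2 ^ k\<close> elements, and its cardinality is a
      square, so \<open>k\<close> is even.\<close>
    then have cc: "c * c = 2 ^ k" using c by (simp only: of_nat_eq_iff)
    then have "c dvd 2 ^ k" using dvd_triv_left[of c c] by simp
    then have "\<exists>i\<le>k. c = 2 ^ i" by (simp add: divides_primepow_nat[OF two_is_prime_nat])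
    then obtain i where "c = 2 ^ i" by (elim exE conjE)
    then have "(2::nat) ^ (i + i) = 2 ^ k" using cc by (simp add: power_add)
    then have "i + i = k" by (simp only: power_inject_exp)
    then have k2: "k = 2 * i" by simp
    \<comment> \<open>Otherwise \<open>ord r 4\<close> would divide half of \<open>k\<close>, and
      \<open>r\<close> would divide \<open>2 ^ k - 1\<close> as well as \<open>2 ^ k + 1\<close>,
      hence 2.\<close>
    have ek: "2 dvd ord r (4::nat)"
    proof (rule ccontr)
      assume "\<not> 2 dvd ord r (4::nat)"
      then have "coprime (ord r (4::nat)) 2" by simp
      then have "ord r (4::nat) dvd i" using er k2 by (simp add: coprime_dvd_mult_right_iff)
      then have "[4 ^ i = 1] (mod r)" by (simp add: ord_divides)
      then have "[2 ^ k = 1] (mod r)" by (simp add: k2 power_mult)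
      then have "r dvd 2 ^ k - 1" using cong_altdef_nat[of 1 "2 ^ k" r] by simp
      then have "r dvd (2 ^ k + 1) - (2 ^ k - 1)" by (rule dvd_diff_nat[OF rk])
      also have "(2 ^ k + 1) - (2 ^ k - 1) = (2::nat)"
        using one_le_power[of "2::nat" k] by linarith
      finally show False using G.r_pos by (auto dest: dvd_imp_le)
    qed
    have dq: "degree [:1, 1, 1 :: bit:] = 2" by simp
    have "field_op g [:1, 1, 1:]"
      by (rule G.field_op_dvd_ord[OF irreducible_quadratic_bit]) (simp only: dq ek)
    then obtain T where T: "selfadj T" "\<forall>x\<in>V. act T [:1, 1, 1:] x = 0" "\<forall>x\<in>V. g (T x) = T (g x)"
      unfolding field_op_def by (elim exE conjE)
    have T'0: "act T' [:1, 1, 1:] x = 0" if x: "x \<in> V" for x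
    proof -
      note E = selfadj_endo[OF T'(1)]
      have "act T' [:1, 1, 1:] x = x + T' (x + T' x)"
        by (simp add: act_pCons[OF E] endo_0[OF E])
      also have "T' (x + T' x) = T' x + (T' x + x)"
        using T'(2) x endo_closed[OF E x] by (simp add: endo_add[OF E])
      finally show ?thesis by simp
    qed
    show ?thesis
    proof (rule conj_proper_field[OF card4 irreducible_quadratic_bit _ T(1) _ _ T'(1) _ _ g(1) h(1)])
      show "degree [:1, 1, 1 :: bit:] \<ge> 2" using dq by simp
      show "act T [:1, 1, 1:] x = 0" if "x \<in> V" for x using T(2) that by (rule bspec)
      show "g (T x) = T (g x)" if "x \<in> V" for x using T(3) that by (rule bspec)
      show "act T' [:1, 1, 1:] x = 0" if "x \<in> V" for x using that by (rule T'0)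
      show "(\<forall>x\<in>V. h (T' x) = T' (h x)) \<or> (\<forall>x\<in>V. h (T' x) = T' (h x) + h x)"
        using T'(3) by (rule disjI2)
    qed
  next
    case False
    then have os: "odd s" using False primes_dvd_imp_eq[OF two_is_prime_nat h(2)] by auto
    have free': "x = 0" if "x \<in> V" "h x = x" for x
    proof (rule odd_order_fixed_point_free[OF h(1) os _ q'(1) _ that])
      show "(h ^^ s) y = y" if "y \<in> V" for y using that by (rule h(3))
      show "q' y = 0" if "y \<in> V" "h y = y" for y using that by (rule q'(3))
    qed
    interpret H: free_isom V B h s
    proof (unfold_locales, goal_cases)
      case 1 show ?case by (rule h(1))
    next
      case 2 show ?case by (rule h(2))
    next
      case 3 show ?case by (rule os)
    next
      case (4 x) then show ?case by (rule h(3))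
    next
      case (5 x) then show ?case by (rule free')
    qed
    have "int s dvd gauss q' - 1"
      by (rule odd_order_gauss[OF h(1,2) _ q'(1)]) (rule h(3) q'(2) free'; assumption)+
    also have "gauss q' - 1 = int (2 ^ k - 1)" by (simp add: gq' of_nat_diff)
    finally have "s dvd 2 ^ k - 1" by (simp only: of_nat_dvd_iff)
    then have es: "ord s (4::nat) dvd k" using ord_4_dvd_iff[OF h(2) os, of k] by simp
    obtain b where b: "prime b" "b dvd k" "b dvd ord r 4 \<or> 2 * ord r (4::nat) = r - 1"
      "b dvd ord s 4 \<or> 2 * ord s (4::nat) = s - 1"
      using common_field_degree[OF k g(2) or rk h(2) os er es] by (elim exE conjE)
    obtain f :: "bit poly" where f: "irreducible f" "degree f = b"
      using irreducible_exists_prime_degree[OF b(1)] .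
    have k0: "k > 0" using k1 by simp
    have "field_op g f" "field_op h f"
      using field_op_prime_degree[OF G.free_isom_axioms card k0 er b(1,2,3) f]
        field_op_prime_degree[OF H.free_isom_axioms card k0 es b(1,2,4) f] by simp_all
    then obtain T T' where T: "selfadj T" "\<forall>x\<in>V. act T f x = 0" "\<forall>x\<in>V. g (T x) = T (g x)"
      and T': "selfadj T'" "\<forall>x\<in>V. act T' f x = 0" "\<forall>x\<in>V. h (T' x) = T' (h x)"
      unfolding field_op_def by (elim exE conjE)
    have df: "degree f \<ge> 2" using f b(1) prime_ge_2_nat by simp
    show ?thesis
    proof (rule conj_proper_field[OF card4 f(1) df T(1) _ _ T'(1) _ _ g(1) h(1)])
      show "act T f x = 0" if "x \<in> V" for x using T(2) that by (rule bspec)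
      show "g (T x) = T (g x)" if "x \<in> V" for x using T(3) that by (rule bspec)
      show "act T' f x = 0" if "x \<in> V" for x using T'(2) that by (rule bspec)
      show "(\<forall>x\<in>V. h (T' x) = T' (h x)) \<or> (\<forall>x\<in>V. h (T' x) = T' (h x) + h x)"
        using T'(3) by (rule disjI1)
    qed
  qed
qed

theorem prime_order_conj_proper:
  assumes card: "card V = 2 ^ (2 * k)" and k: "special k"
    and g: "isom g" "prime r" "\<And>x. x \<in> V \<Longrightarrow> (g ^^ r) x = x"
    and h: "isom h" "prime s" "\<And>x. x \<in> V \<Longrightarrow> (h ^^ s) x = x"
  shows "conj_proper g h"
proof -
  have "(2::nat) ^ 4 \<le> 2 ^ (2 * k)" using special_gt_1[OF k] by (intro power_increasing) auto
  then have card4: "card V > 4" using card by simp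
  obtain q where q: "quad q" "\<And>x. x \<in> V \<Longrightarrow> q (g x) = q x"
  proof (rule invariant_quad_exists[OF g(1)])
    fix p assume "quad p" "\<And>x. x \<in> V \<Longrightarrow> p (g x) = p x"
    then show thesis by (rule that)
  qed
  obtain q' where q': "quad q'" "\<And>x. x \<in> V \<Longrightarrow> q' (h x) = q' x"
  proof (rule invariant_quad_exists[OF h(1)])
    fix p assume "quad p" "\<And>x. x \<in> V \<Longrightarrow> p (h x) = p x"
    then show thesis by (rule that)
  qed
  show ?thesis
  \<comment> \<open>The split is over all pairs of invariant forms: its failure fixes the sign of
    every form invariant under \<open>g\<close> and of every form invariant under \<open>h\<close>,
    as \<open>invariant_vanishes\<close> requires.\<close>
  proof (cases "\<exists>p p'. quad p \<and> quad p' \<and> (\<forall>x\<in>V. p (g x) = p x) \<and> (\<forall>x\<in>V. p' (h x) = p' x) \<and> gauss p = gauss p'")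
    case True
    then obtain p p' where "quad p" "quad p'" "\<forall>x\<in>V. p (g x) = p x" "\<forall>x\<in>V. p' (h x) = p' x" "gauss p = gauss p'"
      by (elim exE conjE)
    then show ?thesis
      using conj_proper_quad[OF card4, of p p' g h] g(1) h(1) by simp
  next
    case False
    then have ne: "gauss p \<noteq> gauss p'" if "quad p" "quad p'" "\<And>x. x \<in> V \<Longrightarrow> p (g x) = p x"
      "\<And>x. x \<in> V \<Longrightarrow> p' (h x) = p' x" for p p'
      using that False by (intro notI) (elim notE, intro exI[of _ p] exI[of _ p'] conjI ballI)
    have "gauss q \<noteq> gauss q'" by (rule ne[OF q(1) q'(1)]) (rule q(2) q'(2); assumption)+
    then have opp: "gauss q' = - gauss q" using gauss_eq_or_neg[OF q(1) q'(1)] by simp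
    have vq: "q v = 0" if "v \<in> V" "g v = v" for v
    proof (rule invariant_vanishes[OF g(1) q(1) _ _ that])
      show "q (g x) = q x" if "x \<in> V" for x using that by (rule q(2))
      fix p assume p: "quad p" "\<And>x. x \<in> V \<Longrightarrow> p (g x) = p x"
      have "gauss p \<noteq> gauss q'" by (rule ne[OF p(1) q'(1)]) (rule p(2) q'(2); assumption)+
      then show "gauss p = gauss q" using gauss_eq_or_neg[OF q(1) p(1)] opp by simp
    qed
    have vq': "q' v = 0" if "v \<in> V" "h v = v" for v
    proof (rule invariant_vanishes[OF h(1) q'(1) _ _ that])
      show "q' (h x) = q' x" if "x \<in> V" for x using that by (rule q'(2))
      fix p assume p: "quad p" "\<And>x. x \<in> V \<Longrightarrow> p (h x) = p x"
      have "gauss q \<noteq> gauss p" by (rule ne[OF q(1) p(1)]) (rule p(2) q(2); assumption)+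
      then show "gauss p = gauss q'" using gauss_eq_or_neg[OF q'(1) p(1)] opp by simp
    qed
    show ?thesis
    proof (cases "gauss q < 0")
      case True
      then have "gauss q' > 0" using opp by simp
      show ?thesis
        by (rule conj_proper_opposite_types[OF card k g(1,2) _ h(1,2) _ q(1) _ _ q'(1)])
          ((rule g(3) h(3) q(2) q'(2) vq vq'; assumption) | (rule \<open>gauss q < 0\<close> \<open>gauss q' > 0\<close>))+
    next
      case False
      then have "gauss q > 0" using gauss_nonzero[OF q(1)] by simp
      then have "gauss q' < 0" using opp by simp
      have "conj_proper h g"
        by (rule conj_proper_opposite_types[OF card k h(1,2) _ g(1,2) _ q'(1) _ _ q(1)])
          ((rule g(3) h(3) q(2) q'(2) vq vq'; assumption) | (rule \<open>gauss q > 0\<close> \<open>gauss q' < 0\<close>))+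
      then show ?thesis by (rule conj_proper_sym)
    qed
  qed
qed

end

subsection \<open>Matrices\<close>

lemma UNIV_bit: "(UNIV :: bit set) = {0, 1}"
proof (rule Set.set_eqI)
  show "x \<in> UNIV \<longleftrightarrow> x \<in> {0, 1}" for x :: bit by (cases x) simp_all
qed

text \<open>Vectors of all lengths share one type, which is not a group. So a vector is represented
  by a function that is 0 from \<open>n\<close> on, and the space is
  \<open>pw n UNIV\<close>.\<close>

definition vmap :: "nat \<Rightarrow> bit mat \<Rightarrow> (nat \<Rightarrow> bit) \<Rightarrow> nat \<Rightarrow> bit" where
  "vmap n A \<phi> = (\<lambda>i. if i < n then (A *\<^sub>v vec n \<phi>) $ i else 0)"

definition mmap :: "nat \<Rightarrow> ((nat \<Rightarrow> bit) \<Rightarrow> nat \<Rightarrow> bit) \<Rightarrow> bit mat" where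
  "mmap n \<sigma> = mat n n (\<lambda>(i, j). \<sigma> (single j 1) i)"

lemma vec_vmap: "A \<in> carrier_mat n n \<Longrightarrow> vec n (vmap n A \<phi>) = A *\<^sub>v vec n \<phi>"
  by (intro eq_vecI) (auto simp: vmap_def)

lemma vmap_mult:
  assumes "A \<in> carrier_mat n n" "C \<in> carrier_mat n n"
  shows "vmap n (A * C) \<phi> = vmap n A (vmap n C \<phi>)"
  unfolding vmap_def[of n A] vmap_def[of n "A * C"] vec_vmap[OF assms(2)]
  by (subst assoc_mult_mat_vec[OF assms vec_carrier]) (rule refl)

lemma vmap_pw: "vmap n A \<phi> \<in> pw n UNIV"
  by (simp add: vmap_def pw_def)

lemma vec_pw_inj: "\<phi> \<in> pw n UNIV \<Longrightarrow> \<psi> \<in> pw n UNIV \<Longrightarrow> vec n \<phi> = vec n \<psi> \<Longrightarrow> \<phi> = (\<psi> :: nat \<Rightarrow> bit)"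
proof (rule ext)
  fix i assume a: "\<phi> \<in> pw n UNIV" "\<psi> \<in> pw n UNIV" "vec n \<phi> = vec n \<psi>"
  show "\<phi> i = \<psi> i"
  proof (cases "i < n")
    case True
    then have "vec n \<phi> $ i = \<phi> i" "vec n \<psi> $ i = \<psi> i" by simp_all
    then show ?thesis using a(3) by simp
  qed (use a in \<open>simp add: pw_def\<close>)
qed

lemma vec_pw_surj:
  assumes "u \<in> carrier_vec n"
  obtains \<phi> :: "nat \<Rightarrow> bit" where "\<phi> \<in> pw n UNIV" "u = vec n \<phi>"
proof
  show "(\<lambda>i. if i < n then u $ i else 0) \<in> pw n UNIV" by (simp add: pw_def)
  show "u = vec n (\<lambda>i. if i < n then u $ i else 0)" using assms by (intro eq_vecI) auto
qed

lemma vmap_one: "\<phi> \<in> pw n UNIV \<Longrightarrow> vmap n (1\<^sub>m n) \<phi> = \<phi>"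
  by (rule vec_pw_inj[OF vmap_pw], assumption)
    (subst vec_vmap[OF one_carrier_mat], rule one_mult_mat_vec[OF vec_carrier])

lemma vmap_add: "A \<in> carrier_mat n n \<Longrightarrow> vmap n A (\<phi> + \<psi>) = vmap n A \<phi> + vmap n A \<psi>"
proof -
  assume A: "A \<in> carrier_mat n n"
  have "vec n (\<phi> + \<psi>) = vec n \<phi> + vec n \<psi>" by (intro eq_vecI) auto
  then show ?thesis using A
    by (intro ext) (simp add: vmap_def mult_add_distrib_mat_vec[OF A, of "vec n \<phi>" "vec n \<psi>"])
qed

lemma subgp_pw_UNIV: "subgp (pw n (UNIV :: bit set))"
  by (simp add: subgp_def pw_def)

lemma vmap_mmap:
  assumes \<sigma>: "endo (pw n UNIV) \<sigma>" and \<phi>: "\<phi> \<in> pw n UNIV"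
  shows "vmap n (mmap n \<sigma>) \<phi> = \<sigma> \<phi>"
proof -
  define tr where "tr m = (\<lambda>i. if i < m then \<phi> i else 0)" for m :: nat
  have tr_pw: "tr m \<in> pw n UNIV" if "m \<le> n" for m using that by (auto simp: tr_def pw_def)
  have main: "\<sigma> (tr m) i = (\<Sum>j<m. \<sigma> (single j 1) i * \<phi> j)" if "m \<le> n" for m i
    using that
  proof (induction m)
    case 0
    have "tr 0 = 0" by (simp add: tr_def fun_eq_iff)
    then have "\<sigma> (tr 0) = 0" using endo_0[OF \<sigma>] by (simp only:)
    then have "\<sigma> (tr 0) i = (0 :: nat \<Rightarrow> bit) i" by (rule fun_cong)
    then show ?case by simp
  next
    case (Suc m)
    have s: "single m 1 \<in> pw n (UNIV :: bit set)"
      using Suc.prems by (intro single_pw) (auto simp: subgp_def)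
    have "tr (Suc m) = tr m + bsc (\<phi> m) (single m 1)"
      by (cases "\<phi> m") (auto simp: tr_def single_def fun_eq_iff less_Suc_eq)
    then have "\<sigma> (tr (Suc m)) = \<sigma> (tr m) + bsc (\<phi> m) (\<sigma> (single m 1))"
      using tr_pw[of m] Suc.prems bsc_closed[OF subgp_pw_UNIV s]
      by (simp add: endo_add[OF \<sigma>] endo_bsc[OF \<sigma>])
    then have "\<sigma> (tr (Suc m)) i = \<sigma> (tr m) i + \<sigma> (single m 1) i * \<phi> m"
      by (cases "\<phi> m") simp_all
    then show ?case using Suc by simp
  qed
  have tr: "tr n = \<phi>" using \<phi> by (auto simp: tr_def pw_def fun_eq_iff)
  have \<sigma>\<phi>: "\<sigma> \<phi> \<in> pw n UNIV" using \<sigma> \<phi> by (rule endo_closed)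
  show ?thesis
  proof (rule vec_pw_inj[OF vmap_pw \<sigma>\<phi>])
    show "vec n (vmap n (mmap n \<sigma>) \<phi>) = vec n (\<sigma> \<phi>)"
      using main[of n] unfolding tr
      by (intro eq_vecI)
        (auto simp: vmap_def mmap_def scalar_prod_def atLeast0LessThan intro!: sum.cong)
  qed
qed

lemma mmap_carrier_mat: "mmap n \<sigma> \<in> carrier_mat n n"
  by (simp add: mmap_def)

lemma mat_eq_vmap:
  assumes A: "A \<in> carrier_mat n n" and C: "C \<in> carrier_mat n n"
    and eq: "\<And>\<phi>. \<phi> \<in> pw n UNIV \<Longrightarrow> vmap n A \<phi> = vmap n C \<phi>"
  shows "A = C"
proof (rule eq_matI)
  fix i j assume "i < dim_row C" "j < dim_col C"
  then have ij: "i < n" "j < n" using C by auto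
  have "(A *\<^sub>v vec n (single j 1)) $ i = vmap n A (single j 1) i" using ij by (simp add: vmap_def)
  also have "\<dots> = vmap n C (single j 1) i"
    using ij by (subst eq) (auto intro!: single_pw simp: subgp_def)
  also have "\<dots> = (C *\<^sub>v vec n (single j 1)) $ i" using ij by (simp add: vmap_def)
  finally show "A $$ (i, j) = C $$ (i, j)"
    using ij A C by (simp add: scalar_prod_def single_def if_distrib cong: if_cong)
qed (use A C in auto)

section \<open>The matrix group and the subgroup generated by conjugates\<close>

locale symplectic_matrices =
  fixes n :: nat and \<omega> :: "bit vec \<Rightarrow> bit vec \<Rightarrow> bit"
  assumes form: "symplectic_form n \<omega>"
begin

lemma sympl_pw: "sympl (pw n UNIV) (\<lambda>\<phi> \<psi>. \<omega> (vec n \<phi>) (vec n \<psi>))"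
proof
  show "finite (pw n (UNIV :: bit set))" using card_pw[of "UNIV :: bit set" n] by (simp add: UNIV_bit)
  show "subgp (pw n (UNIV :: bit set))" by (rule subgp_pw_UNIV)
next
  fix \<phi> \<psi> \<chi> :: "nat \<Rightarrow> bit"
  have add: "vec n (\<phi> + \<psi>) = vec n \<phi> + vec n \<psi>" by (intro eq_vecI) auto
  show "\<omega> (vec n (\<phi> + \<psi>)) (vec n \<chi>) = \<omega> (vec n \<phi>) (vec n \<chi>) + \<omega> (vec n \<psi>) (vec n \<chi>)"
    "\<omega> (vec n \<chi>) (vec n (\<phi> + \<psi>)) = \<omega> (vec n \<chi>) (vec n \<phi>) + \<omega> (vec n \<chi>) (vec n \<psi>)"
    using form unfolding add symplectic_form_def bilinear_form_def by simp_all
next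
  fix \<phi> :: "nat \<Rightarrow> bit"
  show "\<omega> (vec n \<phi>) (vec n \<phi>) = 0"
    using form by (simp add: symplectic_form_def alternating_form_def)
next
  fix \<phi> :: "nat \<Rightarrow> bit"
  assume \<phi>: "\<phi> \<in> pw n UNIV" and z: "\<And>\<psi>. \<psi> \<in> pw n UNIV \<Longrightarrow> \<omega> (vec n \<phi>) (vec n \<psi>) = 0"
  have "\<omega> (vec n \<phi>) v = 0" if "v \<in> carrier_vec n" for v
    using vec_pw_surj[OF that] z by metis
  then have "vec n \<phi> = 0\<^sub>v n"
    using form by (simp add: symplectic_form_def nondegenerate_form_def)
  also have "0\<^sub>v n = vec n (0 :: nat \<Rightarrow> bit)" by (intro eq_vecI) auto
  finally show "\<phi> = 0" by (intro vec_pw_inj[OF \<phi>]) (simp_all add: pw_def)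
qed

sublocale sympl "pw n UNIV" "\<lambda>\<phi> \<psi>. \<omega> (vec n \<phi>) (vec n \<psi>)"
  by (rule sympl_pw)

abbreviation G where "G \<equiv> isometry_group n \<omega>"

sublocale G: group G
  by (rule group_isometry_group)

lemma carrier_matD: "A \<in> carrier G \<Longrightarrow> A \<in> carrier_mat n n"
  by (simp add: isometry_group_def)

lemma isom_vmap:
  assumes A: "A \<in> carrier G"
  shows "isom (vmap n A)"
  unfolding isom_def endo_def
proof (intro conjI ballI)
  fix \<phi> \<psi> :: "nat \<Rightarrow> bit"
  show "vmap n A (\<phi> + \<psi>) = vmap n A \<phi> + vmap n A \<psi>" by (rule vmap_add[OF carrier_matD[OF A]])
  show "\<omega> (vec n (vmap n A \<phi>)) (vec n (vmap n A \<psi>)) = \<omega> (vec n \<phi>) (vec n \<psi>)"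
    using A by (simp add: vec_vmap[OF carrier_matD[OF A]]) (simp add: isometry_group_def)
qed (rule subgp_pw_UNIV vmap_pw)+

lemma vmap_G_mult:
  "A \<in> carrier G \<Longrightarrow> C \<in> carrier G \<Longrightarrow> vmap n (A \<otimes>\<^bsub>G\<^esub> C) \<phi> = vmap n A (vmap n C \<phi>)"
  by (drule carrier_matD)+ (simp add: isometry_group_def vmap_mult)

lemma vmap_G_one: "\<phi> \<in> pw n UNIV \<Longrightarrow> vmap n \<one>\<^bsub>G\<^esub> \<phi> = \<phi>"
  by (simp add: isometry_group_def vmap_one)

lemma vmap_G_pow:
  assumes A: "A \<in> carrier G" and \<phi>: "\<phi> \<in> pw n UNIV"
  shows "vmap n (A [^]\<^bsub>G\<^esub> (m::nat)) \<phi> = (vmap n A ^^ m) \<phi>"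
  using \<phi>
proof (induction m arbitrary: \<phi>)
  case 0
  then show ?case by (simp add: vmap_G_one)
next
  case (Suc m)
  have "vmap n (A [^]\<^bsub>G\<^esub> Suc m) \<phi> = vmap n (A [^]\<^bsub>G\<^esub> m) (vmap n A \<phi>)"
    using A by (simp add: vmap_G_mult)
  also have "\<dots> = (vmap n A ^^ m) (vmap n A \<phi>)" by (rule Suc.IH[OF vmap_pw])
  finally show ?case by (simp add: funpow_swap1)
qed

lemma mmap_carrier:
  assumes \<sigma>: "isom \<sigma>"
  shows "mmap n \<sigma> \<in> carrier G"
proof -
  have inv: "mmap n a * mmap n b = 1\<^sub>m n"
    if ab: "isom a" "isom b" "\<And>\<phi>. \<phi> \<in> pw n UNIV \<Longrightarrow> a (b \<phi>) = \<phi>" for a b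
  proof (rule mat_eq_vmap)
    show "mmap n a * mmap n b \<in> carrier_mat n n"
      using mmap_carrier_mat mmap_carrier_mat by (rule mult_carrier_mat)
    fix \<phi> :: "nat \<Rightarrow> bit" assume \<phi>: "\<phi> \<in> pw n UNIV"
    show "vmap n (mmap n a * mmap n b) \<phi> = vmap n (1\<^sub>m n) \<phi>"
      using isom_closed[OF ab(2) \<phi>] ab(3)[OF \<phi>]
      by (simp add: vmap_mult mmap_carrier_mat vmap_mmap isom_endo ab \<phi> vmap_one)
  qed simp
  obtain \<sigma>' where \<sigma>': "isom \<sigma>'" "\<And>\<phi>. \<phi> \<in> pw n UNIV \<Longrightarrow> \<sigma>' (\<sigma> \<phi>) = \<phi>"
    "\<And>\<phi>. \<phi> \<in> pw n UNIV \<Longrightarrow> \<sigma> (\<sigma>' \<phi>) = \<phi>"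
    using isom_inverse[OF \<sigma>] by metis
  have "invertible_mat (mmap n \<sigma>)"
    unfolding invertible_mat_def inverts_mat_def
  proof (intro conjI exI[of _ "mmap n \<sigma>'"])
    show "mmap n \<sigma> * mmap n \<sigma>' = 1\<^sub>m (dim_row (mmap n \<sigma>))"
      using inv[OF \<sigma> \<sigma>'(1,3)] by (simp add: mmap_def)
    show "mmap n \<sigma>' * mmap n \<sigma> = 1\<^sub>m (dim_row (mmap n \<sigma>'))"
      using inv[OF \<sigma>'(1) \<sigma> \<sigma>'(2)] by (simp add: mmap_def)
  qed (simp add: mmap_def)
  moreover have "\<omega> (mmap n \<sigma> *\<^sub>v u) (mmap n \<sigma> *\<^sub>v v) = \<omega> u v"
    if uv: "u \<in> carrier_vec n" "v \<in> carrier_vec n" for u v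
  proof -
    obtain \<phi> where \<phi>: "\<phi> \<in> pw n UNIV" "u = vec n \<phi>" using vec_pw_surj[OF uv(1)] by metis
    obtain \<psi> where \<psi>: "\<psi> \<in> pw n UNIV" "v = vec n \<psi>" using vec_pw_surj[OF uv(2)] by metis
    have "\<omega> (vec n (\<sigma> \<phi>)) (vec n (\<sigma> \<psi>)) = \<omega> (vec n \<phi>) (vec n \<psi>)"
      using isom_B[OF \<sigma> \<phi>(1) \<psi>(1)] .
    then show ?thesis
      using \<phi> \<psi> by (simp add: vec_vmap[OF mmap_carrier_mat, symmetric] vmap_mmap[OF isom_endo[OF \<sigma>]])
  qed
  ultimately show ?thesis by (simp add: isometry_group_def mmap_carrier_mat)
qed

text \<open>Invariable generation conjugates with the inverse on the left, so carrying
  \<open>A\<close> over by \<sigma> amounts to conjugating by the inverse of the matrix of \<sigma>;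
  hence the double inverse.\<close>

lemma vmap_conj:
  assumes A: "A \<in> carrier G" and \<sigma>: "isom \<sigma>" and \<phi>: "\<phi> \<in> pw n UNIV"
  defines "S \<equiv> mmap n \<sigma>"
  shows "vmap n (inv\<^bsub>G\<^esub> (inv\<^bsub>G\<^esub> S) \<otimes>\<^bsub>G\<^esub> A \<otimes>\<^bsub>G\<^esub> inv\<^bsub>G\<^esub> S) (\<sigma> \<phi>) = \<sigma> (vmap n A \<phi>)"
proof -
  have S: "S \<in> carrier G" using \<sigma> unfolding S_def by (rule mmap_carrier)
  have vS: "vmap n S \<psi> = \<sigma> \<psi>" if "\<psi> \<in> pw n UNIV" for \<psi>
    unfolding S_def using isom_endo[OF \<sigma>] that by (rule vmap_mmap)
  have "S \<otimes>\<^bsub>G\<^esub> A \<otimes>\<^bsub>G\<^esub> inv\<^bsub>G\<^esub> S \<otimes>\<^bsub>G\<^esub> S = S \<otimes>\<^bsub>G\<^esub> A" using S A by (simp add: G.m_assoc)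
  then have "vmap n (S \<otimes>\<^bsub>G\<^esub> A \<otimes>\<^bsub>G\<^esub> inv\<^bsub>G\<^esub> S \<otimes>\<^bsub>G\<^esub> S) \<phi> = vmap n (S \<otimes>\<^bsub>G\<^esub> A) \<phi>" by (rule arg_cong)
  then show ?thesis
    using S A vS[OF \<phi>] vS[OF vmap_pw, of A \<phi>]
      vmap_G_mult[of "S \<otimes>\<^bsub>G\<^esub> A \<otimes>\<^bsub>G\<^esub> inv\<^bsub>G\<^esub> S" S \<phi>] vmap_G_mult[of S A \<phi>]
    by simp
qed

text \<open>The matrices whose maps satisfy \<open>Q\<close> form a subgroup. It contains the chosen
  conjugates of \<open>A\<close> and \<open>C\<close>, hence what they generate, but not the matrix
  of \<open>t\<close>.\<close>

lemma conj_proper_not_invariably_generates: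
  assumes A: "A \<in> carrier G" and C: "C \<in> carrier G" and cp: "conj_proper (vmap n A) (vmap n C)"
  shows "\<not> invariably_generates G [A, C]"
proof
  assume gen: "invariably_generates G [A, C]"
  obtain Q \<sigma> \<tau> t where Q: "subgroup_pred Q" and \<sigma>: "isom \<sigma>" and \<tau>: "isom \<tau>"
    and g: "\<forall>g'. isom g' \<and> (\<forall>x\<in>pw n UNIV. g' (\<sigma> x) = \<sigma> (vmap n A x)) \<longrightarrow> Q g'"
    and h: "\<forall>h'. isom h' \<and> (\<forall>x\<in>pw n UNIV. h' (\<tau> x) = \<tau> (vmap n C x)) \<longrightarrow> Q h'"
    and t: "isom t" "\<not> Q t"
    using cp unfolding conj_proper_def by (elim exE conjE) (rule that)
  have Q1: "Q (\<lambda>x. x)" and Q2: "\<forall>a b. isom a \<and> isom b \<and> Q a \<and> Q b \<longrightarrow> Q (\<lambda>x. a (b x))"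
    and Q3: "\<forall>a b. isom a \<and> isom b \<and> Q a \<and> (\<forall>x\<in>pw n UNIV. a (b x) = x) \<longrightarrow> Q b"
    and Q4: "\<forall>a b. Q a \<and> (\<forall>x\<in>pw n UNIV. b x = a x) \<longrightarrow> Q b"
    using Q unfolding subgroup_pred_def by - (elim conjE, assumption)+
  define H where "H = {M \<in> carrier G. Q (vmap n M)}"
  have H: "subgroup H G"
  proof (rule G.subgroupI)
    show "H \<subseteq> carrier G" by (simp add: H_def)
    have "Q (vmap n \<one>\<^bsub>G\<^esub>)" using Q4[rule_format, of "\<lambda>x. x"] Q1 vmap_G_one by simp
    then show "H \<noteq> {}" using G.one_closed unfolding H_def by auto
  next
    fix M assume M: "M \<in> H"
    then have MG: "M \<in> carrier G" "Q (vmap n M)" by (simp_all add: H_def)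
    have "vmap n M (vmap n (inv\<^bsub>G\<^esub> M) x) = x" if "x \<in> pw n UNIV" for x
      using MG vmap_G_mult[of M "inv\<^bsub>G\<^esub> M" x] vmap_G_one[OF that] by simp
    then have "Q (vmap n (inv\<^bsub>G\<^esub> M))"
      using Q3[rule_format, of "vmap n M" "vmap n (inv\<^bsub>G\<^esub> M)"] MG isom_vmap by simp
    then show "inv\<^bsub>G\<^esub> M \<in> H" using MG by (simp add: H_def)
  next
    fix M N assume "M \<in> H" "N \<in> H"
    then have MN: "M \<in> carrier G" "N \<in> carrier G" "Q (vmap n M)" "Q (vmap n N)" by (simp_all add: H_def)
    have "Q (\<lambda>x. vmap n M (vmap n N x))"
      using Q2[rule_format, of "vmap n M" "vmap n N"] MN isom_vmap by simp
    moreover have "vmap n (M \<otimes>\<^bsub>G\<^esub> N) = (\<lambda>x. vmap n M (vmap n N x))"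
      using MN by (intro ext vmap_G_mult)
    ultimately show "M \<otimes>\<^bsub>G\<^esub> N \<in> H" using MN by (simp add: H_def)
  qed
  define S where "S = inv\<^bsub>G\<^esub> mmap n \<sigma>"
  define T where "T = inv\<^bsub>G\<^esub> mmap n \<tau>"
  have ST: "S \<in> carrier G" "T \<in> carrier G" using mmap_carrier \<sigma> \<tau> by (simp_all add: S_def T_def)
  have "inv\<^bsub>G\<^esub> S \<otimes>\<^bsub>G\<^esub> A \<otimes>\<^bsub>G\<^esub> S \<in> H"
    using g[rule_format, of "vmap n (inv\<^bsub>G\<^esub> S \<otimes>\<^bsub>G\<^esub> A \<otimes>\<^bsub>G\<^esub> S)"] vmap_conj[OF A \<sigma>] isom_vmap ST A
    by (simp add: H_def S_def[symmetric])
  moreover have "inv\<^bsub>G\<^esub> T \<otimes>\<^bsub>G\<^esub> C \<otimes>\<^bsub>G\<^esub> T \<in> H"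
    using h[rule_format, of "vmap n (inv\<^bsub>G\<^esub> T \<otimes>\<^bsub>G\<^esub> C \<otimes>\<^bsub>G\<^esub> T)"] vmap_conj[OF C \<tau>] isom_vmap ST C
    by (simp add: H_def T_def[symmetric])
  ultimately have "generate G {inv\<^bsub>G\<^esub> S \<otimes>\<^bsub>G\<^esub> A \<otimes>\<^bsub>G\<^esub> S, inv\<^bsub>G\<^esub> T \<otimes>\<^bsub>G\<^esub> C \<otimes>\<^bsub>G\<^esub> T} \<subseteq> H"
    using H by (intro G.generate_subgroup_incl) simp_all
  moreover have "generate G {inv\<^bsub>G\<^esub> S \<otimes>\<^bsub>G\<^esub> A \<otimes>\<^bsub>G\<^esub> S, inv\<^bsub>G\<^esub> T \<otimes>\<^bsub>G\<^esub> C \<otimes>\<^bsub>G\<^esub> T} = carrier G"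
    using gen ST unfolding invariably_generates_pair by simp
  ultimately have "mmap n t \<in> H" using mmap_carrier[OF t(1)] by auto
  then have "Q (vmap n (mmap n t))" by (simp add: H_def)
  then have "Q t"
    using Q4[rule_format, of "vmap n (mmap n t)" t] vmap_mmap[OF isom_endo[OF t(1)]] by simp
  then show False using t(2) by simp
qed

end

theorem theorem1:
  fixes p a k :: nat and \<omega> :: "bit vec \<Rightarrow> bit vec \<Rightarrow> bit"
  assumes "prime p" and "a > 0" and "k > 0"
    and "k = p ^ a \<or> k = 2 * p ^ a \<or> k = 3 * p ^ a \<or> k = 6 * p ^ a \<or> k = 45"
    and "symplectic_form (2 * k) \<omega>"
  shows "\<not> (\<exists>g \<in> carrier (isometry_group (2 * k) \<omega>). \<exists>h \<in> carrier (isometry_group (2 * k) \<omega>).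
           prime (group.ord (isometry_group (2 * k) \<omega>) g) \<and>
           prime (group.ord (isometry_group (2 * k) \<omega>) h) \<and>
           invariably_generates (isometry_group (2 * k) \<omega>) [g, h])"
proof -
  interpret symplectic_matrices "2 * k" \<omega> by unfold_locales (rule assms(5))
  have special: "special k" unfolding special_def using assms(1,2,4) by auto
  have card: "card (pw (2 * k) (UNIV :: bit set)) = 2 ^ (2 * k)"
    using card_pw[of "UNIV :: bit set" "2 * k"] by (simp add: UNIV_bit numeral_2_eq_2)
  have "\<not> invariably_generates G [g, h]"
    if g: "g \<in> carrier G" "prime (G.ord g)" and h: "h \<in> carrier G" "prime (G.ord h)" for g h
  proof (rule conj_proper_not_invariably_generates[OF g(1) h(1)])
    show "conj_proper (vmap (2 * k) g) (vmap (2 * k) h)"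
    proof (rule prime_order_conj_proper[OF card special isom_vmap[OF g(1)] g(2) _ isom_vmap[OF h(1)] h(2)])
      fix \<phi> :: "nat \<Rightarrow> bit" assume \<phi>: "\<phi> \<in> pw (2 * k) UNIV"
      show "(vmap (2 * k) g ^^ G.ord g) \<phi> = \<phi>"
        using vmap_G_pow[OF g(1) \<phi>, of "G.ord g"] G.pow_ord_eq_1[OF g(1)] vmap_G_one[OF \<phi>] by simp
      show "(vmap (2 * k) h ^^ G.ord h) \<phi> = \<phi>"
        using vmap_G_pow[OF h(1) \<phi>, of "G.ord h"] G.pow_ord_eq_1[OF h(1)] vmap_G_one[OF \<phi>] by simp
    qed
  qed
  then show ?thesis by auto
qed

end
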